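(* Let $T\ge2$, $\mathcal{T}=\{1,\dots,T\}$, consider the special model described in the context, and fix $i\in\mathcal{T}$ with $i\ge2$. Let $$A^{\alpha}_1=\alpha^{-1/2}\operatorname{E}\bigg[C^{\alpha}_{i,T}-C^{\alpha}_{i,T-i+1}\prod_{s=T-i+1}^{T-1}f_s\,\Big|\,\mathcal{D}^{\alpha}\bigg],\qquad A^{\alpha}_2=\alpha^{1/2}\bigg(\prod_{s=T-i+1}^{T-1}f_s-\prod_{s=T-i+1}^{T-1}\widehat{f}_s\bigg).$$ Then $(A^{\alpha}_1)_{\alpha\ge0}$ and $(A^{\alpha}_2)_{\alpha\ge0}$ are independent and each converges in distribution, as $\alpha\to\infty$, to a normally distributed random variable with zero mean. In particular, $(A^{\alpha}_1A^{\alpha}_2)_{\alpha\ge0}$ converges in distribution to a random variable with zero mean.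
   Context: Special model. Fix an integer $T\ge2$, $\mathcal{T}=\{1,\dots,T\}$. For each $i\in\mathcal{T}$, $(M^{\alpha}_i)_{\alpha\ge0}$ is a homogeneous Poisson process with intensity $\lambda_i\in(0,\infty)$, and $(D_{i,k},Z_{i,k})_{k\ge1}$ is an i.i.d. sequence of pairs with $D_{i,k}\in\mathcal{T}$, with common distribution that of a generic pair $(D,Z)$ not depending on $i$, where $D$ and $Z$ are independent, $\operatorname{E}[Z^2]<\infty$ and $\operatorname{E}[ZI\{D=t\}]>0$ for all $t\in\mathcal{T}$. For each $i$, $(D_{i,k},Z_{i,k})_k$ is independent of $(M^\alpha_i)_\alpha$, and the families $\{(M^{\alpha}_i)_\alpha,(D_{i,k},Z_{i,k})_k\}$, $i=1,\dots,T$, are independent. Define $C^{\alpha}_{i,t}=\sum_{k=1}^{M^{\alpha}_i}Z_{i,k}I\{D_{i,k}\le t\}$. $\mathcal{D}^{\alpha}$ is the $\sigma$-algebra generated by $\{C^{\alpha}_{j,t}:j,t\in\mathcal{T},\ j+t\le T+1\}$. For $t\le T-1$: $\widehat{f}_t=\sum_{j=1}^{T-t}C^{\alpha}_{j,t+1}/\sum_{j=1}^{T-t}C^{\alpha}_{j,t}$ and $f_t=\operatorname{E}[ZI\{D\le t+1\}]/\operatorname{E}[ZI\{D\le t\}]$. *)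

theory Defs
  imports "HOL-Probability.Probability"
begin

definition hom_poisson_process :: "'a measure \<Rightarrow> real \<Rightarrow> (real \<Rightarrow> 'a \<Rightarrow> nat) \<Rightarrow> bool" where
  "hom_poisson_process M lam N \<longleftrightarrow>
     (\<forall>a\<ge>0. N a \<in> measurable M (count_space UNIV)) \<and>
     (\<forall>\<omega>\<in>space M. N 0 \<omega> = 0) \<and>
     (\<forall>\<omega>\<in>space M. \<forall>s t. 0 \<le> s \<longrightarrow> s \<le> t \<longrightarrow> N s \<omega> \<le> N t \<omega>) \<and>
     (\<forall>(n::nat) (t::nat \<Rightarrow> real). 0 \<le> t 0 \<longrightarrow> (\<forall>k<n. t k < t (Suc k)) \<longrightarrow>
        prob_space.indep_vars M (\<lambda>_. count_space UNIV)
          (\<lambda>k \<omega>. N (t (Suc k)) \<omega> - N (t k) \<omega>) {..<n}) \<and>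
     (\<forall>s t. 0 \<le> s \<longrightarrow> s < t \<longrightarrow>
        distr M (count_space UNIV) (\<lambda>\<omega>. N t \<omega> - N s \<omega>)
          = measure_pmf (poisson_pmf (lam * (t - s))))"

definition conv_distr_at_top :: "'a measure \<Rightarrow> (real \<Rightarrow> 'a \<Rightarrow> real) \<Rightarrow> real measure \<Rightarrow> bool" where
  "conv_distr_at_top M X L \<longleftrightarrow>
     (\<forall>a :: nat \<Rightarrow> real. filterlim a at_top sequentially \<longrightarrow>
        weak_conv_m (\<lambda>n. distr M borel (X (a n))) L)"

definition claims :: "(nat \<Rightarrow> real \<Rightarrow> 'a \<Rightarrow> nat) \<Rightarrow> (nat \<Rightarrow> nat \<Rightarrow> 'a \<Rightarrow> nat) \<Rightarrow>
    (nat \<Rightarrow> nat \<Rightarrow> 'a \<Rightarrow> real) \<Rightarrow> real \<Rightarrow> nat \<Rightarrow> nat \<Rightarrow> 'a \<Rightarrow> real" where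
  "claims N D Z \<alpha> i t \<omega> = (\<Sum>k=1..N i \<alpha> \<omega>. Z i k \<omega> * of_bool (D i k \<omega> \<le> t))"

definition obs_alg :: "'a measure \<Rightarrow> nat \<Rightarrow> (nat \<Rightarrow> nat \<Rightarrow> 'a \<Rightarrow> real) \<Rightarrow> 'a measure" where
  "obs_alg M T C = sigma (space M)
     (\<Union>j\<in>{1..T}. \<Union>t\<in>{1..T}. if j + t \<le> T + 1
        then {C j t -` B \<inter> space M | B. B \<in> sets borel} else {})"

text \<open>Chain-ladder estimator hat f_t = sum_{j=1}^{T-t} C_{j,t+1} / sum_{j=1}^{T-t} C_{j,t}
  (with Isabelle's convention x/0 = 0).\<close>
definition f_hat :: "nat \<Rightarrow> (nat \<Rightarrow> nat \<Rightarrow> 'a \<Rightarrow> real) \<Rightarrow> nat \<Rightarrow> 'a \<Rightarrow> real" where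
  "f_hat T C t \<omega> = (\<Sum>j=1..T-t. C j (t+1) \<omega>) / (\<Sum>j=1..T-t. C j t \<omega>)"

definition dev_factor :: "'a measure \<Rightarrow> ('a \<Rightarrow> nat) \<Rightarrow> ('a \<Rightarrow> real) \<Rightarrow> nat \<Rightarrow> real" where
  "dev_factor M D Z t =
     (\<integral>\<omega>. Z \<omega> * of_bool (D \<omega> \<le> t+1) \<partial>M) / (\<integral>\<omega>. Z \<omega> * of_bool (D \<omega> \<le> t) \<partial>M)"

text \<open>Independence of two random elements X, Y with possibly different value types
  (the library's indep_var requires equal value types; this is its definition unfolded).\<close>
definition indep_rv :: "'a measure \<Rightarrow> 'b measure \<Rightarrow> ('a \<Rightarrow> 'b) \<Rightarrow> 'c measure \<Rightarrow> ('a \<Rightarrow> 'c) \<Rightarrow> bool" where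
  "indep_rv M Ma X Mb Y \<longleftrightarrow>
     X \<in> measurable M Ma \<and> Y \<in> measurable M Mb \<and>
     prob_space.indep_set M {X -` A \<inter> space M | A. A \<in> sets Ma} {Y -` B \<inter> space M | B. B \<in> sets Mb}"

end

theory Submission
  imports Defs
begin

text \<open>
  Splitting the claims of row \<open>i\<close> by their delay gives independent compound Poisson sums, so
  \<open>C\<^sub>i\<^sub>,\<^sub>T - C\<^sub>i\<^sub>,\<^sub>T\<^sub>-\<^sub>i\<^sub>+\<^sub>1\<close> is uncorrelated with every event of the observed algebra and its
  conditional expectation is constant. Hence \<open>A\<^sub>1\<close> is almost surely a multiple of the centred and scaled
  \<open>C\<^sub>i\<^sub>,\<^sub>T\<^sub>-\<^sub>i\<^sub>+\<^sub>1\<close>, a function of row \<open>i\<close>, whereas \<open>A\<^sub>2\<close> depends on the rows \<open>j < i\<close> only.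
  A telescoping identity turns \<open>A\<^sub>2\<close> into a sum of centred compound Poisson sums whose random coefficients
  converge in probability, so that a central limit theorem for compound Poisson sums together with
  Slutsky's lemma yields both limits.
\<close>

text \<open>The conditional expectation is determined only up to a null set for each
  \<open>\<alpha>\<close>, and there are uncountably many \<open>\<alpha>\<close>, yet the claim
  concerns two whole processes. Independence is therefore proved for explicit versions
  \<open>A1'\<close> and \<open>A2'\<close> and then carried over. Independence of the split sums is
  not stated as such. What is used is \<open>E[1_A S] = E[S] P(A)\<close> for observed events
  \<open>A\<close> and the unobserved part \<open>S\<close> of row \<open>i\<close>, which is a
  Mecke formula. The limit of \<open>A1\<close> is centred for a structural reason: with
  \<open>m t = E[Z I{D \<le> t}]\<close> and \<open>s0 = T - i + 1\<close> the product of the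
  \<open>f s\<close> telescopes to \<open>m T / m s0\<close>, so the constant conditional mean of
  \<open>S\<close> is minus the mean of the remaining observed term, a multiple of the sum at
  \<open>s0\<close>. In \<open>A2\<close> the fluctuations for different \<open>s\<close> share rows
  and are dependent, so separate limit theorems would not combine. Their limiting linear combination
  is moved inside the marks and treated by a single central limit theorem. A normal density requires
  positive variance; the predicate \<open>nondeg\<close> keeps track of this.\<close>

section \<open>Convergence in probability and in distribution\<close>

text \<open>\<open>X\<^sub>n \<rightarrow> c\<close> in probability iff \<open>\<lambda>(n, \<omega>). X n \<omega>\<close> tends to \<open>c\<close> along this filter, so the limit
  calculus for filters applies to convergence in probability.\<close>

definition in_prob :: "'a measure \<Rightarrow> (nat \<times> 'a) filter" where
  "in_prob M = Abs_filter (\<lambda>P. \<forall>\<epsilon>>0. \<forall>\<^sub>F n in sequentially.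
     \<exists>A\<in>sets M. measure M A < \<epsilon> \<and> (\<forall>\<omega>\<in>space M - A. P (n, \<omega>)))"

text \<open>Two exceptional sets of measure below \<open>\<epsilon>/2\<close> unite to one below
  \<open>\<epsilon>\<close>, which gives closure under conjunction. The failures of \<open>P\<close>
  only have to lie inside a measurable \<open>A\<close>, so \<open>P\<close> itself may be
  non-measurable.\<close>

lemma (in finite_measure) eventually_in_prob:
  "eventually P (in_prob M) \<longleftrightarrow> (\<forall>\<epsilon>>0. \<forall>\<^sub>F n in sequentially.
     \<exists>A\<in>sets M. measure M A < \<epsilon> \<and> (\<forall>\<omega>\<in>space M - A. P (n, \<omega>)))"
  unfolding in_prob_def
proof (subst eventually_Abs_filter, rule is_filter.intro, goal_cases)
  case 1
  have "{} \<in> sets M" by simp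
  then show ?case by (force intro!: always_eventually)
next
  case (2 P Q)
  show ?case
  proof (intro allI impI)
    fix \<epsilon> :: real assume "\<epsilon> > 0"
    then have e: "\<epsilon>/2 > 0" by simp
    from 2(1)[rule_format, OF e] 2(2)[rule_format, OF e]
    show "\<forall>\<^sub>F n in sequentially.
      \<exists>A\<in>sets M. measure M A < \<epsilon> \<and> (\<forall>\<omega>\<in>space M - A. P (n, \<omega>) \<and> Q (n, \<omega>))"
    proof eventually_elim
      case (elim n)
      then obtain A B where "A \<in> sets M" "B \<in> sets M" "measure M A < \<epsilon>/2" "measure M B < \<epsilon>/2"
        "\<forall>\<omega>\<in>space M - A. P (n, \<omega>)" "\<forall>\<omega>\<in>space M - B. Q (n, \<omega>)" by blast
      moreover have "measure M (A \<union> B) \<le> measure M A + measure M B"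
        using \<open>A \<in> sets M\<close> \<open>B \<in> sets M\<close> by (rule measure_Un_le)
      ultimately show ?case by (intro bexI[of _ "A \<union> B"]) auto
    qed
  qed
next
  case (3 P Q)
  show ?case
  proof (intro allI impI)
    fix \<epsilon> :: real assume "\<epsilon> > 0"
    with 3(2) have "\<forall>\<^sub>F n in sequentially. \<exists>A\<in>sets M. measure M A < \<epsilon> \<and> (\<forall>\<omega>\<in>space M - A. P (n, \<omega>))"
      by blast
    then show "\<forall>\<^sub>F n in sequentially. \<exists>A\<in>sets M. measure M A < \<epsilon> \<and> (\<forall>\<omega>\<in>space M - A. Q (n, \<omega>))"
      by eventually_elim (use 3(1) in blast)
  qed
qed simp

text \<open>With the empty exceptional set, deterministic convergence becomes convergence in
  probability. This brings sequences such as \<open>1 / sqrt (a n)\<close> into the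
  calculus.\<close>

lemma (in finite_measure) filterlim_fst_in_prob: "filterlim fst sequentially (in_prob M)"
  unfolding filterlim_iff
proof (intro allI impI)
  fix P :: "nat \<Rightarrow> bool" assume P: "eventually P sequentially"
  show "eventually (\<lambda>x. P (fst x)) (in_prob M)"
    unfolding eventually_in_prob
  proof (intro allI impI)
    fix \<epsilon> :: real assume "\<epsilon> > 0"
    from P show "\<forall>\<^sub>F n in sequentially. \<exists>A\<in>sets M. measure M A < \<epsilon> \<and> (\<forall>\<omega>\<in>space M - A. P (fst (n, \<omega>)))"
      by eventually_elim (use \<open>\<epsilon> > 0\<close> in \<open>auto intro!: bexI[of _ "{}"]\<close>)
  qed
qed

lemma (in finite_measure) tendsto_in_prob_iff:
  fixes c :: real
  shows "((\<lambda>(n, \<omega>). X n \<omega>) \<longlongrightarrow> c) (in_prob M) \<longleftrightarrow> (\<forall>\<delta>>0. \<forall>\<epsilon>>0. \<forall>\<^sub>F n in sequentially.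
     \<exists>A\<in>sets M. measure M A < \<epsilon> \<and> (\<forall>\<omega>\<in>space M - A. \<bar>X n \<omega> - c\<bar> < \<delta>))"
  by (simp add: tendsto_iff eventually_in_prob dist_real_def)

definition tight_seq :: "'a measure \<Rightarrow> (nat \<Rightarrow> 'a \<Rightarrow> real) \<Rightarrow> bool" where
  "tight_seq M X \<longleftrightarrow> (\<forall>\<epsilon>>0. \<exists>K>0. \<forall>\<^sub>F n in sequentially. measure M {\<omega>\<in>space M. \<bar>X n \<omega>\<bar> > K} < \<epsilon>)"

text \<open>The rule o_P(1) O_P(1) = o_P(1): off a small set the bounds \<open>\<delta>/K\<close>
  for \<open>V n\<close> and \<open>K\<close> for \<open>U n\<close> hold together.\<close>

lemma (in finite_measure) tendsto_in_prob_mult_tight: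
  assumes [measurable]: "\<And>n. U n \<in> borel_measurable M"
    and U: "tight_seq M U" and V: "((\<lambda>(n, \<omega>). V n \<omega>) \<longlongrightarrow> 0) (in_prob M)"
  shows "((\<lambda>(n, \<omega>). V n \<omega> * U n \<omega>) \<longlongrightarrow> 0) (in_prob M)"
  unfolding tendsto_in_prob_iff
proof (intro allI impI)
  fix \<delta> \<epsilon> :: real assume d: "\<delta> > 0" and "\<epsilon> > 0"
  then have e: "\<epsilon>/2 > 0" by simp
  obtain K where K: "K > 0" and *: "\<forall>\<^sub>F n in sequentially. measure M {\<omega>\<in>space M. \<bar>U n \<omega>\<bar> > K} < \<epsilon>/2"
    using U[unfolded tight_seq_def, rule_format, OF e] by blast
  from d K have "\<delta>/K > 0" by simp
  from V[unfolded tendsto_in_prob_iff, rule_format, OF this e] *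
  show "\<forall>\<^sub>F n in sequentially. \<exists>A\<in>sets M. measure M A < \<epsilon> \<and> (\<forall>\<omega>\<in>space M - A. \<bar>V n \<omega> * U n \<omega> - 0\<bar> < \<delta>)"
  proof eventually_elim
    case (elim n)
    let ?B = "{\<omega>\<in>space M. \<bar>U n \<omega>\<bar> > K}"
    have B: "?B \<in> sets M" by measurable
    obtain A where A: "A \<in> sets M" "measure M A < \<epsilon>/2" "\<forall>\<omega>\<in>space M - A. \<bar>V n \<omega> - 0\<bar> < \<delta>/K"
      using elim(1) by blast
    have "\<bar>V n \<omega> * U n \<omega> - 0\<bar> < \<delta>" if "\<omega> \<in> space M - (A \<union> ?B)" for \<omega>
    proof -
      have "\<bar>V n \<omega>\<bar> < \<delta>/K" "\<bar>U n \<omega>\<bar> \<le> K" using that A(3) by auto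
      then have "\<bar>V n \<omega>\<bar> * \<bar>U n \<omega>\<bar> \<le> \<bar>V n \<omega>\<bar> * K" by (intro mult_left_mono) auto
      also have "\<dots> < \<delta>" using \<open>\<bar>V n \<omega>\<bar> < \<delta>/K\<close> K by (simp add: field_simps)
      finally show ?thesis by (simp add: abs_mult)
    qed
    moreover have "measure M (A \<union> ?B) \<le> measure M A + measure M ?B"
      using A(1) B by (rule measure_Un_le)
    ultimately show ?case using A(1,2) B elim(2) by (intro bexI[of _ "A \<union> ?B"]) auto
  qed
qed

text \<open>Weak convergence controls integrals of bounded continuous functions rather than tail
  probabilities. The tails are therefore dominated by continuous ramps, whose integrals under the
  limit law vanish as \<open>K\<close> grows.\<close>

lemma (in prob_space) weak_conv_imp_tight_seq:
  assumes [measurable]: "\<And>n. X n \<in> borel_measurable M"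
    and L: "real_distribution L" and w: "weak_conv_m (\<lambda>n. distr M borel (X n)) L"
  shows "tight_seq M X"
  unfolding tight_seq_def
proof (intro allI impI)
  fix \<epsilon> :: real assume e: "\<epsilon> > 0"
  interpret L: real_distribution L by fact
  \<comment> \<open>The ramp is 0 for \<open>\<bar>x\<bar> \<le> K\<close> and 1 from
    \<open>K + 1\<close> on, so it dominates the indicator of
    \<open>\<bar>x\<bar> > K + 1\<close>.\<close>
  define g where "g K x = min 1 (max 0 (\<bar>x\<bar> - real K))" for K and x :: real
  have g: "\<bar>g K x\<bar> \<le> 1" "isCont (g K) x" for K x
    unfolding g_def by (auto intro!: continuous_intros)
  then have [measurable]: "g K \<in> borel_measurable borel" for K
    by (intro borel_measurable_continuous_onI) (auto intro!: continuous_at_imp_continuous_on)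
  have "(\<lambda>K. integral\<^sup>L L (g K)) \<longlonglongrightarrow> integral\<^sup>L L (\<lambda>x. 0)"
  proof (rule integral_dominated_convergence[where w="\<lambda>_. 1"])
    show "AE x in L. (\<lambda>K. g K x) \<longlonglongrightarrow> 0"
    proof (intro always_eventually allI)
      fix x
      obtain K0 where "\<bar>x\<bar> \<le> real K0" using real_arch_simple by blast
      then show "(\<lambda>K. g K x) \<longlonglongrightarrow> 0"
        by (intro tendsto_eventually eventually_sequentiallyI[of K0]) (simp add: g_def)
    qed
  qed (use g(1) in auto)
  then have "(\<lambda>K. integral\<^sup>L L (g K)) \<longlonglongrightarrow> 0" by simp
  from order_tendstoD(2)[OF this e] obtain K where K: "integral\<^sup>L L (g K) < \<epsilon>"
    by (auto simp: eventually_sequentially)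
  have "(\<lambda>n. integral\<^sup>L (distr M borel (X n)) (g K)) \<longlonglongrightarrow> integral\<^sup>L L (g K)"
    by (rule weak_conv_imp_integral_bdd_continuous_conv[OF _ L w, where B=1]) (use g in auto)
  from order_tendstoD(2)[OF this K]
  have "\<forall>\<^sub>F n in sequentially. measure M {\<omega>\<in>space M. \<bar>X n \<omega>\<bar> > real K + 1} < \<epsilon>"
  proof eventually_elim
    case (elim n)
    have "measure M {\<omega>\<in>space M. \<bar>X n \<omega>\<bar> > real K + 1} = (\<integral>\<omega>. indicator {\<omega>\<in>space M. \<bar>X n \<omega>\<bar> > real K + 1} \<omega> \<partial>M)"
      by simp
    also have "\<dots> \<le> (\<integral>\<omega>. g K (X n \<omega>) \<partial>M)"
      by (intro integral_mono integrable_const_bound[where B=1])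
         (auto simp: g(1)[simplified] g_def split: split_indicator)
    finally show ?case using elim by (simp add: integral_distr)
  qed
  then show "\<exists>K>0. \<forall>\<^sub>F n in sequentially. measure M {\<omega>\<in>space M. \<bar>X n \<omega>\<bar> > K} < \<epsilon>"
    by (intro exI[of _ "real K + 1"]) auto
qed

text \<open>As \<open>iexp\<close> is 1-Lipschitz and of modulus 1, the characteristic functions at
  \<open>t\<close> differ by at most \<open>2 * P(A) + \<bar>t\<bar> * \<delta>\<close>, where
  \<open>\<bar>Y n - X n\<bar> < \<delta>\<close> off \<open>A\<close>. Levy's continuity theorem
  then transfers the limit.\<close>

lemma (in prob_space) slutsky:
  assumes [measurable]: "\<And>n. X n \<in> borel_measurable M" "\<And>n. Y n \<in> borel_measurable M"
    and L: "real_distribution L" and w: "weak_conv_m (\<lambda>n. distr M borel (X n)) L"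
    and d: "((\<lambda>(n, \<omega>). Y n \<omega> - X n \<omega>) \<longlongrightarrow> 0) (in_prob M)"
  shows "weak_conv_m (\<lambda>n. distr M borel (Y n)) L"
proof (rule levy_continuity[OF _ L])
  fix t
  define \<phi> \<psi> where "\<phi> n = char (distr M borel (X n)) t" and "\<psi> n = char (distr M borel (Y n)) t" for n
  have "\<phi> \<longlonglongrightarrow> char L t"
    unfolding \<phi>_def by (rule levy_continuity1[OF _ L w]) simp
  moreover have "(\<lambda>n. \<psi> n - \<phi> n) \<longlonglongrightarrow> 0"
  proof (rule LIMSEQ_I)
    fix r :: real assume r: "r > 0"
    \<comment> \<open>This keeps \<open>\<bar>t\<bar> * \<delta>\<close> below \<open>r/2\<close>,
      the summand 1 covering \<open>t = 0\<close>; the other half of \<open>r\<close> is spent on an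
      exceptional set of measure below \<open>r/4\<close>.\<close>
    define \<delta> where "\<delta> = r / (2 * (\<bar>t\<bar> + 1))"
    have \<delta>: "\<delta> > 0" "\<bar>t\<bar> * \<delta> < r / 2"
      using r by (auto simp: \<delta>_def field_simps)
    from r have "r/4 > 0" by simp
    from d[unfolded tendsto_in_prob_iff, rule_format, OF \<delta>(1) this]
    have "\<forall>\<^sub>F n in sequentially. norm (\<psi> n - \<phi> n - 0) < r"
    proof eventually_elim
      case (elim n)
      then obtain A where A[measurable]: "A \<in> sets M" and "measure M A < r/4"
        "\<forall>\<omega>\<in>space M - A. \<bar>Y n \<omega> - X n \<omega> - 0\<bar> < \<delta>" by blast
      have 1: "norm (iexp a - iexp b) \<le> \<bar>a - b\<bar>" for a b :: real
      proof -
        have "iexp a - iexp b = iexp b * (iexp (a - b) - 1)"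
          by (simp add: algebra_simps flip: exp_add)
        then have "norm (iexp a - iexp b) = norm (iexp (a - b) - 1)" by (simp add: norm_mult)
        also have "\<dots> \<le> \<bar>a - b\<bar>" using iexp_approx1[of "a-b" 0] by simp
        finally show ?thesis .
      qed
      have 2: "norm (iexp a - iexp b) \<le> 2" for a b :: real
        using norm_triangle_ineq4[of "iexp a" "iexp b"] by simp
      have "norm (\<psi> n - \<phi> n) = norm (\<integral>\<omega>. iexp (t * Y n \<omega>) - iexp (t * X n \<omega>) \<partial>M)"
        unfolding \<psi>_def \<phi>_def char_def
        by (subst Bochner_Integration.integral_diff) (auto simp: integral_distr integrable_iexp)
      also have "\<dots> \<le> (\<integral>\<omega>. norm (iexp (t * Y n \<omega>) - iexp (t * X n \<omega>)) \<partial>M)"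
        by (rule integral_norm_bound)
      also have "\<dots> \<le> (\<integral>\<omega>. 2 * indicator A \<omega> + \<bar>t\<bar> * \<delta> \<partial>M)"
      proof (rule integral_mono)
        show "integrable M (\<lambda>\<omega>. norm (iexp (t * Y n \<omega>) - iexp (t * X n \<omega>)))"
          by (intro integrable_norm Bochner_Integration.integrable_diff integrable_iexp) auto
        show "integrable M (\<lambda>\<omega>. 2 * indicator A \<omega> + \<bar>t\<bar> * \<delta>)"
          by (intro Bochner_Integration.integrable_add integrable_mult_right integrable_real_indicator)
             (auto simp: less_top[symmetric])
        fix \<omega> assume "\<omega> \<in> space M"
        show "norm (iexp (t * Y n \<omega>) - iexp (t * X n \<omega>)) \<le> 2 * indicator A \<omega> + \<bar>t\<bar> * \<delta>"
        proof (cases "\<omega> \<in> A")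
          case True
          have "0 \<le> \<bar>t\<bar> * \<delta>" using \<delta> by simp
          with True 2[of "t * Y n \<omega>" "t * X n \<omega>"] show ?thesis by simp
        next
          case False
          then have "\<bar>Y n \<omega> - X n \<omega>\<bar> \<le> \<delta>" using \<open>\<omega> \<in> space M\<close> \<open>\<forall>\<omega>\<in>space M - A. _\<close> by force
          then have "\<bar>t * Y n \<omega> - t * X n \<omega>\<bar> \<le> \<bar>t\<bar> * \<delta>"
            by (simp add: abs_mult mult_left_mono flip: right_diff_distrib)
          with 1[of "t * Y n \<omega>" "t * X n \<omega>"] False show ?thesis by simp
        qed
      qed
      also have "\<dots> = 2 * measure M A + \<bar>t\<bar> * \<delta>"
        by (subst Bochner_Integration.integral_add) (auto simp: prob_space less_top[symmetric])
      also have "\<dots> < r" using \<delta> \<open>measure M A < r/4\<close> by simp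
      finally show ?case by simp
    qed
    then show "\<exists>no. \<forall>n\<ge>no. norm (\<psi> n - \<phi> n - 0) < r" by (simp add: eventually_sequentially)
  qed
  ultimately have "(\<lambda>n. \<phi> n + (\<psi> n - \<phi> n)) \<longlonglongrightarrow> char L t + 0" by (rule tendsto_add)
  then show "(\<lambda>n. char (distr M borel (Y n)) t) \<longlonglongrightarrow> char L t" by (simp add: \<psi>_def)
qed simp

text \<open>By independence the law of the product depends only on the two marginal laws, so each
  factor may be replaced by its own Skorohod representation. On the product of the two representing
  spaces both factors converge pointwise, and dominated convergence applies to the characteristic
  functions.\<close>

lemma (in prob_space) weak_conv_indep_mult:
  assumes ind: "\<And>n. indep_var borel (X n) borel (Y n)"
    and A: "real_distribution A" and B: "real_distribution B"
    and wA: "weak_conv_m (\<lambda>n. distr M borel (X n)) A" and wB: "weak_conv_m (\<lambda>n. distr M borel (Y n)) B"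
  shows "weak_conv_m (\<lambda>n. distr M borel (\<lambda>\<omega>. X n \<omega> * Y n \<omega>)) (distr (A \<Otimes>\<^sub>M B) borel (\<lambda>(x, y). x * y))"
proof -
  have [measurable]: "X n \<in> borel_measurable M" "Y n \<in> borel_measurable M" for n
    using ind[of n] by (auto dest: indep_var_rv1 indep_var_rv2)
  interpret A: real_distribution A by fact
  interpret B: real_distribution B by fact
  obtain P :: "real measure" and X' X0 where P: "prob_space P" "\<And>n. X' n \<in> measurable P borel"
    "\<And>n. distr P borel (X' n) = distr M borel (X n)" "X0 \<in> measurable P lborel" "distr P borel X0 = A"
    "\<And>x. x \<in> space P \<Longrightarrow> (\<lambda>n. X' n x) \<longlonglongrightarrow> X0 x"
    using Skorohod[OF _ A wA] by (metis real_distribution_distr \<open>\<And>n. X n \<in> borel_measurable M\<close>)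
  obtain Q :: "real measure" and Y' Y0 where Q: "prob_space Q" "\<And>n. Y' n \<in> measurable Q borel"
    "\<And>n. distr Q borel (Y' n) = distr M borel (Y n)" "Y0 \<in> measurable Q lborel" "distr Q borel Y0 = B"
    "\<And>x. x \<in> space Q \<Longrightarrow> (\<lambda>n. Y' n x) \<longlonglongrightarrow> Y0 x"
    using Skorohod[OF _ B wB] by (metis real_distribution_distr \<open>\<And>n. Y n \<in> borel_measurable M\<close>)
  note [measurable] = P(2) Q(2)
  have [measurable]: "X0 \<in> borel_measurable P" "Y0 \<in> borel_measurable Q" using P(4) Q(4) by auto
  interpret P: prob_space P by fact
  interpret Q: prob_space Q by fact
  interpret PQ: pair_prob_space P Q ..
  interpret AB: pair_prob_space A B ..
  have sA: "sets A = sets borel" and sB: "sets B = sets borel" by simp_all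
  have [measurable]: "(\<lambda>(x, y). x * y :: real) \<in> borel_measurable (A \<Otimes>\<^sub>M B)"
    by (subst measurable_cong_sets[OF sets_pair_measure_cong[OF sA sB] refl]) measurable
  have pair: "distr (P \<Otimes>\<^sub>M Q) borel (\<lambda>p. f (fst p) * g (snd p)) =
      distr (distr P borel f \<Otimes>\<^sub>M distr Q borel g) borel (\<lambda>(x, y). x * y)"
    if [measurable]: "f \<in> borel_measurable P" "g \<in> borel_measurable Q" for f g :: "real \<Rightarrow> real"
    by (subst pair_measure_distr)
       (auto simp: distr_distr comp_def case_prod_beta
          intro!: prob_space_imp_sigma_finite Q.prob_space_distr)
  have 1: "distr M borel (\<lambda>\<omega>. X n \<omega> * Y n \<omega>) = distr (P \<Otimes>\<^sub>M Q) borel (\<lambda>p. X' n (fst p) * Y' n (snd p))" for n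
  proof -
    have "distr M borel (\<lambda>\<omega>. X n \<omega> * Y n \<omega>) = distr (distr M (borel \<Otimes>\<^sub>M borel) (\<lambda>\<omega>. (X n \<omega>, Y n \<omega>))) borel (\<lambda>(x, y). x * y)"
      by (subst distr_distr) (auto simp: comp_def)
    also have "distr M (borel \<Otimes>\<^sub>M borel) (\<lambda>\<omega>. (X n \<omega>, Y n \<omega>)) = distr M borel (X n) \<Otimes>\<^sub>M distr M borel (Y n)"
      using ind[of n] by (simp add: indep_var_distribution_eq)
    finally show ?thesis by (simp add: pair P(3) Q(3))
  qed
  have 2: "distr (A \<Otimes>\<^sub>M B) borel (\<lambda>(x, y). x * y) = distr (P \<Otimes>\<^sub>M Q) borel (\<lambda>p. X0 (fst p) * Y0 (snd p))"
    by (simp add: pair P(5) Q(5))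
  show ?thesis unfolding 1 2
  proof (rule levy_continuity)
    fix t
    have "(\<lambda>n. \<integral>p. iexp (t * (X' n (fst p) * Y' n (snd p))) \<partial>(P \<Otimes>\<^sub>M Q)) \<longlonglongrightarrow>
        (\<integral>p. iexp (t * (X0 (fst p) * Y0 (snd p))) \<partial>(P \<Otimes>\<^sub>M Q))"
    proof (rule integral_dominated_convergence[where w="\<lambda>_. 1"])
      show "AE p in P \<Otimes>\<^sub>M Q. (\<lambda>n. iexp (t * (X' n (fst p) * Y' n (snd p)))) \<longlonglongrightarrow> iexp (t * (X0 (fst p) * Y0 (snd p)))"
        by (rule AE_I2) (auto simp: space_pair_measure intro!: tendsto_intros P(6) Q(6))
    qed auto
    then show "(\<lambda>n. char (distr (P \<Otimes>\<^sub>M Q) borel (\<lambda>p. X' n (fst p) * Y' n (snd p))) t) \<longlonglongrightarrow>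
        char (distr (P \<Otimes>\<^sub>M Q) borel (\<lambda>p. X0 (fst p) * Y0 (snd p))) t"
      by (simp add: char_def integral_distr)
  qed (auto intro!: PQ.real_distribution_distr)
qed

section \<open>Compound Poisson sums\<close>

lemma (in prob_space) indep_rv_distr_pair:
  assumes "indep_rv M Ma X Mb Y"
  shows "distr M (Ma \<Otimes>\<^sub>M Mb) (\<lambda>\<omega>. (X \<omega>, Y \<omega>)) = distr M Ma X \<Otimes>\<^sub>M distr M Mb Y"
proof (rule pair_measure_eqI[symmetric])
  have [measurable]: "X \<in> measurable M Ma" "Y \<in> measurable M Mb" using assms by (auto simp: indep_rv_def)
  show "sigma_finite_measure (distr M Ma X)" "sigma_finite_measure (distr M Mb Y)"
    by (auto intro!: prob_space_imp_sigma_finite prob_space_distr)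
  show "sets (distr M Ma X \<Otimes>\<^sub>M distr M Mb Y) = sets (distr M (Ma \<Otimes>\<^sub>M Mb) (\<lambda>\<omega>. (X \<omega>, Y \<omega>)))"
    by (simp cong: sets_pair_measure_cong)
  fix A B assume "A \<in> sets (distr M Ma X)" "B \<in> sets (distr M Mb Y)"
  then have AB[measurable]: "A \<in> sets Ma" "B \<in> sets Mb" by auto
  have "prob ((X -` A \<inter> space M) \<inter> (Y -` B \<inter> space M)) = prob (X -` A \<inter> space M) * prob (Y -` B \<inter> space M)"
    using assms AB by (intro indep_setD) (auto simp: indep_rv_def)
  moreover have "(\<lambda>\<omega>. (X \<omega>, Y \<omega>)) -` (A \<times> B) \<inter> space M = (X -` A \<inter> space M) \<inter> (Y -` B \<inter> space M)" by auto
  ultimately show "emeasure (distr M Ma X) A * emeasure (distr M Mb Y) B =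
      emeasure (distr M (Ma \<Otimes>\<^sub>M Mb) (\<lambda>\<omega>. (X \<omega>, Y \<omega>))) (A \<times> B)"
    by (simp add: emeasure_distr emeasure_eq_measure ennreal_mult'')
qed

lemma (in prob_space) indep_set_mono:
  "indep_set A B \<Longrightarrow> A' \<subseteq> A \<Longrightarrow> B' \<subseteq> B \<Longrightarrow> indep_set A' B'"
  unfolding indep_sets2_eq by blast

lemma (in prob_space) indep_rv_compose:
  assumes "indep_rv M Ma X Mb Y" and [measurable]: "f \<in> measurable Ma Na" "g \<in> measurable Mb Nb"
  shows "indep_rv M Na (\<lambda>\<omega>. f (X \<omega>)) Nb (\<lambda>\<omega>. g (Y \<omega>))"
proof -
  have X[measurable]: "X \<in> measurable M Ma" "Y \<in> measurable M Mb" using assms(1) by (auto simp: indep_rv_def)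
  have "{(\<lambda>\<omega>. f (X \<omega>)) -` A \<inter> space M |A. A \<in> sets Na} \<subseteq> {X -` A \<inter> space M |A. A \<in> sets Ma}"
  proof safe
    fix A assume "A \<in> sets Na"
    then show "\<exists>B. (\<lambda>\<omega>. f (X \<omega>)) -` A \<inter> space M = X -` B \<inter> space M \<and> B \<in> sets Ma"
      using measurable_space[OF X(1)] by (intro exI[of _ "f -` A \<inter> space Ma"]) (auto intro: measurable_sets assms)
  qed
  moreover have "{(\<lambda>\<omega>. g (Y \<omega>)) -` A \<inter> space M |A. A \<in> sets Nb} \<subseteq> {Y -` A \<inter> space M |A. A \<in> sets Mb}"
  proof safe
    fix A assume "A \<in> sets Nb"
    then show "\<exists>B. (\<lambda>\<omega>. g (Y \<omega>)) -` A \<inter> space M = Y -` B \<inter> space M \<and> B \<in> sets Mb"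
      using measurable_space[OF X(2)] by (intro exI[of _ "g -` A \<inter> space Mb"]) (auto intro: measurable_sets assms)
  qed
  ultimately have "indep_set {(\<lambda>\<omega>. f (X \<omega>)) -` A \<inter> space M |A. A \<in> sets Na} {(\<lambda>\<omega>. g (Y \<omega>)) -` A \<inter> space M |A. A \<in> sets Nb}"
    using assms(1) unfolding indep_rv_def by (blast intro: indep_set_mono)
  then show ?thesis by (simp add: indep_rv_def)
qed

lemma (in prob_space) indep_rv_if_indep_var:
  assumes "indep_var Ma X Mb Y"
  shows "indep_rv M Ma X Mb Y"
  using assms unfolding indep_rv_def indep_var_eq indep_sets2_eq
  by (auto intro: sigma_sets.Basic)

text \<open>Fubini for the product law, with \<open>X\<close> frozen at a value while
  \<open>Y\<close> stays a random variable on \<open>M\<close>. In this form, statements about a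
  fixed number \<open>n\<close> of marks can be inserted under the integral over the Poisson
  count.\<close>

lemma (in prob_space) nn_integral_indep_rv:
  assumes I: "indep_rv M Ma X Mb Y" and [measurable]: "f \<in> borel_measurable (Ma \<Otimes>\<^sub>M Mb)"
  shows "(\<integral>\<^sup>+\<omega>. f (X \<omega>, Y \<omega>) \<partial>M) = (\<integral>\<^sup>+x. \<integral>\<^sup>+\<omega>. f (x, Y \<omega>) \<partial>M \<partial>distr M Ma X)"
proof -
  have [measurable]: "X \<in> measurable M Ma" "Y \<in> measurable M Mb" using I by (auto simp: indep_rv_def)
  interpret Y: prob_space "distr M Mb Y" by (rule prob_space_distr) simp
  have "(\<integral>\<^sup>+\<omega>. f (X \<omega>, Y \<omega>) \<partial>M) = (\<integral>\<^sup>+p. f p \<partial>distr M (Ma \<Otimes>\<^sub>M Mb) (\<lambda>\<omega>. (X \<omega>, Y \<omega>)))"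
    by (simp add: nn_integral_distr)
  also have "\<dots> = (\<integral>\<^sup>+x. \<integral>\<^sup>+y. f (x, y) \<partial>distr M Mb Y \<partial>distr M Ma X)"
    unfolding indep_rv_distr_pair[OF I] by (subst Y.nn_integral_fst[symmetric]) auto
  also have "\<dots> = (\<integral>\<^sup>+x. \<integral>\<^sup>+\<omega>. f (x, Y \<omega>) \<partial>M \<partial>distr M Ma X)"
    by (intro nn_integral_cong nn_integral_distr) auto
  finally show ?thesis .
qed

lemma (in prob_space) integral_indep_rv:
  fixes f :: "_ \<Rightarrow> 'c::{banach, second_countable_topology}"
  assumes I: "indep_rv M Ma X Mb Y" and [measurable]: "f \<in> borel_measurable (Ma \<Otimes>\<^sub>M Mb)"
    and f: "integrable M (\<lambda>\<omega>. f (X \<omega>, Y \<omega>))"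
  shows "(\<integral>\<omega>. f (X \<omega>, Y \<omega>) \<partial>M) = (\<integral>x. \<integral>\<omega>. f (x, Y \<omega>) \<partial>M \<partial>distr M Ma X)"
proof -
  have [measurable]: "X \<in> measurable M Ma" "Y \<in> measurable M Mb" using I by (auto simp: indep_rv_def)
  interpret Y: prob_space "distr M Mb Y" by (rule prob_space_distr) simp
  interpret X: prob_space "distr M Ma X" by (rule prob_space_distr) simp
  interpret XY: pair_sigma_finite "distr M Ma X" "distr M Mb Y" ..
  have "(\<integral>\<omega>. f (X \<omega>, Y \<omega>) \<partial>M) = (\<integral>p. f p \<partial>distr M (Ma \<Otimes>\<^sub>M Mb) (\<lambda>\<omega>. (X \<omega>, Y \<omega>)))"
    by (simp add: integral_distr)
  also have "\<dots> = (\<integral>x. \<integral>y. f (x, y) \<partial>distr M Mb Y \<partial>distr M Ma X)"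
    unfolding indep_rv_distr_pair[OF I]
    by (rule XY.integral_fst'[symmetric])
       (simp flip: indep_rv_distr_pair[OF I] add: integrable_distr_eq f)
  also have "\<dots> = (\<integral>x. \<integral>\<omega>. f (x, Y \<omega>) \<partial>M \<partial>distr M Ma X)"
    by (intro Bochner_Integration.integral_cong refl integral_distr) auto
  finally show ?thesis .
qed

text \<open>The random upper limit takes countably many values, and for each of them the sum is
  finite and measurable.\<close>

lemma measurable_sum_countable_bound [measurable (raw)]:
  fixes F :: "nat \<Rightarrow> 'a \<Rightarrow> 'b::{second_countable_topology, topological_comm_monoid_add}"
  assumes "n \<in> measurable M (count_space UNIV)"
    and "\<And>k. k \<ge> 1 \<Longrightarrow> F k \<in> borel_measurable M"
  shows "(\<lambda>\<omega>. \<Sum>k=1..n \<omega>. F k \<omega>) \<in> borel_measurable M"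
  by (rule measurable_compose_countable[OF _ assms(1)], rule borel_measurable_sum) (use assms(2) in auto)

text \<open>The argument is complex because values of characteristic functions will be inserted for
  \<open>z\<close>; \<open>norm z \<le> 1\<close> keeps the integrand bounded, and the series is
  that of \<open>exp\<close>.\<close>

lemma poisson_pgf:
  fixes z :: complex
  assumes c: "c > 0" and z: "norm z \<le> 1"
  shows "(\<integral>n. z ^ n \<partial>measure_pmf (poisson_pmf c)) = exp (of_real c * (z - 1))"
proof -
  let ?f = "\<lambda>n. pmf (poisson_pmf c) n *\<^sub>R z ^ n"
  have "norm (z ^ n) \<le> 1" for n using z by (simp add: norm_power power_le_one)
  then have int: "integrable (measure_pmf (poisson_pmf c)) (\<lambda>n. z ^ n)"
    by (intro measure_pmf.integrable_const_bound[where B=1]) auto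
  have "(\<integral>n. z ^ n \<partial>measure_pmf (poisson_pmf c)) = (\<integral>n. ?f n \<partial>count_space UNIV)"
    unfolding measure_pmf_eq_density by (rule integral_density) auto
  moreover have "?f sums (\<integral>n. ?f n \<partial>count_space UNIV)"
    using int unfolding measure_pmf_eq_density
    by (intro sums_integral_count_space_nat) (subst (asm) integrable_density, auto)
  moreover have "?f sums (exp (- of_real c) * exp (of_real c * z))"
  proof -
    have "?f = (\<lambda>n. exp (- of_real c) * ((of_real c * z) ^ n /\<^sub>R fact n))"
      using c by (auto simp: fun_eq_iff scaleR_conv_of_real power_mult_distrib divide_inverse exp_of_real[symmetric])
    then show ?thesis by (simp only:) (intro sums_mult exp_converges)
  qed
  ultimately have "(\<integral>n. z ^ n \<partial>measure_pmf (poisson_pmf c)) = exp (- of_real c) * exp (of_real c * z)"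
    using sums_unique2 by metis
  then show ?thesis by (simp add: exp_add[symmetric] algebra_simps)
qed

text \<open>The mark space \<open>S\<close> is arbitrary, so that several real functions of the same
  marks, such as payments up to different delays, can be summed over one and the same
  configuration.\<close>

locale compound_poisson = prob_space M for M :: "'a measure" +
  fixes S :: "'b measure" and \<mu> :: "'b measure" and X :: "nat \<Rightarrow> 'a \<Rightarrow> 'b" and N :: "'a \<Rightarrow> nat" and c :: real
  assumes c_pos: "c > 0"
    and N_distr: "distr M (count_space UNIV) N = measure_pmf (poisson_pmf c)"
    and X_indep: "indep_vars (\<lambda>_. S) X {1..}"
    and X_distr: "\<And>k. k \<ge> 1 \<Longrightarrow> distr M S (X k) = \<mu>"
    and NX: "indep_rv M (count_space UNIV) N (\<Pi>\<^sub>M k\<in>{1..}. S) (\<lambda>\<omega>. \<lambda>k\<in>{1..}. X k \<omega>)"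
begin

lemma N_meas [measurable]: "N \<in> measurable M (count_space UNIV)"
  using NX by (simp add: indep_rv_def)

lemma X_meas [measurable (raw)]: "k \<ge> 1 \<Longrightarrow> X k \<in> measurable M S"
  using X_indep by (auto simp: indep_vars_def)

lemma sets_\<mu> [measurable_cong]: "sets \<mu> = sets S"
  using X_distr[of 1] by (metis sets_distr order_refl)

lemma prob_space_\<mu>: "prob_space \<mu>"
  using X_distr[of 1] prob_space_distr[OF X_meas, of 1] by simp

text \<open>For a frozen count \<open>n\<close> the sum of i.i.d. terms has characteristic function
  \<open>?\<phi> ^ n\<close>; averaging over the count evaluates the Poisson generating function at
  \<open>?\<phi>\<close>.\<close>

lemma char_compound:
  assumes [measurable]: "h \<in> borel_measurable S"
  shows "char (distr M borel (\<lambda>\<omega>. \<Sum>k=1..N \<omega>. h (X k \<omega>))) t = exp (of_real c * (char (distr \<mu> borel h) t - 1))"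
proof -
  interpret \<mu>: prob_space \<mu> by (rule prob_space_\<mu>)
  have [measurable]: "h \<in> borel_measurable \<mu>" by measurable
  let ?\<phi> = "char (distr \<mu> borel h) t"
  let ?f = "\<lambda>(n, x). iexp (t * (\<Sum>k=1..n. h (x k)))"
  have [measurable]: "?f \<in> borel_measurable (count_space UNIV \<Otimes>\<^sub>M (\<Pi>\<^sub>M k\<in>{1::nat..}. S))"
    by measurable
  have "char (distr M borel (\<lambda>\<omega>. \<Sum>k=1..N \<omega>. h (X k \<omega>))) t = (\<integral>\<omega>. ?f (N \<omega>, \<lambda>k\<in>{1..}. X k \<omega>) \<partial>M)"
    by (simp add: char_def integral_distr)
  also have "\<dots> = (\<integral>n. (\<integral>\<omega>. ?f (n, \<lambda>k\<in>{1..}. X k \<omega>) \<partial>M) \<partial>measure_pmf (poisson_pmf c))"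
    unfolding N_distr[symmetric]
    by (rule integral_indep_rv[OF NX]) (auto intro!: integrable_const_bound[where B=1])
  also have "(\<lambda>n. \<integral>\<omega>. ?f (n, \<lambda>k\<in>{1..}. X k \<omega>) \<partial>M) = (\<lambda>n. ?\<phi> ^ n)"
  proof
    fix n
    have "indep_vars (\<lambda>_. borel) (\<lambda>k \<omega>. h (X k \<omega>)) {1..n}"
      by (rule indep_vars_subset[OF indep_vars_compose2[OF X_indep]]) auto
    then have "char (distr M borel (\<lambda>\<omega>. \<Sum>k\<in>{1..n}. h (X k \<omega>))) t =
        (\<Prod>k\<in>{1..n}. char (distr M borel (\<lambda>\<omega>. h (X k \<omega>))) t)"
      by (rule char_distr_sum)
    also have "\<dots> = (\<Prod>k\<in>{1..n}. ?\<phi>)"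
    proof (rule prod.cong[OF refl])
      fix k assume k: "k \<in> {1..n}"
      then have "distr \<mu> borel h = distr M borel (\<lambda>\<omega>. h (X k \<omega>))"
        using X_distr[of k, symmetric] by (simp add: distr_distr comp_def)
      then show "char (distr M borel (\<lambda>\<omega>. h (X k \<omega>))) t = ?\<phi>" by simp
    qed
    finally show "(\<integral>\<omega>. ?f (n, \<lambda>k\<in>{1..}. X k \<omega>) \<partial>M) = ?\<phi> ^ n"
      by (simp add: char_def integral_distr)
  qed
  also have "(\<integral>n. ?\<phi> ^ n \<partial>measure_pmf (poisson_pmf c)) = exp (of_real c * (?\<phi> - 1))"
    by (rule poisson_pgf[OF c_pos]) (rule real_distribution.cmod_char_le_1, simp)
  finally show ?thesis .
qed

section \<open>Mecke formula for compound Poisson sums\<close>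

text \<open>The product law of the marks is invariant under exchanging coordinates \<open>k\<close>
  and \<open>n\<close>, and this transposition carries \<open>{1..n-1}\<close> onto
  \<open>{1..n}-{k}\<close>. All \<open>t \<in> I\<close> are treated jointly, since
  \<open>B\<close> is an event about the whole vector of sums.\<close>

lemma emeasure_partial_sums:
  assumes [measurable]: "\<And>t. t \<in> I \<Longrightarrow> g t \<in> borel_measurable S" and B[measurable]: "B \<in> sets (\<Pi>\<^sub>M t\<in>I. borel)"
    and k: "k \<in> {1..n}"
  shows "emeasure M {\<omega>\<in>space M. (\<lambda>t\<in>I. \<Sum>l\<in>{1..n}-{k}. g t (X l \<omega>) :: real) \<in> B} =
    emeasure M {\<omega>\<in>space M. (\<lambda>t\<in>I. \<Sum>l\<in>{1..n-1}. g t (X l \<omega>)) \<in> B}"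
proof -
  interpret \<mu>: prob_space \<mu> by (rule prob_space_\<mu>)
  define f where "f = Transposition.transpose k n"
  let ?P = "\<Pi>\<^sub>M l\<in>{1::nat..}. \<mu>"
  have [measurable]: "g t \<in> borel_measurable \<mu>" if "t \<in> I" for t using that by measurable
  have Xd: "distr M ?P (\<lambda>\<omega>. \<lambda>l\<in>{1..}. X l \<omega>) = ?P"
  proof -
    have "distr M (\<Pi>\<^sub>M l\<in>{1::nat..}. S) (\<lambda>\<omega>. \<lambda>l\<in>{1..}. X l \<omega>) = (\<Pi>\<^sub>M l\<in>{1..}. distr M S (X l))"
      using X_indep by (subst (asm) indep_vars_iff_distr_eq_PiM') auto
    moreover have "(\<Pi>\<^sub>M l\<in>{1..}. distr M S (X l)) = ?P"
      by (rule PiM_cong) (auto simp: X_distr)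
    moreover have "distr M ?P (\<lambda>\<omega>. \<lambda>l\<in>{1..}. X l \<omega>) = distr M (\<Pi>\<^sub>M l\<in>{1::nat..}. S) (\<lambda>\<omega>. \<lambda>l\<in>{1..}. X l \<omega>)"
      by (rule distr_cong) (auto intro!: sets_PiM_cong sets_\<mu>)
    ultimately show ?thesis by simp
  qed
  have Xm[measurable]: "(\<lambda>\<omega>. \<lambda>l\<in>{1..}. X l \<omega>) \<in> measurable M ?P"
    by (rule measurable_restrict) auto
  let ?A = "\<lambda>J. {x \<in> space ?P. (\<lambda>t\<in>I. \<Sum>l\<in>J. g t (x l)) \<in> B}"
  have A: "?A J \<in> sets ?P" if "J \<subseteq> {1..}" for J
  proof -
    have "(\<lambda>x. \<lambda>t\<in>I. \<Sum>l\<in>J. g t (x l)) \<in> measurable ?P (\<Pi>\<^sub>M t\<in>I. borel)"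
      using that by (intro measurable_restrict borel_measurable_sum) (auto intro!: measurable_compose[OF measurable_component_singleton])
    from measurable_sets[OF this B] show ?thesis by (simp add: vimage_def Int_def conj_commute)
  qed
  have 1: "emeasure M {\<omega>\<in>space M. (\<lambda>t\<in>I. \<Sum>l\<in>J. g t (X l \<omega>)) \<in> B} = emeasure ?P (?A J)"
    if J: "J \<subseteq> {1..}" for J
  proof -
    have "emeasure ?P (?A J) = emeasure M ((\<lambda>\<omega>. \<lambda>l\<in>{1..}. X l \<omega>) -` ?A J \<inter> space M)"
      by (subst Xd[symmetric], rule emeasure_distr[OF Xm A[OF J]])
    also have "(\<lambda>\<omega>. \<lambda>l\<in>{1..}. X l \<omega>) -` ?A J \<inter> space M = {\<omega>\<in>space M. (\<lambda>t\<in>I. \<Sum>l\<in>J. g t (X l \<omega>)) \<in> B}"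
    proof -
      have "(\<Sum>l\<in>J. g t ((\<lambda>l\<in>{1..}. X l \<omega>) l)) = (\<Sum>l\<in>J. g t (X l \<omega>))" for t \<omega>
        using J by (intro sum.cong) auto
      then show ?thesis using measurable_space[OF Xm] by auto
    qed
    finally show ?thesis by (rule sym)
  qed
  have fP: "f ` {1..} \<subseteq> {1..}" "inj_on f {1..}"
    using k by (auto simp: f_def Transposition.transpose_def inj_on_def split: if_splits)
  have fd: "distr ?P ?P (\<lambda>x. \<lambda>l\<in>{1..}. x (f l)) = ?P"
    using distr_PiM_reindex[of "{1..}" "\<lambda>_. \<mu>" f "{1..}"] fP \<mu>.prob_space_axioms by auto
  have fm: "(\<lambda>x. \<lambda>l\<in>{1..}. x (f l)) \<in> measurable ?P ?P"
    using fP by (intro measurable_restrict) auto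
  have "emeasure ?P (?A ({1..n-1})) = emeasure ?P ((\<lambda>x. \<lambda>l\<in>{1..}. x (f l)) -` ?A {1..n-1} \<inter> space ?P)"
    by (subst fd[symmetric], rule emeasure_distr[OF fm A]) auto
  also have "(\<lambda>x. \<lambda>l\<in>{1..}. x (f l)) -` ?A {1..n-1} \<inter> space ?P = ?A ({1..n}-{k})"
  proof -
    have img: "f ` {1..n-1} = {1..n} - {k}"
    proof -
      have "bij f" by (simp add: f_def)
      have "f ` {1..n} = {1..n}" using k unfolding f_def by (intro transpose_image_eq) auto
      moreover have "{1..n-1} = {1..n} - {n}" using k by auto
      ultimately show ?thesis using \<open>bij f\<close>
        by (simp add: image_set_diff[OF bij_is_inj]) (simp add: f_def)
    qed
    have "inj_on f {1..n-1}" by (rule inj_on_subset[OF fP(2)]) auto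
    then have "(\<Sum>l\<in>{1..n-1}. g t ((\<lambda>l\<in>{1..}. x (f l)) l)) = (\<Sum>l\<in>{1..n}-{k}. g t (x l))" for t x
      unfolding img[symmetric] by (subst sum.reindex) (auto intro!: sum.cong)
    then show ?thesis using measurable_space[OF fm] by auto
  qed
  finally have "emeasure ?P (?A {1..n-1}) = emeasure ?P (?A ({1..n}-{k}))" .
  moreover have "{1..n}-{k} \<subseteq> {1..}" "{1..n-1} \<subseteq> {1..}" by auto
  ultimately show ?thesis by (simp only: 1)
qed

text \<open>The mark \<open>X k\<close> is independent of the block of the other marks up to
  \<open>n\<close>, so its factor splits off. The remaining probability is written with
  \<open>{1..n-1}\<close>, hence without \<open>k\<close>, so that summing over \<open>k\<close>
  will produce the factor \<open>n\<close>.\<close>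

lemma nn_integral_times_partial_sums:
  assumes [measurable]: "h \<in> borel_measurable S" "\<And>t. t \<in> I \<Longrightarrow> g t \<in> borel_measurable S"
    and B[measurable]: "B \<in> sets (\<Pi>\<^sub>M t\<in>I. borel)" and k: "k \<in> {1..n}"
  shows "(\<integral>\<^sup>+\<omega>. h (X k \<omega>) * indicator B (\<lambda>t\<in>I. \<Sum>l\<in>{1..n}-{k}. g t (X l \<omega>) :: real) \<partial>M) =
    (\<integral>\<^sup>+x. h x \<partial>\<mu>) * emeasure M {\<omega>\<in>space M. (\<lambda>t\<in>I. \<Sum>l\<in>{1..n-1}. g t (X l \<omega>)) \<in> B}"
proof -
  let ?J = "{1..n}-{k}"
  let ?\<beta> = "emeasure M {\<omega>\<in>space M. (\<lambda>t\<in>I. \<Sum>l\<in>{1..n-1}. g t (X l \<omega>)) \<in> B}"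
  have [measurable]: "X k \<in> measurable M S" "\<And>l. l \<in> ?J \<Longrightarrow> X l \<in> measurable M S" using k by (auto intro: X_meas)
  have "indep_var (PiM {k} (\<lambda>_. S)) (\<lambda>\<omega>. restrict (\<lambda>i. X i \<omega>) {k}) (PiM ?J (\<lambda>_. S)) (\<lambda>\<omega>. restrict (\<lambda>i. X i \<omega>) ?J)"
    using k by (intro indep_var_restrict[OF X_indep]) auto
  note I = indep_rv_if_indep_var[OF this]
  let ?f = "\<lambda>(p, y). h (p k) * indicator B (\<lambda>t\<in>I. \<Sum>l\<in>?J. g t (y l))"
  have sm: "(\<lambda>y. \<lambda>t\<in>I. \<Sum>l\<in>?J. g t (y l)) \<in> measurable (PiM ?J (\<lambda>_. S)) (\<Pi>\<^sub>M t\<in>I. borel)"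
    by (intro measurable_restrict borel_measurable_sum) (auto intro!: measurable_compose[OF measurable_component_singleton])
  have [measurable]: "(\<lambda>p. h (p k)) \<in> borel_measurable (PiM {k} (\<lambda>_. S))"
    by (auto intro!: measurable_compose[OF measurable_component_singleton])
  have [measurable]: "(\<lambda>y. indicator B (\<lambda>t\<in>I. \<Sum>l\<in>?J. g t (y l)) :: ennreal) \<in> borel_measurable (PiM ?J (\<lambda>_. S))"
    using sm by measurable
  have [measurable]: "(\<lambda>\<omega>. restrict (\<lambda>i. X i \<omega>) ?J) \<in> measurable M (PiM ?J (\<lambda>_. S))"
      "(\<lambda>\<omega>. restrict (\<lambda>i. X i \<omega>) {k}) \<in> measurable M (PiM {k} (\<lambda>_. S))"
    using I by (simp_all add: indep_rv_def)
  have eq: "(\<lambda>t\<in>I. \<Sum>l\<in>?J. g t (restrict (\<lambda>i. X i \<omega>) ?J l)) = (\<lambda>t\<in>I. \<Sum>l\<in>?J. g t (X l \<omega>))" for \<omega>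
    by (intro restrict_ext sum.cong) auto
  have m2: "(\<lambda>\<omega>. indicator B (\<lambda>t\<in>I. \<Sum>l\<in>?J. g t (X l \<omega>)) :: ennreal) \<in> borel_measurable M"
    using measurable_compose[of "\<lambda>\<omega>. restrict (\<lambda>i. X i \<omega>) ?J" M _ "\<lambda>y. indicator B (\<lambda>t\<in>I. \<Sum>l\<in>?J. g t (y l)) :: ennreal"]
    unfolding eq by measurable
  have s: "{\<omega>\<in>space M. (\<lambda>t\<in>I. \<Sum>l\<in>?J. g t (X l \<omega>)) \<in> B} \<in> sets M"
  proof -
    have "(\<lambda>\<omega>. \<lambda>t\<in>I. \<Sum>l\<in>?J. g t (X l \<omega>)) \<in> measurable M (\<Pi>\<^sub>M t\<in>I. borel)"
      by (intro measurable_restrict borel_measurable_sum measurable_compose[OF X_meas assms(2)]) auto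
    from measurable_sets[OF this B] show ?thesis by (simp add: vimage_def Int_def conj_commute)
  qed
  have "(\<integral>\<^sup>+\<omega>. h (X k \<omega>) * indicator B (\<lambda>t\<in>I. \<Sum>l\<in>?J. g t (X l \<omega>)) \<partial>M) =
      (\<integral>\<^sup>+\<omega>. ?f (restrict (\<lambda>i. X i \<omega>) {k}, restrict (\<lambda>i. X i \<omega>) ?J) \<partial>M)"
    by (simp only: eq prod.case) simp
  also have "\<dots> = (\<integral>\<^sup>+p. \<integral>\<^sup>+\<omega>. ?f (p, restrict (\<lambda>i. X i \<omega>) ?J) \<partial>M \<partial>distr M (PiM {k} (\<lambda>_. S)) (\<lambda>\<omega>. restrict (\<lambda>i. X i \<omega>) {k}))"
    by (rule nn_integral_indep_rv[OF I]) measurable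
  also have "(\<lambda>p. \<integral>\<^sup>+\<omega>. ?f (p, restrict (\<lambda>i. X i \<omega>) ?J) \<partial>M) = (\<lambda>p. h (p k) * ?\<beta>)"
  proof
    fix p
    have "(\<integral>\<^sup>+\<omega>. ?f (p, restrict (\<lambda>i. X i \<omega>) ?J) \<partial>M) =
        h (p k) * (\<integral>\<^sup>+\<omega>. indicator B (\<lambda>t\<in>I. \<Sum>l\<in>?J. g t (X l \<omega>)) \<partial>M)"
      unfolding prod.case eq by (rule nn_integral_cmult[OF m2])
    also have "(\<integral>\<^sup>+\<omega>. indicator B (\<lambda>t\<in>I. \<Sum>l\<in>?J. g t (X l \<omega>)) \<partial>M) =
        (\<integral>\<^sup>+\<omega>. indicator {\<omega>\<in>space M. (\<lambda>t\<in>I. \<Sum>l\<in>?J. g t (X l \<omega>)) \<in> B} \<omega> \<partial>M)"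
      by (intro nn_integral_cong) (auto split: split_indicator)
    also have "\<dots> = ?\<beta>" using s emeasure_partial_sums[OF assms(2) B k] by simp
    finally show "(\<integral>\<^sup>+\<omega>. ?f (p, restrict (\<lambda>i. X i \<omega>) ?J) \<partial>M) = h (p k) * ?\<beta>" .
  qed
  also have "(\<integral>\<^sup>+p. h (p k) * ?\<beta> \<partial>distr M (PiM {k} (\<lambda>_. S)) (\<lambda>\<omega>. restrict (\<lambda>i. X i \<omega>) {k})) =
      (\<integral>\<^sup>+\<omega>. h (X k \<omega>) \<partial>M) * ?\<beta>"
    by (simp add: nn_integral_distr nn_integral_multc)
  also have "(\<integral>\<^sup>+\<omega>. h (X k \<omega>) \<partial>M) = (\<integral>\<^sup>+x. h x \<partial>\<mu>)"
    using k X_distr[of k, symmetric] by (simp add: nn_integral_distr)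
  finally show ?thesis .
qed

abbreviation "PX \<equiv> \<Pi>\<^sub>M k\<in>{1::nat..}. S"
abbreviation "seqX \<equiv> \<lambda>\<omega>. \<lambda>k\<in>{1::nat..}. X k \<omega>"

lemma nn_integral_poisson: "(\<integral>\<^sup>+n. f n \<partial>measure_pmf (poisson_pmf c)) = (\<Sum>n. ennreal (pmf (poisson_pmf c) n) * f n)"
  by (simp add: nn_integral_measure_pmf nn_integral_count_space_nat)

lemma compound_measurable:
  assumes "\<And>t. t \<in> I \<Longrightarrow> g t \<in> borel_measurable S"
  shows "(\<lambda>(n, x). \<lambda>t\<in>I. \<Sum>k=1..n. g t (x k) :: real) \<in> measurable (count_space UNIV \<Otimes>\<^sub>M PX) (\<Pi>\<^sub>M t\<in>I. borel)"
  unfolding case_prod_beta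
  by (intro measurable_restrict measurable_sum_countable_bound)
     (auto intro!: measurable_compose[OF _ assms] measurable_compose[OF measurable_snd] measurable_component_singleton)

text \<open>A Mecke formula: as \<open>h\<close> and \<open>g\<close> live on disjoint sets of marks, deleting the atom counted by \<open>h\<close>
  leaves the sums of the \<open>g t\<close> unchanged, and \<open>n P(N = n) = c P(N = n - 1)\<close>.\<close>

lemma nn_integral_mecke:
  assumes [measurable]: "h \<in> borel_measurable S" "\<And>t. t \<in> I \<Longrightarrow> g t \<in> borel_measurable S"
    and B[measurable]: "B \<in> sets (\<Pi>\<^sub>M t\<in>I. borel)"
    and disj: "\<And>x t. t \<in> I \<Longrightarrow> h x \<noteq> 0 \<Longrightarrow> g t x = 0"
  shows "(\<integral>\<^sup>+\<omega>. (\<Sum>k=1..N \<omega>. h (X k \<omega>)) * indicator B (\<lambda>t\<in>I. \<Sum>k=1..N \<omega>. g t (X k \<omega>) :: real) \<partial>M) =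
    ennreal c * (\<integral>\<^sup>+x. h x \<partial>\<mu>) * (\<integral>\<^sup>+\<omega>. indicator B (\<lambda>t\<in>I. \<Sum>k=1..N \<omega>. g t (X k \<omega>) :: real) \<partial>M)"
proof -
  define \<beta> where "\<beta> n = emeasure M {\<omega>\<in>space M. (\<lambda>t\<in>I. \<Sum>l\<in>{1..n}. g t (X l \<omega>)) \<in> B}" for n
  let ?H = "\<integral>\<^sup>+x. h x \<partial>\<mu>"
  have cm: "(\<lambda>(n, x). \<lambda>t\<in>I. \<Sum>k=1..n. g t (x k)) \<in> measurable (count_space UNIV \<Otimes>\<^sub>M PX) (\<Pi>\<^sub>M t\<in>I. borel)"
    by (rule compound_measurable) (rule assms(2))
  have vm: "(\<lambda>\<omega>. \<lambda>t\<in>I. \<Sum>k\<in>J. g t (X k \<omega>)) \<in> measurable M (\<Pi>\<^sub>M t\<in>I. borel)" if "J \<subseteq> {1..}" for J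
    using that by (intro measurable_restrict borel_measurable_sum) (auto intro!: measurable_compose[OF X_meas])
  have eq: "(\<lambda>t\<in>I. \<Sum>k=1..n. g t (seqX \<omega> k)) = (\<lambda>t\<in>I. \<Sum>k=1..n. g t (X k \<omega>))"
    "(\<Sum>k=1..n. h (seqX \<omega> k)) = (\<Sum>k=1..n. h (X k \<omega>))" for n \<omega>
    by (intro restrict_ext sum.cong; auto)+
  have i\<beta>: "(\<integral>\<^sup>+\<omega>. indicator B (\<lambda>t\<in>I. \<Sum>k=1..n. g t (X k \<omega>)) \<partial>M) = \<beta> n" for n
  proof -
    have "{\<omega>\<in>space M. (\<lambda>t\<in>I. \<Sum>l\<in>{1..n}. g t (X l \<omega>)) \<in> B} \<in> sets M"
      using measurable_sets[OF vm[of "{1..n}"] B] by (simp add: vimage_def Int_def conj_commute subset_iff)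
    then have "\<beta> n = (\<integral>\<^sup>+\<omega>. indicator {\<omega>\<in>space M. (\<lambda>t\<in>I. \<Sum>l\<in>{1..n}. g t (X l \<omega>)) \<in> B} \<omega> \<partial>M)"
      by (simp add: \<beta>_def)
    then show ?thesis by (simp add: indicator_def cong: nn_integral_cong)
  qed
  have fixed: "(\<integral>\<^sup>+\<omega>. (\<Sum>k=1..n. h (X k \<omega>)) * indicator B (\<lambda>t\<in>I. \<Sum>k=1..n. g t (X k \<omega>)) \<partial>M) =
      of_nat n * ?H * \<beta> (n - 1)" for n
  proof -
    have "(\<integral>\<^sup>+\<omega>. (\<Sum>k=1..n. h (X k \<omega>)) * indicator B (\<lambda>t\<in>I. \<Sum>k=1..n. g t (X k \<omega>)) \<partial>M) =
        (\<integral>\<^sup>+\<omega>. (\<Sum>k=1..n. h (X k \<omega>) * indicator B (\<lambda>t\<in>I. \<Sum>l\<in>{1..n}-{k}. g t (X l \<omega>))) \<partial>M)"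
    proof (intro nn_integral_cong, subst sum_distrib_right, intro sum.cong refl)
      fix \<omega> k assume k: "k \<in> {1..n}"
      \<comment> \<open>A mark on which \<open>h\<close> is nonzero contributes 0 to every sum of a
        \<open>g t\<close>; where \<open>h\<close> vanishes, both sides are 0 anyway.\<close>
      have "(\<lambda>t\<in>I. \<Sum>l=1..n. g t (X l \<omega>)) = (\<lambda>t\<in>I. \<Sum>l\<in>{1..n}-{k}. g t (X l \<omega>))" if "h (X k \<omega>) \<noteq> 0"
        using disj[OF _ that] k by (intro restrict_ext) (simp add: sum.remove)
      then show "h (X k \<omega>) * indicator B (\<lambda>t\<in>I. \<Sum>l=1..n. g t (X l \<omega>)) =
          h (X k \<omega>) * indicator B (\<lambda>t\<in>I. \<Sum>l\<in>{1..n}-{k}. g t (X l \<omega>))"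
        by (cases "h (X k \<omega>) = 0") auto
    qed
    also have "\<dots> = (\<Sum>k=1..n. \<integral>\<^sup>+\<omega>. h (X k \<omega>) * indicator B (\<lambda>t\<in>I. \<Sum>l\<in>{1..n}-{k}. g t (X l \<omega>)) \<partial>M)"
    proof (rule nn_integral_sum)
      fix k assume "k \<in> {1..n}"
      then have "X k \<in> measurable M S" by (auto intro: X_meas)
      moreover have "(\<lambda>\<omega>. \<lambda>t\<in>I. \<Sum>l\<in>{1..n}-{k}. g t (X l \<omega>)) \<in> measurable M (\<Pi>\<^sub>M t\<in>I. borel)"
        by (rule vm) auto
      ultimately show "(\<lambda>\<omega>. h (X k \<omega>) * indicator B (\<lambda>t\<in>I. \<Sum>l\<in>{1..n}-{k}. g t (X l \<omega>))) \<in> borel_measurable M"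
        by measurable
    qed
    also have "\<dots> = (\<Sum>k=1..n. ?H * \<beta> (n - 1))"
      unfolding \<beta>_def by (intro sum.cong refl nn_integral_times_partial_sums) auto
    also have "\<dots> = of_nat n * ?H * \<beta> (n - 1)" by (simp add: mult.assoc)
    finally show ?thesis .
  qed
  have "(\<integral>\<^sup>+\<omega>. (\<Sum>k=1..N \<omega>. h (X k \<omega>)) * indicator B (\<lambda>t\<in>I. \<Sum>k=1..N \<omega>. g t (X k \<omega>)) \<partial>M) =
      (\<integral>\<^sup>+\<omega>. (\<lambda>(n, x). (\<Sum>k=1..n. h (x k)) * indicator B (\<lambda>t\<in>I. \<Sum>k=1..n. g t (x k))) (N \<omega>, seqX \<omega>) \<partial>M)"
    by (simp only: eq prod.case)
  also have "\<dots> = (\<integral>\<^sup>+n. \<integral>\<^sup>+\<omega>. (\<lambda>(n, x). (\<Sum>k=1..n. h (x k)) * indicator B (\<lambda>t\<in>I. \<Sum>k=1..n. g t (x k))) (n, seqX \<omega>) \<partial>M \<partial>measure_pmf (poisson_pmf c))"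
    unfolding N_distr[symmetric]
  proof (rule nn_integral_indep_rv[OF NX])
    have [measurable]: "(\<lambda>p. indicator B (\<lambda>t\<in>I. \<Sum>k=1..fst p. g t (snd p k)) :: ennreal) \<in> borel_measurable (count_space UNIV \<Otimes>\<^sub>M PX)"
      using measurable_compose[OF cm borel_measurable_indicator[OF B]] by (simp add: case_prod_beta)
    show "(\<lambda>(n, x). (\<Sum>k=1..n. h (x k)) * indicator B (\<lambda>t\<in>I. \<Sum>k=1..n. g t (x k))) \<in> borel_measurable (count_space UNIV \<Otimes>\<^sub>M PX)"
      unfolding case_prod_beta by measurable
  qed
  also have "\<dots> = (\<integral>\<^sup>+n. of_nat n * ?H * \<beta> (n - 1) \<partial>measure_pmf (poisson_pmf c))"
    by (simp only: eq prod.case fixed)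
  also have "\<dots> = (\<Sum>n. ennreal (pmf (poisson_pmf c) n) * (of_nat n * ?H * \<beta> (n - 1)))"
    by (rule nn_integral_poisson)
  \<comment> \<open>The term \<open>n = 0\<close>, in which \<open>n - 1\<close> truncates to 0,
    carries the factor \<open>of_nat 0\<close>; dropping it allows the index shift.\<close>
  also have "\<dots> = (\<Sum>n. ennreal (pmf (poisson_pmf c) (Suc n)) * (of_nat (Suc n) * ?H * \<beta> n))"
  proof -
    let ?a = "\<lambda>n. ennreal (pmf (poisson_pmf c) n) * (of_nat n * ?H * \<beta> (n - 1))"
    have "(\<lambda>n. ?a (Suc n)) sums (\<Sum>n. ?a (Suc n))" by (rule summable_sums) simp
    then have "?a sums ((\<Sum>n. ?a (Suc n)) + ?a 0)" by (rule sums_Suc)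
    then show ?thesis by (simp add: sums_iff)
  qed
  also have "\<dots> = (\<Sum>n. (ennreal c * ?H) * (ennreal (pmf (poisson_pmf c) n) * \<beta> n))"
  proof (intro arg_cong[where f=suminf] ext)
    fix n
    have "pmf (poisson_pmf c) (Suc n) * real (Suc n) = c * pmf (poisson_pmf c) n"
    proof -
      have "(fact (Suc n) :: real) = real (Suc n) * fact n" by (rule fact_Suc)
      then show ?thesis using c_pos by (simp del: fact_Suc of_nat_Suc)
    qed
    then have "ennreal (pmf (poisson_pmf c) (Suc n)) * of_nat (Suc n) = ennreal c * ennreal (pmf (poisson_pmf c) n)"
      by (metis ennreal_mult'' ennreal_of_nat_eq_real_of_nat of_nat_0_le_iff pmf_nonneg)
    then show "ennreal (pmf (poisson_pmf c) (Suc n)) * (of_nat (Suc n) * ?H * \<beta> n) =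
        (ennreal c * ?H) * (ennreal (pmf (poisson_pmf c) n) * \<beta> n)"
      by (metis mult.assoc mult.commute)
  qed
  also have "\<dots> = ennreal c * ?H * (\<Sum>n. ennreal (pmf (poisson_pmf c) n) * \<beta> n)"
    by (rule ennreal_suminf_cmult)
  also have "(\<Sum>n. ennreal (pmf (poisson_pmf c) n) * \<beta> n) = (\<integral>\<^sup>+n. \<beta> n \<partial>measure_pmf (poisson_pmf c))"
    by (rule nn_integral_poisson[symmetric])
  also have "\<dots> = (\<integral>\<^sup>+n. \<integral>\<^sup>+\<omega>. (\<lambda>(n, x). indicator B (\<lambda>t\<in>I. \<Sum>k=1..n. g t (x k))) (n, seqX \<omega>) \<partial>M \<partial>measure_pmf (poisson_pmf c))"
    by (simp only: eq prod.case i\<beta>)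
  also have "\<dots> = (\<integral>\<^sup>+\<omega>. (\<lambda>(n, x). indicator B (\<lambda>t\<in>I. \<Sum>k=1..n. g t (x k))) (N \<omega>, seqX \<omega>) \<partial>M)"
    unfolding N_distr[symmetric]
    by (rule nn_integral_indep_rv[OF NX, symmetric])
       (use measurable_compose[OF cm borel_measurable_indicator[OF B]] in \<open>simp only: case_prod_beta\<close>)
  finally show ?thesis by (simp only: eq prod.case)
qed

text \<open>Observed events involve the sums of one row jointly with the other rows, for which
  \<open>W\<close> stands. Freezing \<open>W\<close> at \<open>w\<close> leaves the section of
  \<open>B\<close> at \<open>w\<close>, an event about the sums alone.\<close>

lemma nn_integral_mecke_indep:
  assumes [measurable]: "h \<in> borel_measurable S" "\<And>t. t \<in> I \<Longrightarrow> g t \<in> borel_measurable S"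
    and W: "indep_rv M Q W (count_space UNIV \<Otimes>\<^sub>M PX) (\<lambda>\<omega>. (N \<omega>, seqX \<omega>))"
    and B[measurable]: "B \<in> sets (Q \<Otimes>\<^sub>M (\<Pi>\<^sub>M t\<in>I. borel))"
    and disj: "\<And>x t. t \<in> I \<Longrightarrow> h x \<noteq> 0 \<Longrightarrow> g t x = 0"
  shows "(\<integral>\<^sup>+\<omega>. (\<Sum>k=1..N \<omega>. h (X k \<omega>)) * indicator B (W \<omega>, \<lambda>t\<in>I. \<Sum>k=1..N \<omega>. g t (X k \<omega>) :: real) \<partial>M) =
    ennreal c * (\<integral>\<^sup>+x. h x \<partial>\<mu>) * (\<integral>\<^sup>+\<omega>. indicator B (W \<omega>, \<lambda>t\<in>I. \<Sum>k=1..N \<omega>. g t (X k \<omega>) :: real) \<partial>M)"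
proof -
  let ?v = "\<lambda>(n, x). \<lambda>t\<in>I. \<Sum>k=1..n. g t (x k) :: real"
  let ?u = "\<lambda>(n, x). \<Sum>k=1..n. h (x k)"
  have v[measurable]: "?v \<in> measurable (count_space UNIV \<Otimes>\<^sub>M PX) (\<Pi>\<^sub>M t\<in>I. borel)"
    by (rule compound_measurable) (rule assms(2))
  have u[measurable]: "?u \<in> borel_measurable (count_space UNIV \<Otimes>\<^sub>M PX)"
    unfolding case_prod_beta by measurable
  have NXm[measurable]: "(\<lambda>\<omega>. (N \<omega>, seqX \<omega>)) \<in> measurable M (count_space UNIV \<Otimes>\<^sub>M PX)"
    using W by (simp add: indep_rv_def)
  interpret W: prob_space "distr M Q W"
    using W by (intro prob_space_distr) (simp add: indep_rv_def)
  have eq: "(\<lambda>t\<in>I. \<Sum>k=1..N \<omega>. g t (X k \<omega>)) = ?v (N \<omega>, seqX \<omega>)" "(\<Sum>k=1..N \<omega>. h (X k \<omega>)) = ?u (N \<omega>, seqX \<omega>)" for \<omega>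
    unfolding prod.case by (intro restrict_ext sum.cong; auto)+
  have slice: "(\<integral>\<^sup>+\<omega>. ?u (N \<omega>, seqX \<omega>) * indicator B (w, ?v (N \<omega>, seqX \<omega>)) \<partial>M) =
      ennreal c * (\<integral>\<^sup>+x. h x \<partial>\<mu>) * (\<integral>\<^sup>+\<omega>. indicator B (w, ?v (N \<omega>, seqX \<omega>)) \<partial>M)" for w
    using nn_integral_mecke[of h I g "Pair w -` B", OF assms(1,2) sets_Pair1[OF B] disj]
    unfolding eq by (simp add: indicator_def)
  have "(\<integral>\<^sup>+\<omega>. ?u (N \<omega>, seqX \<omega>) * indicator B (W \<omega>, ?v (N \<omega>, seqX \<omega>)) \<partial>M) =
      (\<integral>\<^sup>+\<omega>. (\<lambda>(w, p). ?u p * indicator B (w, ?v p)) (W \<omega>, (N \<omega>, seqX \<omega>)) \<partial>M)" by simp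
  also have "\<dots> = (\<integral>\<^sup>+w. \<integral>\<^sup>+\<omega>. (\<lambda>(w, p). ?u p * indicator B (w, ?v p)) (w, (N \<omega>, seqX \<omega>)) \<partial>M \<partial>distr M Q W)"
    by (rule nn_integral_indep_rv[OF W]) measurable
  also have "\<dots> = (\<integral>\<^sup>+w. ennreal c * (\<integral>\<^sup>+x. h x \<partial>\<mu>) * (\<integral>\<^sup>+\<omega>. (\<lambda>(w, p). indicator B (w, ?v p)) (w, (N \<omega>, seqX \<omega>)) \<partial>M) \<partial>distr M Q W)"
    by (intro nn_integral_cong) (use slice in simp)
  also have "\<dots> = ennreal c * (\<integral>\<^sup>+x. h x \<partial>\<mu>) * (\<integral>\<^sup>+w. (\<integral>\<^sup>+\<omega>. (\<lambda>(w, p). indicator B (w, ?v p)) (w, (N \<omega>, seqX \<omega>)) \<partial>M) \<partial>distr M Q W)"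
    by (rule nn_integral_cmult) measurable
  also have "(\<integral>\<^sup>+w. (\<integral>\<^sup>+\<omega>. (\<lambda>(w, p). indicator B (w, ?v p)) (w, (N \<omega>, seqX \<omega>)) \<partial>M) \<partial>distr M Q W) =
      (\<integral>\<^sup>+\<omega>. (\<lambda>(w, p). indicator B (w, ?v p)) (W \<omega>, (N \<omega>, seqX \<omega>)) \<partial>M)"
    by (rule nn_integral_indep_rv[OF W, symmetric]) measurable
  finally show ?thesis by (simp only: eq prod.case)
qed

text \<open>The Mecke formula is an identity of extended nonnegative integrals; for signed
  \<open>h\<close> it is applied to the positive and negative parts and subtracted. With
  \<open>A\<close> the whole space the value is the mean of the sum, so this says that the sum is
  uncorrelated with every \<open>A\<close>.\<close>

lemma has_integral_compound_times_indicator: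
  fixes h :: "'b \<Rightarrow> real"
  assumes h[measurable]: "integrable \<mu> h" and g[measurable]: "\<And>t. t \<in> I \<Longrightarrow> g t \<in> borel_measurable S"
    and W: "indep_rv M Q W (count_space UNIV \<Otimes>\<^sub>M PX) (\<lambda>\<omega>. (N \<omega>, seqX \<omega>))"
    and B[measurable]: "B \<in> sets (Q \<Otimes>\<^sub>M (\<Pi>\<^sub>M t\<in>I. borel))"
    and disj: "\<And>x t. t \<in> I \<Longrightarrow> h x \<noteq> 0 \<Longrightarrow> g t x = 0"
  defines "A \<equiv> (\<lambda>\<omega>. (W \<omega>, \<lambda>t\<in>I. \<Sum>k=1..N \<omega>. g t (X k \<omega>) :: real)) -` B \<inter> space M"
  shows "has_bochner_integral M (\<lambda>\<omega>. indicator A \<omega> * (\<Sum>k=1..N \<omega>. h (X k \<omega>))) (c * (\<integral>x. h x \<partial>\<mu>) * prob A)"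
proof -
  have [measurable]: "W \<in> measurable M Q" using W by (simp add: indep_rv_def)
  have "(\<lambda>\<omega>. \<lambda>t\<in>I. \<Sum>k=1..N \<omega>. g t (X k \<omega>)) \<in> measurable M (\<Pi>\<^sub>M t\<in>I. borel)"
    by (intro measurable_restrict measurable_sum_countable_bound N_meas) (auto intro: measurable_compose[OF X_meas g])
  then have "(\<lambda>\<omega>. (W \<omega>, \<lambda>t\<in>I. \<Sum>k=1..N \<omega>. g t (X k \<omega>))) \<in> measurable M (Q \<Otimes>\<^sub>M (\<Pi>\<^sub>M t\<in>I. borel))"
    by measurable
  from measurable_sets[OF this B] have A[measurable]: "A \<in> sets M" unfolding A_def .
  have ind: "indicator B (W \<omega>, \<lambda>t\<in>I. \<Sum>k=1..N \<omega>. g t (X k \<omega>)) = (indicator A \<omega> :: ennreal)" if "\<omega> \<in> space M" for \<omega>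
    using that by (auto simp: A_def split: split_indicator)
  have hm[measurable]: "h \<in> borel_measurable S"
    using borel_measurable_integrable[OF h] by (simp cong: measurable_cong_sets add: sets_\<mu>)
  \<comment> \<open>The last premise lets both parts of \<open>h\<close> inherit
    \<open>disj\<close>: each of them vanishes wherever \<open>h\<close> does.\<close>
  have *: "has_bochner_integral M (\<lambda>\<omega>. indicator A \<omega> * (\<Sum>k=1..N \<omega>. f (X k \<omega>))) (c * (\<integral>x. f x \<partial>\<mu>) * prob A)"
    if f: "integrable \<mu> f" "\<And>x. f x \<ge> 0" "\<And>x. f x \<noteq> 0 \<Longrightarrow> h x \<noteq> 0" for f
  proof (rule has_bochner_integral_nn_integral)
    have [measurable]: "f \<in> borel_measurable S"
      using borel_measurable_integrable[OF f(1)] by (simp cong: measurable_cong_sets add: sets_\<mu>)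
    show "(\<lambda>\<omega>. indicator A \<omega> * (\<Sum>k=1..N \<omega>. f (X k \<omega>))) \<in> borel_measurable M" by measurable
    show "AE \<omega> in M. 0 \<le> indicator A \<omega> * (\<Sum>k=1..N \<omega>. f (X k \<omega>))"
      by (auto intro!: AE_I2 mult_nonneg_nonneg sum_nonneg f(2))
    show "0 \<le> c * (\<integral>x. f x \<partial>\<mu>) * prob A"
      using c_pos f(2) by (auto intro!: mult_nonneg_nonneg integral_nonneg)
    have "(\<integral>\<^sup>+\<omega>. ennreal (indicator A \<omega> * (\<Sum>k=1..N \<omega>. f (X k \<omega>))) \<partial>M) =
        (\<integral>\<^sup>+\<omega>. (\<Sum>k=1..N \<omega>. ennreal (f (X k \<omega>))) * indicator B (W \<omega>, \<lambda>t\<in>I. \<Sum>k=1..N \<omega>. g t (X k \<omega>)) \<partial>M)"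
      by (intro nn_integral_cong, simp only: ind) (simp add: f(2) split: split_indicator)
    also have "\<dots> = ennreal c * (\<integral>\<^sup>+x. ennreal (f x) \<partial>\<mu>) * (\<integral>\<^sup>+\<omega>. indicator B (W \<omega>, \<lambda>t\<in>I. \<Sum>k=1..N \<omega>. g t (X k \<omega>)) \<partial>M)"
    proof (rule nn_integral_mecke_indep[OF _ g W B])
      show "(\<lambda>x. ennreal (f x)) \<in> borel_measurable S" by measurable
      show "g t x = 0" if "t \<in> I" "ennreal (f x) \<noteq> 0" for x t
      proof -
        have "f x \<noteq> 0" using that(2) by auto
        then show ?thesis using disj[OF that(1) f(3)] by blast
      qed
    qed
    also have "(\<integral>\<^sup>+\<omega>. indicator B (W \<omega>, \<lambda>t\<in>I. \<Sum>k=1..N \<omega>. g t (X k \<omega>)) \<partial>M) = ennreal (prob A)"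
    proof -
      have "(\<integral>\<^sup>+\<omega>. indicator B (W \<omega>, \<lambda>t\<in>I. \<Sum>k=1..N \<omega>. g t (X k \<omega>)) \<partial>M) = (\<integral>\<^sup>+\<omega>. indicator A \<omega> \<partial>M)"
        by (intro nn_integral_cong) (simp only: ind)
      then show ?thesis by (simp add: emeasure_eq_measure)
    qed
    also have "(\<integral>\<^sup>+x. ennreal (f x) \<partial>\<mu>) = ennreal (\<integral>x. f x \<partial>\<mu>)"
      by (rule nn_integral_eq_integral) (use f in auto)
    finally show "(\<integral>\<^sup>+\<omega>. ennreal (indicator A \<omega> * (\<Sum>k=1..N \<omega>. f (X k \<omega>))) \<partial>M) = ennreal (c * (\<integral>x. f x \<partial>\<mu>) * prob A)"
      using c_pos f(2) by (simp add: ennreal_mult'' ennreal_mult')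
  qed
  have [intro]: "integrable \<mu> (\<lambda>x. max 0 (h x))" "integrable \<mu> (\<lambda>x. max 0 (- h x))"
    using h by (auto intro!: integrable_max)
  have "has_bochner_integral M (\<lambda>\<omega>. indicator A \<omega> * (\<Sum>k=1..N \<omega>. max 0 (h (X k \<omega>))) - indicator A \<omega> * (\<Sum>k=1..N \<omega>. max 0 (- h (X k \<omega>))))
      (c * (\<integral>x. max 0 (h x) \<partial>\<mu>) * prob A - c * (\<integral>x. max 0 (- h x) \<partial>\<mu>) * prob A)"
    by (intro has_bochner_integral_diff *[of "\<lambda>x. max 0 (h x)"] *[of "\<lambda>x. max 0 (- h x)"]) auto
  moreover have "(\<Sum>k=1..N \<omega>. max 0 (h (X k \<omega>))) - (\<Sum>k=1..N \<omega>. max 0 (- h (X k \<omega>))) = (\<Sum>k=1..N \<omega>. h (X k \<omega>))" for \<omega>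
    by (subst sum_subtractf[symmetric]) (auto intro!: sum.cong)
  moreover have "(\<integral>x. max 0 (h x) \<partial>\<mu>) - (\<integral>x. max 0 (- h x) \<partial>\<mu>) = (\<integral>x. h x \<partial>\<mu>)"
    by (subst Bochner_Integration.integral_diff[symmetric]) (auto intro!: Bochner_Integration.integral_cong)
  ultimately show ?thesis by (simp flip: right_diff_distrib left_diff_distrib)
qed

text \<open>On every \<open>A\<close> of \<open>F\<close> the sum and the constant have equal
  integrals, which characterises the conditional expectation. \<open>FB\<close> is an inclusion:
  \<open>F\<close> may be smaller than the algebra generated by \<open>W\<close> and the sums of the
  \<open>g t\<close>.\<close>

lemma real_cond_exp_compound:
  fixes h :: "'b \<Rightarrow> real"
  assumes h: "integrable \<mu> h" and g: "\<And>t. t \<in> I \<Longrightarrow> g t \<in> borel_measurable S"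
    and W: "indep_rv M Q W (count_space UNIV \<Otimes>\<^sub>M PX) (\<lambda>\<omega>. (N \<omega>, seqX \<omega>))"
    and disj: "\<And>x t. t \<in> I \<Longrightarrow> h x \<noteq> 0 \<Longrightarrow> g t x = 0"
    and F: "subalgebra M F"
    and FB: "\<And>A. A \<in> sets F \<Longrightarrow> \<exists>B\<in>sets (Q \<Otimes>\<^sub>M (\<Pi>\<^sub>M t\<in>I. borel)).
      A = (\<lambda>\<omega>. (W \<omega>, \<lambda>t\<in>I. \<Sum>k=1..N \<omega>. g t (X k \<omega>) :: real)) -` B \<inter> space M"
  shows "integrable M (\<lambda>\<omega>. \<Sum>k=1..N \<omega>. h (X k \<omega>))"
    and "AE \<omega> in M. real_cond_exp M F (\<lambda>\<omega>. \<Sum>k=1..N \<omega>. h (X k \<omega>)) \<omega> = c * (\<integral>x. h x \<partial>\<mu>)"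
proof -
  interpret F: finite_measure_subalgebra M F by unfold_locales (rule F)
  have *: "has_bochner_integral M (\<lambda>\<omega>. indicator A \<omega> * (\<Sum>k=1..N \<omega>. h (X k \<omega>))) (c * (\<integral>x. h x \<partial>\<mu>) * prob A)"
    if A: "A \<in> sets F" for A
  proof -
    obtain B where B: "B \<in> sets (Q \<Otimes>\<^sub>M (\<Pi>\<^sub>M t\<in>I. borel))"
      "A = (\<lambda>\<omega>. (W \<omega>, \<lambda>t\<in>I. \<Sum>k=1..N \<omega>. g t (X k \<omega>) :: real)) -` B \<inter> space M" using FB[OF A] by blast
    show ?thesis unfolding B(2) by (rule has_integral_compound_times_indicator[OF h g W B(1) disj])
  qed
  have "space M = space F" using F by (simp add: subalgebra_def)
  then have "space M \<in> sets F" by simp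
  from *[OF this] have "integrable M (\<lambda>\<omega>. indicator (space M) \<omega> * (\<Sum>k=1..N \<omega>. h (X k \<omega>)))"
    by (rule integrable.intros)
  then show 1: "integrable M (\<lambda>\<omega>. \<Sum>k=1..N \<omega>. h (X k \<omega>))"
    by (rule Bochner_Integration.integrable_cong[THEN iffD1, rotated -1]) auto
  show "AE \<omega> in M. real_cond_exp M F (\<lambda>\<omega>. \<Sum>k=1..N \<omega>. h (X k \<omega>)) \<omega> = c * (\<integral>x. h x \<partial>\<mu>)"
  proof (rule F.real_cond_exp_charact)
    fix A assume A: "A \<in> sets F"
    then have "A \<in> sets M" using F by (auto simp: subalgebra_def)
    with has_bochner_integral_integral_eq[OF *[OF A]]
    show "(\<integral>\<omega>\<in>A. (\<Sum>k=1..N \<omega>. h (X k \<omega>)) \<partial>M) = (\<integral>\<omega>\<in>A. c * (\<integral>x. h x \<partial>\<mu>) \<partial>M)"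
      by (simp add: set_lebesgue_integral_def mult.commute)
  qed (use 1 in auto)
qed

end

section \<open>Second-order expansion and normal laws\<close>

text \<open>Taylor expansion to second order, with a remainder that is the minimum of a quadratic
  and a cubic bound: the cubic one tends to 0 pointwise, the quadratic one is an integrable
  majorant. The limit involves the second moment and not the variance of a mark, because the Poisson
  count fluctuates as well.\<close>

lemma (in real_distribution) compound_exponent_tendsto:
  assumes sq: "integrable M (\<lambda>x. x\<^sup>2)" and a: "filterlim a at_top sequentially"
  shows "(\<lambda>n. complex_of_real (a n) * (char M (t / sqrt (a n)) - 1 - \<i> * (t / sqrt (a n)) * expectation (\<lambda>x. x)))
    \<longlonglongrightarrow> - (t\<^sup>2 * expectation (\<lambda>x. x\<^sup>2) / 2)"
proof -
  have i1: "integrable M (\<lambda>x. x)"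
    by (rule square_integrable_imp_integrable) (use sq in auto)
  then have ik: "integrable M (\<lambda>x. x ^ k)" if "k \<le> 2" for k
    using that sq by (cases "k = 0 \<or> k = 1 \<or> k = 2") (auto simp: numeral_2_eq_2 le_Suc_eq)
  \<comment> \<open>The 6 inside the minimum is \<open>2 * Suc 2\<close> from the remainder bound
    \<open>char_approx2\<close>; the factor \<open>t\<^sup>2 / 6\<close> used below comes from
    \<open>fact 3\<close>.\<close>
  define R where "R n = expectation (\<lambda>x. min (6 * x\<^sup>2) (\<bar>t / sqrt (a n)\<bar> * \<bar>x\<bar> ^ 3))" for n
  have "R \<longlonglongrightarrow> expectation (\<lambda>x. 0)"
    unfolding R_def
  proof (rule integral_dominated_convergence[where w="\<lambda>x. 6 * x\<^sup>2"])
    have "filterlim (\<lambda>n. sqrt (a n)) at_top sequentially"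
      using sqrt_at_top a by (rule filterlim_compose)
    then have "filterlim (\<lambda>n. sqrt (a n)) at_infinity sequentially" by (rule filterlim_at_top_imp_at_infinity)
    then have "(\<lambda>n. t / sqrt (a n)) \<longlonglongrightarrow> 0" by (rule tendsto_divide_0[OF tendsto_const])
    then have "(\<lambda>n. min (6 * x\<^sup>2) (\<bar>t / sqrt (a n)\<bar> * \<bar>x\<bar> ^ 3)) \<longlonglongrightarrow> min (6 * x\<^sup>2) (\<bar>0\<bar> * \<bar>x\<bar> ^ 3)" for x :: real
      by (intro tendsto_intros)
    moreover have "min (6 * x\<^sup>2) (\<bar>0\<bar> * \<bar>x\<bar> ^ 3) = 0" for x :: real by simp
    ultimately show "AE x in M. (\<lambda>n. min (6 * x\<^sup>2) (\<bar>t / sqrt (a n)\<bar> * \<bar>x\<bar> ^ 3)) \<longlonglongrightarrow> 0"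
      by (intro AE_I2) (simp only:)
  qed (use sq in auto)
  then have "(\<lambda>n. t\<^sup>2 / 6 * R n) \<longlonglongrightarrow> t\<^sup>2 / 6 * 0" by (intro tendsto_intros) simp
  then have R: "(\<lambda>n. t\<^sup>2 / 6 * R n) \<longlonglongrightarrow> 0" by simp
  have bound: "\<forall>\<^sub>F n in sequentially. norm (complex_of_real (a n) * (char M (t / sqrt (a n)) - 1 - \<i> * (t / sqrt (a n)) * expectation (\<lambda>x. x))
      - complex_of_real (- (t\<^sup>2 * expectation (\<lambda>x. x\<^sup>2) / 2))) \<le> t\<^sup>2 / 6 * R n"
    using filterlim_at_top_dense[THEN iffD1, OF a, rule_format, of 0]
  proof eventually_elim
    case (elim n)
    define s where "s = t / sqrt (a n)"
    have as: "a n * s\<^sup>2 = t\<^sup>2" using elim by (simp add: s_def power_divide)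
    let ?m = "expectation (\<lambda>x. x)" and ?v = "expectation (\<lambda>x. x\<^sup>2)"
    have "norm (char M s - (\<Sum>k\<le>2. (\<i> * s) ^ k / fact k * expectation (\<lambda>x. x ^ k))) \<le>
        \<bar>s\<bar>\<^sup>2 / fact (Suc 2) * expectation (\<lambda>x. min (2 * \<bar>x\<bar>\<^sup>2 * Suc 2) (\<bar>s\<bar> * \<bar>x\<bar> ^ Suc 2))"
      by (rule char_approx2) (rule ik)
    also have "(\<Sum>k\<le>2. (\<i> * s) ^ k / fact k * expectation (\<lambda>x. x ^ k)) = 1 + \<i> * s * ?m - complex_of_real (s\<^sup>2 * ?v / 2)"
      by (simp add: eval_nat_numeral prob_space[simplified] algebra_simps)
    also have "\<bar>s\<bar>\<^sup>2 / fact (Suc 2) * expectation (\<lambda>x. min (2 * \<bar>x\<bar>\<^sup>2 * Suc 2) (\<bar>s\<bar> * \<bar>x\<bar> ^ Suc 2)) = s\<^sup>2 / 6 * R n"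
      by (simp add: R_def s_def eval_nat_numeral)
    finally have *: "norm (char M s - (1 + \<i> * s * ?m - complex_of_real (s\<^sup>2 * ?v / 2))) \<le> s\<^sup>2 / 6 * R n" .
    have "complex_of_real (a n) * (char M s - 1 - \<i> * s * ?m) - complex_of_real (- (t\<^sup>2 * ?v / 2)) =
        complex_of_real (a n) * (char M s - (1 + \<i> * s * ?m - complex_of_real (s\<^sup>2 * ?v / 2)))"
      unfolding as[symmetric] by (simp add: algebra_simps)
    then have "norm (complex_of_real (a n) * (char M s - 1 - \<i> * s * ?m) - complex_of_real (- (t\<^sup>2 * ?v / 2)))
        = a n * norm (char M s - (1 + \<i> * s * ?m - complex_of_real (s\<^sup>2 * ?v / 2)))"
      using elim by (simp add: norm_mult)
    also have "\<dots> \<le> a n * (s\<^sup>2 / 6 * R n)" using elim * by (intro mult_left_mono) auto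
    also have "\<dots> = t\<^sup>2 / 6 * R n" by (simp flip: as)
    finally show ?case by (simp add: s_def)
  qed
  show ?thesis
    using Lim_null_comparison[OF bound R] by (subst (asm) LIM_zero_iff) simp
qed

text \<open>Scaling transports characteristic function and moments of the standard normal law to
  every standard deviation \<open>\<sigma>\<close>.\<close>

lemma normal_measure_eq_distr:
  assumes "\<sigma> > 0"
  shows "density lborel (normal_density 0 \<sigma>) = distr std_normal_distribution borel (\<lambda>x. \<sigma> * x)"
proof -
  interpret std: real_distribution std_normal_distribution by (rule real_dist_normal_dist)
  have "distr std_normal_distribution lborel (\<lambda>x. x) = std_normal_distribution"
    by (rule distr_id2) simp
  then have "distributed std_normal_distribution lborel (\<lambda>x. x) std_normal_density"
    by (simp add: distributed_def)
  from std.normal_density_affine[OF this, of \<sigma> 0] assms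
  have "distributed std_normal_distribution lborel (\<lambda>x. \<sigma> * x) (normal_density 0 \<sigma>)" by simp
  from distributed_distr_eq_density[OF this]
  show ?thesis by (simp cong: distr_cong)
qed

lemma char_normal:
  assumes "\<sigma> > 0"
  shows "char (density lborel (normal_density 0 \<sigma>)) t = complex_of_real (exp (- (\<sigma>\<^sup>2 * t\<^sup>2) / 2))"
proof -
  have "char (density lborel (normal_density 0 \<sigma>)) t = char std_normal_distribution (t * \<sigma>)"
    unfolding normal_measure_eq_distr[OF assms] char_def
    by (subst integral_distr) (auto simp: mult.assoc)
  then show ?thesis by (simp add: char_std_normal_distribution power_mult_distrib mult.commute)
qed

lemma real_distribution_normal:
  assumes "\<sigma> > 0"
  shows "real_distribution (density lborel (normal_density 0 \<sigma>))"
  unfolding normal_measure_eq_distr[OF assms]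
  by (intro prob_space.real_distribution_distr real_distribution.axioms(1)[OF real_dist_normal_dist]) auto

text \<open>The null set where \<open>X \<alpha>\<close> and \<open>X' \<alpha>\<close> differ
  depends on \<open>\<alpha>\<close>, and the union over an uncountable \<open>I\<close> need not be
  null. Each single event of the product algebra, however, arises from coordinate events by
  countable operations, so its two versions agree almost surely. Hence the marginal and joint laws
  coincide, and independence is a property of these laws.\<close>

lemma (in prob_space) indep_var_process_cong_AE:
  fixes X X' :: "'i \<Rightarrow> 'a \<Rightarrow> 'c::topological_space"
  assumes I: "indep_var (\<Pi>\<^sub>M \<alpha>\<in>I. borel) (\<lambda>\<omega>. \<lambda>\<alpha>\<in>I. X' \<alpha> \<omega>) N Y"
    and X: "\<And>\<alpha>. \<alpha> \<in> I \<Longrightarrow> X \<alpha> \<in> borel_measurable M"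
    and ae: "\<And>\<alpha>. \<alpha> \<in> I \<Longrightarrow> AE \<omega> in M. X \<alpha> \<omega> = X' \<alpha> \<omega>"
  shows "indep_var (\<Pi>\<^sub>M \<alpha>\<in>I. borel) (\<lambda>\<omega>. \<lambda>\<alpha>\<in>I. X \<alpha> \<omega>) N Y"
proof -
  let ?P = "(\<Pi>\<^sub>M \<alpha>\<in>I. borel) :: ('i \<Rightarrow> 'c) measure" and ?X = "\<lambda>\<omega>. \<lambda>\<alpha>\<in>I. X \<alpha> \<omega>" and ?X' = "\<lambda>\<omega>. \<lambda>\<alpha>\<in>I. X' \<alpha> \<omega>"
  have m: "?X' \<in> measurable M ?P" "Y \<in> measurable M N" "?X \<in> measurable M ?P"
    using indep_var_rv1[OF I] indep_var_rv2[OF I] by (auto intro!: measurable_restrict[of I X] X)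
  \<comment> \<open>Induction over the generation of the product algebra; for a countable union,
    countably many null sets are collected.\<close>
  have AE_B: "AE \<omega> in M. ?X \<omega> \<in> B \<longleftrightarrow> ?X' \<omega> \<in> B" if "B \<in> sets ?P" for B
    using that unfolding sets_PiM_single
  proof (induction rule: sigma_sets.induct)
    case (Basic B)
    then obtain \<alpha> A where "\<alpha> \<in> I" "B = {f \<in> \<Pi>\<^sub>E i\<in>I. space borel. f \<alpha> \<in> A}" by blast
    with ae[of \<alpha>] show ?case by (auto elim!: eventually_mono)
  next
    case (Compl B)
    then show ?case by (auto elim!: eventually_mono)
  next
    case (Union B)
    then have "AE \<omega> in M. \<forall>n. ?X \<omega> \<in> B n \<longleftrightarrow> ?X' \<omega> \<in> B n"
      unfolding AE_all_countable by blast
    then show ?case by (rule eventually_mono) blast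
  qed simp
  have "distr M ?P ?X = distr M ?P ?X'"
  proof (rule measure_eqI)
    fix B assume "B \<in> sets (distr M ?P ?X)"
    then have B: "B \<in> sets ?P" by simp
    show "emeasure (distr M ?P ?X) B = emeasure (distr M ?P ?X') B"
      using AE_B[OF B] measurable_sets[OF m(1) B] measurable_sets[OF m(3) B]
      by (simp add: emeasure_distr[OF m(1) B] emeasure_distr[OF m(3) B]) (rule emeasure_eq_AE, auto)
  qed simp
  \<comment> \<open>Equality of the joint laws is checked on rectangles, an intersection-stable
    generator.\<close>
  moreover have "distr M (?P \<Otimes>\<^sub>M N) (\<lambda>\<omega>. (?X \<omega>, Y \<omega>)) = distr M (?P \<Otimes>\<^sub>M N) (\<lambda>\<omega>. (?X' \<omega>, Y \<omega>))"
  proof (rule measure_eqI_generator_eq[where A="\<lambda>_. space (?P \<Otimes>\<^sub>M N)"])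
    let ?E = "{a \<times> b |a b. a \<in> sets ?P \<and> b \<in> sets N}"
    show "Int_stable ?E" by (rule Int_stable_pair_measure_generator)
    show "?E \<subseteq> Pow (space (?P \<Otimes>\<^sub>M N))" using pair_measure_closed by (simp add: space_pair_measure)
    show "sets (distr M (?P \<Otimes>\<^sub>M N) (\<lambda>\<omega>. (?X \<omega>, Y \<omega>))) = sigma_sets (space (?P \<Otimes>\<^sub>M N)) ?E"
      "sets (distr M (?P \<Otimes>\<^sub>M N) (\<lambda>\<omega>. (?X' \<omega>, Y \<omega>))) = sigma_sets (space (?P \<Otimes>\<^sub>M N)) ?E"
      by (simp_all add: sets_pair_measure space_pair_measure)
    show "range (\<lambda>_::nat. space (?P \<Otimes>\<^sub>M N)) \<subseteq> ?E" by (auto simp: space_pair_measure)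
    show "emeasure (distr M (?P \<Otimes>\<^sub>M N) (\<lambda>\<omega>. (?X \<omega>, Y \<omega>))) (space (?P \<Otimes>\<^sub>M N)) \<noteq> \<infinity>" for n :: nat
      using m by (subst emeasure_distr) auto
    fix C assume "C \<in> ?E"
    then obtain B b where C: "C = B \<times> b" "B \<in> sets ?P" "b \<in> sets N" by blast
    have p: "(\<lambda>\<omega>. (?X \<omega>, Y \<omega>)) \<in> measurable M (?P \<Otimes>\<^sub>M N)" "(\<lambda>\<omega>. (?X' \<omega>, Y \<omega>)) \<in> measurable M (?P \<Otimes>\<^sub>M N)"
      using m by auto
    have C': "C \<in> sets (?P \<Otimes>\<^sub>M N)" using C by auto
    have "AE \<omega> in M. \<omega> \<in> (\<lambda>\<omega>. (?X \<omega>, Y \<omega>)) -` C \<inter> space M \<longleftrightarrow> \<omega> \<in> (\<lambda>\<omega>. (?X' \<omega>, Y \<omega>)) -` C \<inter> space M"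
      using AE_B[OF C(2)] by eventually_elim (auto simp: C(1))
    then show "emeasure (distr M (?P \<Otimes>\<^sub>M N) (\<lambda>\<omega>. (?X \<omega>, Y \<omega>))) C = emeasure (distr M (?P \<Otimes>\<^sub>M N) (\<lambda>\<omega>. (?X' \<omega>, Y \<omega>))) C"
      unfolding emeasure_distr[OF p(1) C'] emeasure_distr[OF p(2) C']
      by (rule emeasure_eq_AE) (use measurable_sets[OF p(1) C'] measurable_sets[OF p(2) C'] in auto)
  qed auto
  ultimately show ?thesis using I m unfolding indep_var_distribution_eq by simp
qed

section \<open>Independent rows of compound Poisson sums\<close>

locale poisson_rows = prob_space M for M :: "'a measure" +
  fixes J :: "nat set" and S \<mu> :: "'b measure" and lam :: "nat \<Rightarrow> real"
    and N :: "nat \<Rightarrow> real \<Rightarrow> 'a \<Rightarrow> nat" and X :: "nat \<Rightarrow> nat \<Rightarrow> 'a \<Rightarrow> 'b"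
  assumes finite_J: "finite J"
    and lam_pos: "j \<in> J \<Longrightarrow> lam j > 0"
    and poisson: "j \<in> J \<Longrightarrow> hom_poisson_process M (lam j) (N j)"
    and X_indep: "j \<in> J \<Longrightarrow> indep_vars (\<lambda>_. S) (X j) {1..}"
    and X_distr: "j \<in> J \<Longrightarrow> k \<ge> 1 \<Longrightarrow> distr M S (X j k) = \<mu>"
    and within: "j \<in> J \<Longrightarrow> indep_rv M (\<Pi>\<^sub>M \<alpha>\<in>{0..}. count_space UNIV) (\<lambda>\<omega>. \<lambda>\<alpha>\<in>{0..}. N j \<alpha> \<omega>)
        (\<Pi>\<^sub>M k\<in>{1..}. S) (\<lambda>\<omega>. \<lambda>k\<in>{1..}. X j k \<omega>)"
    and across: "indep_vars (\<lambda>_. (\<Pi>\<^sub>M \<alpha>\<in>{0..}. count_space UNIV) \<Otimes>\<^sub>M (\<Pi>\<^sub>M k\<in>{1..}. S))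
        (\<lambda>j \<omega>. (\<lambda>\<alpha>\<in>{0..}. N j \<alpha> \<omega>, \<lambda>k\<in>{1..}. X j k \<omega>)) J"
begin

abbreviation "rowM \<equiv> (\<Pi>\<^sub>M \<alpha>\<in>{0::real..}. count_space (UNIV :: nat set)) \<Otimes>\<^sub>M (\<Pi>\<^sub>M k\<in>{1::nat..}. S)"

text \<open>The counts at all exposures and all marks of a row form one random element. Sums for
  every \<open>\<alpha>\<close> are functions of it, so independence of rows yields independence of
  whole processes in \<open>\<alpha>\<close>.\<close>

definition row :: "nat \<Rightarrow> 'a \<Rightarrow> (real \<Rightarrow> nat) \<times> (nat \<Rightarrow> 'b)" where
  "row j \<omega> = (\<lambda>\<alpha>\<in>{0..}. N j \<alpha> \<omega>, \<lambda>k\<in>{1..}. X j k \<omega>)"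

text \<open>A deterministic function of a realised row, against \<open>total\<close>, which lives on
  the probability space. Through this factorisation independence of the rows passes to the
  sums.\<close>

definition row_sum :: "('b \<Rightarrow> real) \<Rightarrow> real \<Rightarrow> (real \<Rightarrow> nat) \<times> (nat \<Rightarrow> 'b) \<Rightarrow> real" where
  "row_sum h \<alpha> r = (\<Sum>k=1..fst r \<alpha>. h (snd r k))"

definition total :: "nat \<Rightarrow> ('b \<Rightarrow> real) \<Rightarrow> real \<Rightarrow> 'a \<Rightarrow> real" where
  "total j h \<alpha> \<omega> = (\<Sum>k=1..N j \<alpha> \<omega>. h (X j k \<omega>))"

lemma total_eq_row_sum: "\<alpha> \<ge> 0 \<Longrightarrow> total j h \<alpha> \<omega> = row_sum h \<alpha> (row j \<omega>)"
  by (simp add: total_def row_sum_def row_def)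

lemma row_sum_measurable [measurable (raw)]:
  assumes "\<alpha> \<ge> 0" "h \<in> borel_measurable S" and r: "r \<in> measurable L rowM"
  shows "(\<lambda>x. row_sum h \<alpha> (r x)) \<in> borel_measurable L"
proof -
  have "(\<lambda>r. fst r \<alpha>) \<in> measurable rowM (count_space UNIV)"
    using assms by (intro measurable_compose[OF measurable_fst measurable_component_singleton]) auto
  moreover have "(\<lambda>r. h (snd r k)) \<in> borel_measurable rowM" if "k \<ge> 1" for k
    using that assms by (intro measurable_compose[OF measurable_compose[OF measurable_snd measurable_component_singleton]]) auto
  ultimately have "row_sum h \<alpha> \<in> borel_measurable rowM"
    unfolding row_sum_def by (intro measurable_sum_countable_bound) auto
  with r show ?thesis by (rule measurable_compose)
qed

lemma rows_indep: "indep_vars (\<lambda>_. rowM) row J"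
  using across by (simp add: row_def[abs_def])

lemma row_measurable [measurable (raw)]: "j \<in> J \<Longrightarrow> row j \<in> measurable M rowM"
  using rows_indep by (simp add: indep_vars_def)

lemma total_measurable [measurable (raw)]:
  assumes "j \<in> J" "\<alpha> \<ge> 0" "h \<in> borel_measurable S"
  shows "total j h \<alpha> \<in> borel_measurable M"
  unfolding total_eq_row_sum[OF assms(2), abs_def] using assms by measurable

lemma total_sum: "finite A \<Longrightarrow> total j (\<lambda>x. \<Sum>a\<in>A. f a x) \<alpha> \<omega> = (\<Sum>a\<in>A. total j (f a) \<alpha> \<omega>)"
  unfolding total_def by (subst sum.swap) simp

lemma total_cmult: "total j (\<lambda>x. c * h x) \<alpha> \<omega> = c * total j h \<alpha> \<omega>"
  by (simp add: total_def sum_distrib_left)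

lemma total_diff: "total j (\<lambda>x. g x - h x) \<alpha> \<omega> = total j g \<alpha> \<omega> - total j h \<alpha> \<omega>"
  by (simp add: total_def sum_subtractf)

lemma total_0: "total j (\<lambda>x. 0) \<alpha> \<omega> = 0"
  by (simp add: total_def)

lemma compound_poisson_row:
  assumes j: "j \<in> J" and \<alpha>: "\<alpha> > 0"
  shows "compound_poisson M S \<mu> (X j) (N j \<alpha>) (lam j * \<alpha>)"
proof
  show "lam j * \<alpha> > 0" using lam_pos[OF j] \<alpha> by simp
  have P: "\<forall>s t. 0 \<le> s \<longrightarrow> s < t \<longrightarrow> distr M (count_space UNIV) (\<lambda>\<omega>. N j t \<omega> - N j s \<omega>) = measure_pmf (poisson_pmf (lam j * (t - s)))"
    and N0: "\<forall>\<omega>\<in>space M. N j 0 \<omega> = 0"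
    using poisson[OF j] unfolding hom_poisson_process_def by blast+
  \<comment> \<open>The process is specified through its increments; the law at
    \<open>\<alpha>\<close> is that of the increment from 0, where the process vanishes.\<close>
  have "distr M (count_space UNIV) (N j \<alpha>) = distr M (count_space UNIV) (\<lambda>\<omega>. N j \<alpha> \<omega> - N j 0 \<omega>)"
    by (rule distr_cong) (use N0 in auto)
  with P \<alpha> show "distr M (count_space UNIV) (N j \<alpha>) = measure_pmf (poisson_pmf (lam j * \<alpha>))" by simp
  have "(\<lambda>x. x \<alpha>) \<in> measurable (\<Pi>\<^sub>M \<alpha>\<in>{0..}. count_space UNIV) (count_space (UNIV :: nat set))"
    using \<alpha> by (intro measurable_component_singleton) simp
  from indep_rv_compose[OF within[OF j] this measurable_ident]
  show "indep_rv M (count_space UNIV) (N j \<alpha>) (\<Pi>\<^sub>M k\<in>{1..}. S) (\<lambda>\<omega>. \<lambda>k\<in>{1..}. X j k \<omega>)"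
    using \<alpha> by simp
qed (use X_indep X_distr j in auto)

lemma sets_\<mu>: "j \<in> J \<Longrightarrow> sets \<mu> = sets S"
  using X_distr[of j 1] by (metis sets_distr order_refl)

text \<open>Centring multiplies the characteristic function by an exponential whose exponent becomes
  the subtracted linear term; the exponent then has the shape treated in
  \<open>compound_exponent_tendsto\<close>.\<close>

lemma char_total:
  assumes j: "j \<in> J" and \<alpha>: "\<alpha> > 0" and [measurable]: "h \<in> borel_measurable S"
  shows "char (distr M borel (\<lambda>\<omega>. (total j h \<alpha> \<omega> - \<alpha> * lam j * m) / sqrt \<alpha>)) t =
    exp (of_real (lam j) * (of_real \<alpha> * (char (distr \<mu> borel h) (t / sqrt \<alpha>) - 1 - \<i> * (t / sqrt \<alpha>) * m)))"
proof -
  interpret C: compound_poisson M S \<mu> "X j" "N j \<alpha>" "lam j * \<alpha>" using j \<alpha> by (rule compound_poisson_row)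
  let ?s = "t / sqrt \<alpha>"
  have [measurable]: "total j h \<alpha> \<in> borel_measurable M" using j \<alpha> by (intro total_measurable) auto
  have e: "iexp (t * ((x - \<alpha> * lam j * m) / sqrt \<alpha>)) = exp (- (\<i> * ?s * (\<alpha> * lam j * m))) * iexp (?s * x)" for x
    by (simp add: exp_add[symmetric] algebra_simps diff_divide_distrib)
  have "char (distr M borel (\<lambda>\<omega>. (total j h \<alpha> \<omega> - \<alpha> * lam j * m) / sqrt \<alpha>)) t =
      exp (- (\<i> * ?s * (\<alpha> * lam j * m))) * char (distr M borel (total j h \<alpha>)) ?s"
  proof -
    have [measurable]: "(\<lambda>x. iexp (r * x)) \<in> borel_measurable borel" for r :: real by measurable
    show ?thesis unfolding char_def
      by (subst (1 2) integral_distr) (measurable, simp only: e integral_mult_right_zero)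
  qed
  also have "char (distr M borel (total j h \<alpha>)) ?s = exp (of_real (lam j * \<alpha>) * (char (distr \<mu> borel h) ?s - 1))"
    unfolding total_def[abs_def] by (rule C.char_compound) simp
  finally show ?thesis by (simp add: exp_add[symmetric] algebra_simps)
qed

text \<open>Independence of the rows turns the characteristic function into a product, and each
  factor converges by the expansion above. Each row has its own mark function \<open>h j\<close>;
  choosing it to be zero removes the row.\<close>

lemma central_limit_rows:
  assumes hm: "\<And>j. j \<in> J \<Longrightarrow> h j \<in> borel_measurable S"
    and sq: "\<And>j. j \<in> J \<Longrightarrow> integrable \<mu> (\<lambda>x. (h j x)\<^sup>2)"
    and \<sigma>: "\<sigma> > 0" "\<sigma>\<^sup>2 = (\<Sum>j\<in>J. lam j * (\<integral>x. (h j x)\<^sup>2 \<partial>\<mu>))"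
    and a: "filterlim a at_top sequentially" "\<And>n. a n > 0"
  shows "weak_conv_m (\<lambda>n. distr M borel (\<lambda>\<omega>. \<Sum>j\<in>J. (total j (h j) (a n) \<omega> - a n * lam j * (\<integral>x. h j x \<partial>\<mu>)) / sqrt (a n)))
    (density lborel (normal_density 0 \<sigma>))"
proof (rule levy_continuity)
  show "real_distribution (density lborel (normal_density 0 \<sigma>))" using \<sigma>(1) by (rule real_distribution_normal)
  have m: "total j (h j) (a n) \<in> borel_measurable M" if "j \<in> J" for j n
    using that a(2)[of n] hm by (intro total_measurable) auto
  show "real_distribution (distr M borel (\<lambda>\<omega>. \<Sum>j\<in>J. (total j (h j) (a n) \<omega> - a n * lam j * (\<integral>x. h j x \<partial>\<mu>)) / sqrt (a n)))" for n
    using m by (intro real_distribution_distr borel_measurable_sum borel_measurable_divide borel_measurable_diff) auto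
  fix t
  define \<phi> where "\<phi> j = char (distr \<mu> borel (h j))" for j
  have "(\<lambda>n. \<Prod>j\<in>J. exp (of_real (lam j) * (of_real (a n) * (\<phi> j (t / sqrt (a n)) - 1 - \<i> * (t / sqrt (a n)) * (\<integral>x. h j x \<partial>\<mu>))))) \<longlonglongrightarrow>
      (\<Prod>j\<in>J. exp (of_real (lam j) * of_real (- (t\<^sup>2 * (\<integral>x. (h j x)\<^sup>2 \<partial>\<mu>) / 2))))"
  proof (intro tendsto_prod tendsto_exp tendsto_mult tendsto_const)
    fix j assume j: "j \<in> J"
    interpret \<mu>: prob_space \<mu>
      using j compound_poisson.prob_space_\<mu>[OF compound_poisson_row[OF j, of 1]] by simp
    have hj[measurable]: "h j \<in> borel_measurable \<mu>" using hm[OF j] sets_\<mu>[OF j] by (simp cong: measurable_cong_sets)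
    interpret h: real_distribution "distr \<mu> borel (h j)" by simp
    have "integrable (distr \<mu> borel (h j)) (\<lambda>x. x\<^sup>2)" using sq[OF j] by (simp add: integrable_distr_eq)
    from h.compound_exponent_tendsto[OF this a(1), of t]
    show "(\<lambda>n. of_real (a n) * (\<phi> j (t / sqrt (a n)) - 1 - \<i> * (t / sqrt (a n)) * (\<integral>x. h j x \<partial>\<mu>))) \<longlonglongrightarrow>
        of_real (- (t\<^sup>2 * (\<integral>x. (h j x)\<^sup>2 \<partial>\<mu>) / 2))"
      by (simp add: \<phi>_def integral_distr)
  qed
  moreover have "char (distr M borel (\<lambda>\<omega>. \<Sum>j\<in>J. (total j (h j) (a n) \<omega> - a n * lam j * (\<integral>x. h j x \<partial>\<mu>)) / sqrt (a n))) t =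
      (\<Prod>j\<in>J. exp (of_real (lam j) * (of_real (a n) * (\<phi> j (t / sqrt (a n)) - 1 - \<i> * (t / sqrt (a n)) * (\<integral>x. h j x \<partial>\<mu>)))))" for n
  proof -
    have an: "a n \<ge> 0" using a(2)[of n] by simp
    have "indep_vars (\<lambda>_. borel) (\<lambda>j \<omega>. (row_sum (h j) (a n) (row j \<omega>) - a n * lam j * (\<integral>x. h j x \<partial>\<mu>)) / sqrt (a n)) J"
      by (rule indep_vars_compose2[OF rows_indep]) (use an hm in measurable)
    from char_distr_sum[OF this, of t] show ?thesis
      using an a(2)[of n] hm unfolding \<phi>_def
      by (simp only: total_eq_row_sum[symmetric]) (rule prod.cong[OF refl], rule char_total, auto)
  qed
  moreover have "(\<Prod>j\<in>J. exp (complex_of_real (lam j) * of_real (- (t\<^sup>2 * (\<integral>x. (h j x)\<^sup>2 \<partial>\<mu>) / 2)))) =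
      char (density lborel (normal_density 0 \<sigma>)) t"
    unfolding char_normal[OF \<sigma>(1)] \<sigma>(2)
    by (simp add: exp_sum[OF finite_J, symmetric] sum_distrib_left sum_distrib_right sum_divide_distrib exp_of_real[symmetric] sum_negf algebra_simps del: exp_of_real)
  ultimately show "(\<lambda>n. char (distr M borel (\<lambda>\<omega>. \<Sum>j\<in>J. (total j (h j) (a n) \<omega> - a n * lam j * (\<integral>x. h j x \<partial>\<mu>)) / sqrt (a n))) t)
      \<longlonglongrightarrow> char (density lborel (normal_density 0 \<sigma>)) t"
    by simp
qed

text \<open>Supplies the independent element \<open>W\<close> of the Mecke formula for row
  \<open>i\<close>: all other rows at all exposures.\<close>

lemma indep_rv_other_rows:
  assumes i: "i \<in> J" and \<alpha>: "\<alpha> \<ge> 0"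
  shows "indep_rv M (PiM (J - {i}) (\<lambda>_. rowM)) (\<lambda>\<omega>. \<lambda>j\<in>J-{i}. row j \<omega>)
    (count_space UNIV \<Otimes>\<^sub>M (\<Pi>\<^sub>M k\<in>{1..}. S)) (\<lambda>\<omega>. (N i \<alpha> \<omega>, \<lambda>k\<in>{1..}. X i k \<omega>))"
proof -
  have "indep_var (PiM (J - {i}) (\<lambda>_. rowM)) (\<lambda>\<omega>. \<lambda>j\<in>J-{i}. row j \<omega>) (PiM {i} (\<lambda>_. rowM)) (\<lambda>\<omega>. \<lambda>j\<in>{i}. row j \<omega>)"
    using i by (intro indep_var_restrict[OF rows_indep]) auto
  note I = indep_rv_if_indep_var[OF this]
  have pi: "(\<lambda>p. p i) \<in> measurable (PiM {i} (\<lambda>_. rowM)) rowM" by simp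
  have "(\<lambda>p. (fst (p i) \<alpha>, snd (p i))) \<in> measurable (PiM {i} (\<lambda>_. rowM)) (count_space UNIV \<Otimes>\<^sub>M (\<Pi>\<^sub>M k\<in>{1..}. S))"
    using \<alpha> by (intro measurable_Pair measurable_compose[OF pi measurable_snd]
        measurable_compose[OF measurable_compose[OF pi measurable_fst] measurable_component_singleton]) auto
  from indep_rv_compose[OF I measurable_ident this] show ?thesis using \<alpha> by (simp add: row_def)
qed

end

section \<open>The chain ladder model\<close>

text \<open>Factors are exchanged one at a time: in the \<open>s\<close>-th summand those to the
  left of \<open>s\<close> are already \<open>h\<close>, those to the right are still
  \<open>g\<close>.\<close>

lemma prod_diff_telescope:
  fixes g h :: "nat \<Rightarrow> 'a::comm_ring_1"
  assumes "a \<le> b"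
  shows "(\<Prod>s=a..<b. g s) - (\<Prod>s=a..<b. h s) =
    (\<Sum>s=a..<b. (\<Prod>r=a..<s. h r) * (g s - h s) * (\<Prod>r=Suc s..<b. g r))"
  using assms
proof (induction b rule: dec_induct)
  case (step b)
  have "(\<Sum>s=a..<Suc b. (\<Prod>r=a..<s. h r) * (g s - h s) * (\<Prod>r=Suc s..<Suc b. g r)) =
      (\<Sum>s=a..<b. (\<Prod>r=a..<s. h r) * (g s - h s) * (\<Prod>r=Suc s..<b. g r)) * g b + (\<Prod>r=a..<b. h r) * (g b - h b)"
    using step(1) by (simp add: sum_distrib_right mult.assoc)
  then show ?case using step by (simp add: step.IH[symmetric] algebra_simps)
qed simp

lemma prod_ratio_telescope:
  fixes m :: "nat \<Rightarrow> 'a::field"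
  assumes "a \<le> b" "\<And>s. a \<le> s \<Longrightarrow> s < b \<Longrightarrow> m s \<noteq> 0" "m a \<noteq> 0"
  shows "(\<Prod>s=a..<b. m (Suc s) / m s) = m b / m a"
  using assms by (induction b rule: dec_induct) auto

text \<open>A sequence tending to infinity is eventually at least 1, so \<open>max 1 (a n)\<close>
  differs from it in finitely many terms only. This makes square roots and Poisson parameters
  positive for every \<open>n\<close>.\<close>

lemma conv_distr_at_topI:
  assumes "\<And>b. filterlim b at_top sequentially \<Longrightarrow> (\<And>n. b n > 0) \<Longrightarrow> weak_conv_m (\<lambda>n. distr M borel (X (b n))) L"
  shows "conv_distr_at_top M X L"
  unfolding conv_distr_at_top_def
proof (intro allI impI)
  fix a :: "nat \<Rightarrow> real" assume a: "filterlim a at_top sequentially"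
  define b where "b n = max 1 (a n)" for n
  have ev: "\<forall>\<^sub>F n in sequentially. b n = a n"
    using filterlim_at_top[THEN iffD1, OF a, rule_format, of 1] by eventually_elim (simp add: b_def)
  have "filterlim b at_top sequentially"
    by (rule filterlim_at_top_mono[OF a]) (auto simp: b_def)
  then have w: "weak_conv_m (\<lambda>n. distr M borel (X (b n))) L" by (rule assms) (auto simp: b_def)
  show "weak_conv_m (\<lambda>n. distr M borel (X (a n))) L"
    unfolding weak_conv_m_def weak_conv_def
  proof (intro allI impI)
    fix x assume "isCont (cdf L) x"
    then have "(\<lambda>n. cdf (distr M borel (X (b n))) x) \<longlonglongrightarrow> cdf L x"
      using w by (simp add: weak_conv_m_def weak_conv_def)
    then show "(\<lambda>n. cdf (distr M borel (X (a n))) x) \<longlonglongrightarrow> cdf L x"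
      by (rule Lim_transform_eventually) (use ev in eventually_elim, simp)
  qed
qed

text \<open>The integral against an indicator is specialised to an empty family of observed sums and
  the whole space as event.\<close>

lemma (in poisson_rows) integrable_total:
  assumes j: "j \<in> J" and \<alpha>: "\<alpha> > 0" and h: "integrable \<mu> h"
  shows "integrable M (total j h \<alpha>)"
proof -
  interpret C: compound_poisson M S \<mu> "X j" "N j \<alpha>" "lam j * \<alpha>" using j \<alpha> by (rule compound_poisson_row)
  let ?Q = "PiM (J - {j}) (\<lambda>_. rowM)" and ?W = "\<lambda>\<omega>. \<lambda>j\<in>J-{j}. row j \<omega>"
  have W: "indep_rv M ?Q ?W (count_space UNIV \<Otimes>\<^sub>M (\<Pi>\<^sub>M k\<in>{1..}. S)) (\<lambda>\<omega>. (N j \<alpha> \<omega>, \<lambda>k\<in>{1..}. X j k \<omega>))"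
    using j \<alpha> by (intro indep_rv_other_rows) auto
  have s: "(\<lambda>\<omega>. (?W \<omega>, \<lambda>t\<in>{}. 0 :: real)) -` space (?Q \<Otimes>\<^sub>M (\<Pi>\<^sub>M t\<in>({} :: nat set). borel)) \<inter> space M = space M"
  proof -
    have "(\<lambda>t\<in>{}. 0 :: real) \<in> space (\<Pi>\<^sub>M t\<in>({} :: nat set). borel)" by (simp add: space_PiM restrict_def)
    then show ?thesis
      using measurable_space[of ?W M ?Q] W by (auto simp: indep_rv_def space_pair_measure)
  qed
  have "integrable M (\<lambda>\<omega>. indicator (space M) \<omega> * total j h \<alpha> \<omega>)"
    using C.has_integral_compound_times_indicator[OF h _ W sets.top, of "{}" "\<lambda>_ _. 0"]
    unfolding total_def[abs_def] by (subst s[symmetric]) (auto simp: has_bochner_integral_iff restrict_def)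
  then show ?thesis by (rule Bochner_Integration.integrable_cong[THEN iffD1, rotated -1]) auto
qed

section \<open>Mark functions and fluctuations in the chain ladder model\<close>

locale chain_ladder = poisson_rows M "{1..T}" "count_space UNIV \<Otimes>\<^sub>M borel" \<mu> lam N X
  for M :: "'a measure" and T :: nat and \<mu> :: "(nat \<times> real) measure" and lam :: "nat \<Rightarrow> real"
    and N :: "nat \<Rightarrow> real \<Rightarrow> 'a \<Rightarrow> nat" and X :: "nat \<Rightarrow> nat \<Rightarrow> 'a \<Rightarrow> nat \<times> real" +
  fixes i :: nat
  assumes i: "2 \<le> i" "i \<le> T"
    and sq: "integrable \<mu> (\<lambda>x. (snd x)\<^sup>2)"
    and range: "AE x in \<mu>. fst x \<in> {1..T}"
    and pos: "t \<in> {1..T} \<Longrightarrow> (\<integral>x. snd x * of_bool (fst x = t) \<partial>\<mu>) > 0"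
begin

definition paid :: "nat \<Rightarrow> nat \<times> real \<Rightarrow> real" where
  "paid t x = snd x * of_bool (fst x \<le> t)"

definition m :: "nat \<Rightarrow> real" where "m t = (\<integral>x. paid t x \<partial>\<mu>)"

definition f :: "nat \<Rightarrow> real" where "f t = m (Suc t) / m t"

text \<open>A vector space of mark functions of linear growth in the claim size. Its members are
  square integrable under \<open>\<mu>\<close>, so the moment conditions of all limit theorems below
  are checked once.\<close>

definition lin_bdd :: "(nat \<times> real \<Rightarrow> real) \<Rightarrow> bool" where
  "lin_bdd h \<longleftrightarrow> h \<in> borel_measurable (count_space UNIV \<Otimes>\<^sub>M borel) \<and> (\<exists>K. \<forall>x. \<bar>h x\<bar> \<le> K * \<bar>snd x\<bar>)"

lemma sets_mu [measurable_cong]: "sets \<mu> = sets (count_space UNIV \<Otimes>\<^sub>M borel)"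
  using i by (intro sets_\<mu>[of 1]) auto

lemma prob_mu: "prob_space \<mu>"
  using i by (intro compound_poisson.prob_space_\<mu>[OF compound_poisson_row[of 1 1]]) auto

lemma snd_mu: "integrable \<mu> snd"
proof -
  interpret \<mu>: prob_space \<mu> by (rule prob_mu)
  show ?thesis by (rule \<mu>.square_integrable_imp_integrable) (use sq in auto)
qed

lemma lin_bdd_measurable: "lin_bdd h \<Longrightarrow> h \<in> borel_measurable (count_space UNIV \<Otimes>\<^sub>M borel)"
  by (simp add: lin_bdd_def)

lemma lin_bdd_integrable:
  assumes "lin_bdd h"
  shows "integrable \<mu> h" "integrable \<mu> (\<lambda>x. (h x)\<^sup>2)"
proof -
  have [measurable]: "h \<in> borel_measurable \<mu>" using lin_bdd_measurable[OF assms] by (simp cong: measurable_cong_sets add: sets_mu)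
  obtain K where K: "\<And>x. \<bar>h x\<bar> \<le> K * \<bar>snd x\<bar>" using assms unfolding lin_bdd_def by metis
  show "integrable \<mu> h"
    by (rule Bochner_Integration.integrable_bound[of _ "\<lambda>x. K * \<bar>snd x\<bar>"])
       (use snd_mu K in \<open>auto intro!: AE_I2 intro: order_trans[OF _ abs_ge_self]\<close>)
  have "norm ((h x)\<^sup>2) \<le> norm (K\<^sup>2 * (snd x)\<^sup>2)" for x
    using power_mono[OF K[of x], of 2] by (simp add: power_mult_distrib)
  then show "integrable \<mu> (\<lambda>x. (h x)\<^sup>2)"
    by (intro Bochner_Integration.integrable_bound[OF integrable_mult_right[OF sq, of "K\<^sup>2"]] AE_I2) measurable
qed

lemma lin_bdd_paid: "lin_bdd (paid t)"
proof -
  have "paid t \<in> borel_measurable (count_space UNIV \<Otimes>\<^sub>M borel)"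
    unfolding paid_def[abs_def]
    by (intro borel_measurable_times measurable_snd measurable_compose[OF measurable_fst, of "\<lambda>d. of_bool (d \<le> t)"]) auto
  then show ?thesis unfolding lin_bdd_def by (intro conjI exI[of _ 1]) (auto simp: paid_def)
qed

lemma lin_bdd_0: "lin_bdd (\<lambda>x. 0)"
  unfolding lin_bdd_def by (intro conjI exI[of _ 0]) auto

lemma lin_bdd_diff:
  assumes "lin_bdd g" "lin_bdd h"
  shows "lin_bdd (\<lambda>x. g x - h x)"
proof -
  from assms obtain K L where "\<And>x. \<bar>g x\<bar> \<le> K * \<bar>snd x\<bar>" "\<And>x. \<bar>h x\<bar> \<le> L * \<bar>snd x\<bar>"
    unfolding lin_bdd_def by metis
  then have "\<bar>g x - h x\<bar> \<le> (K + L) * \<bar>snd x\<bar>" for x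
    by (smt (verit) distrib_right)
  then show ?thesis using assms unfolding lin_bdd_def by (intro conjI exI[of _ "K + L"]) auto
qed

lemma lin_bdd_cmult:
  assumes "lin_bdd g"
  shows "lin_bdd (\<lambda>x. c * g x)"
proof -
  from assms obtain K where "\<And>x. \<bar>g x\<bar> \<le> K * \<bar>snd x\<bar>" unfolding lin_bdd_def by metis
  then have "\<bar>c * g x\<bar> \<le> (\<bar>c\<bar> * K) * \<bar>snd x\<bar>" for x
    by (simp add: abs_mult mult.assoc mult_left_mono)
  then show ?thesis using assms unfolding lin_bdd_def by (intro conjI exI[of _ "\<bar>c\<bar> * K"]) auto
qed

lemma lin_bdd_sum: "finite A \<Longrightarrow> (\<And>s. s \<in> A \<Longrightarrow> lin_bdd (g s)) \<Longrightarrow> lin_bdd (\<lambda>x. \<Sum>s\<in>A. g s x)"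
proof (induction A rule: finite_induct)
  case (insert s A)
  then have "lin_bdd (\<lambda>x. g s x - (-1) * (\<Sum>s\<in>A. g s x))" by (intro lin_bdd_diff lin_bdd_cmult) auto
  with insert show ?case by simp
qed (simp add: lin_bdd_0)

text \<open>Almost surely delays start at 1, so \<open>m t\<close> splits into the expectations over
  the exact delays \<open>1..t\<close>, each positive by \<open>pos\<close>.\<close>

lemma m_pos: "1 \<le> t \<Longrightarrow> t \<le> T \<Longrightarrow> m t > 0"
proof -
  assume t: "1 \<le> t" "t \<le> T"
  have ae: "AE x in \<mu>. paid t x = (\<Sum>s=1..t. snd x * of_bool (fst x = s))"
    using range by eventually_elim (auto simp: paid_def of_bool_def if_distrib sum.delta' cong: if_cong)
  have int: "integrable \<mu> (\<lambda>x. snd x * of_bool (fst x = s))" for s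
    by (rule Bochner_Integration.integrable_bound[OF snd_mu]) auto
  have "m t = (\<integral>x. (\<Sum>s=1..t. snd x * of_bool (fst x = s)) \<partial>\<mu>)"
    unfolding m_def
    by (intro integral_cong_AE ae borel_measurable_sum borel_measurable_integrable[OF int]
        borel_measurable_integrable[OF lin_bdd_integrable(1)[OF lin_bdd_paid]])
  also have "\<dots> = (\<Sum>s=1..t. \<integral>x. snd x * of_bool (fst x = s) \<partial>\<mu>)"
    by (rule Bochner_Integration.integral_sum) (rule int)
  also have "\<dots> > 0" using t by (intro sum_pos pos) auto
  finally show ?thesis .
qed

text \<open>If the second moment vanished, \<open>h\<close> would be null almost everywhere, so
  claims of delay \<open>t\<close> would have size 0, contradicting \<open>pos\<close>.\<close>

lemma second_moment_pos:
  assumes h: "lin_bdd h" and t: "t \<in> {1..T}" "c \<noteq> 0" and hc: "\<And>z. h (t, z) = c * z"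
  shows "(\<integral>x. (h x)\<^sup>2 \<partial>\<mu>) > 0"
proof (rule ccontr)
  assume "\<not> ?thesis"
  moreover have "(\<integral>x. (h x)\<^sup>2 \<partial>\<mu>) \<ge> 0" by (rule Bochner_Integration.integral_nonneg) simp
  ultimately have "(\<integral>x. (h x)\<^sup>2 \<partial>\<mu>) = 0" by simp
  then have "AE x in \<mu>. (h x)\<^sup>2 = 0"
    by (subst (asm) integral_nonneg_eq_0_iff_AE) (use lin_bdd_integrable[OF h] in auto)
  then have "AE x in \<mu>. snd x * of_bool (fst x = t) = 0"
    by eventually_elim (use hc t(2) in \<open>auto simp: of_bool_def\<close>)
  then have "(\<integral>x. snd x * of_bool (fst x = t) \<partial>\<mu>) = 0" by (rule integral_eq_zero_AE)
  with pos[OF t(1)] show False by simp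
qed

text \<open>The witness, one row and one delay on which the mark function is a nonzero multiple of
  the claim size, forces a strictly positive limiting variance.\<close>

definition nondeg :: "(nat \<Rightarrow> nat \<times> real \<Rightarrow> real) \<Rightarrow> bool" where
  "nondeg h \<longleftrightarrow> (\<forall>j\<in>{1..T}. lin_bdd (h j)) \<and> (\<exists>j\<in>{1..T}. \<exists>t\<in>{1..T}. \<exists>c. c \<noteq> 0 \<and> (\<forall>z. h j (t, z) = c * z))"

definition sd :: "(nat \<Rightarrow> nat \<times> real \<Rightarrow> real) \<Rightarrow> real" where
  "sd h = sqrt (\<Sum>j\<in>{1..T}. lam j * (\<integral>x. (h j x)\<^sup>2 \<partial>\<mu>))"

definition fluct :: "(nat \<Rightarrow> nat \<times> real \<Rightarrow> real) \<Rightarrow> real \<Rightarrow> 'a \<Rightarrow> real" where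
  "fluct h \<alpha> \<omega> = (\<Sum>j\<in>{1..T}. (total j (h j) \<alpha> \<omega> - \<alpha> * lam j * (\<integral>x. h j x \<partial>\<mu>)) / sqrt \<alpha>)"

lemma fluct_measurable: "nondeg h \<Longrightarrow> \<alpha> > 0 \<Longrightarrow> fluct h \<alpha> \<in> borel_measurable M"
  unfolding fluct_def[abs_def] nondeg_def
  by (intro borel_measurable_sum borel_measurable_divide borel_measurable_diff total_measurable)
     (auto intro: lin_bdd_measurable)

lemma var_term_nonneg: "j \<in> {1..T} \<Longrightarrow> 0 \<le> lam j * (\<integral>x. (h x)\<^sup>2 \<partial>\<mu>)"
  by (intro mult_nonneg_nonneg less_imp_le[OF lam_pos] Bochner_Integration.integral_nonneg) auto

lemma sd_pos: "nondeg h \<Longrightarrow> sd h > 0"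
proof -
  assume n: "nondeg h"
  then obtain j where j: "j \<in> {1..T}" "(\<integral>x. (h j x)\<^sup>2 \<partial>\<mu>) > 0"
    unfolding nondeg_def using second_moment_pos by metis
  have "0 < lam j * (\<integral>x. (h j x)\<^sup>2 \<partial>\<mu>)" using j lam_pos by simp
  also have "\<dots> \<le> (\<Sum>j\<in>{1..T}. lam j * (\<integral>x. (h j x)\<^sup>2 \<partial>\<mu>))"
    using j by (intro member_le_sum var_term_nonneg) auto
  finally show ?thesis by (simp add: sd_def)
qed

context
  fixes a :: "nat \<Rightarrow> real"
  assumes a: "filterlim a at_top sequentially" "\<And>n. a n > 0"
begin

lemma fluct_weak_conv:
  assumes n: "nondeg h"
  shows "weak_conv_m (\<lambda>n. distr M borel (fluct h (a n))) (density lborel (normal_density 0 (sd h)))"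
  unfolding fluct_def[abs_def]
proof (rule central_limit_rows[OF _ _ sd_pos[OF n] _ a])
  have "(\<Sum>j\<in>{1..T}. lam j * (\<integral>x. (h j x)\<^sup>2 \<partial>\<mu>)) \<ge> 0"
    by (intro sum_nonneg var_term_nonneg)
  then show "(sd h)\<^sup>2 = (\<Sum>j\<in>{1..T}. lam j * (\<integral>x. (h j x)\<^sup>2 \<partial>\<mu>))" by (simp add: sd_def)
qed (use n in \<open>auto simp: nondeg_def intro: lin_bdd_measurable lin_bdd_integrable\<close>)

lemma fluct_tight: "nondeg h \<Longrightarrow> tight_seq M (\<lambda>n. fluct h (a n))"
  by (rule weak_conv_imp_tight_seq[OF _ _ fluct_weak_conv])
     (auto intro: fluct_measurable a real_distribution_normal sd_pos)

text \<open>A tight fluctuation divided by \<open>sqrt (a n)\<close> vanishes in probability, so the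
  weak law follows from the central limit theorem.\<close>

lemma law_of_large_numbers:
  assumes n: "nondeg h"
  shows "((\<lambda>(n, \<omega>). (\<Sum>j\<in>{1..T}. total j (h j) (a n) \<omega>) / a n) \<longlongrightarrow> (\<Sum>j\<in>{1..T}. lam j * (\<integral>x. h j x \<partial>\<mu>))) (in_prob M)"
proof -
  let ?l = "\<Sum>j\<in>{1..T}. lam j * (\<integral>x. h j x \<partial>\<mu>)"
  have "(\<lambda>n. 1 / sqrt (a n)) \<longlonglongrightarrow> 0"
    by (intro tendsto_divide_0[OF tendsto_const] filterlim_at_top_imp_at_infinity filterlim_compose[OF sqrt_at_top a(1)])
  from filterlim_compose[OF this filterlim_fst_in_prob]
  have "((\<lambda>(n, \<omega>). 1 / sqrt (a n)) \<longlongrightarrow> 0) (in_prob M)" by (simp add: case_prod_beta')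
  then have "((\<lambda>(n, \<omega>). 1 / sqrt (a n) * fluct h (a n) \<omega>) \<longlongrightarrow> 0) (in_prob M)"
    using n by (intro tendsto_in_prob_mult_tight fluct_tight fluct_measurable a)
  then have "((\<lambda>p. 1 / sqrt (a (fst p)) * fluct h (a (fst p)) (snd p) + ?l) \<longlongrightarrow> 0 + ?l) (in_prob M)"
    unfolding case_prod_beta' by (intro tendsto_add tendsto_const)
  moreover have "1 / sqrt (a k) * fluct h (a k) \<omega> + ?l = (\<Sum>j\<in>{1..T}. total j (h j) (a k) \<omega>) / a k" for k \<omega>
  proof -
    have "1 / sqrt (a k) * fluct h (a k) \<omega> = (\<Sum>j\<in>{1..T}. (total j (h j) (a k) \<omega> - a k * lam j * (\<integral>x. h j x \<partial>\<mu>)) / a k)"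
      unfolding fluct_def sum_distrib_left using a(2)[of k] by (intro sum.cong) (auto simp: field_simps)
    also have "\<dots> = (\<Sum>j\<in>{1..T}. total j (h j) (a k) \<omega>) / a k - ?l"
      using a(2)[of k] by (simp add: diff_divide_distrib sum_subtractf sum_divide_distrib)
    finally show ?thesis by simp
  qed
  ultimately show ?thesis by (simp add: case_prod_beta')
qed

end

end

section \<open>The observed algebra\<close>

lemma sets_obs_alg_subset:
  assumes "space G = space M"
    and "\<And>j t. j \<in> {1..T} \<Longrightarrow> t \<in> {1..T} \<Longrightarrow> j + t \<le> T + 1 \<Longrightarrow> C j t \<in> borel_measurable G"
  shows "sets (obs_alg M T C) \<subseteq> sets G"
  unfolding obs_alg_def
proof (subst sets_measure_of)
  show "sigma_sets (space M) (\<Union>j\<in>{1..T}. \<Union>t\<in>{1..T}. if j + t \<le> T + 1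
        then {C j t -` B \<inter> space M | B. B \<in> sets borel} else {}) \<subseteq> sets G"
    unfolding assms(1)[symmetric]
    by (rule sets.sigma_sets_subset) (auto intro: measurable_sets[OF assms(2)] split: if_splits)
qed (auto split: if_splits)

lemma measurable_obs_alg:
  assumes "j \<in> {1..T}" "t \<in> {1..T}" "j + t \<le> T + 1"
  shows "C j t \<in> borel_measurable (obs_alg M T C)"
  unfolding obs_alg_def
proof (rule measurableI)
  let ?E = "\<Union>j\<in>{1..T}. \<Union>t\<in>{1..T}. if j + t \<le> T + 1 then {C j t -` B \<inter> space M | B. B \<in> sets borel} else {}"
  have E: "?E \<subseteq> Pow (space M)" by (auto split: if_splits)
  fix B :: "real set" assume "B \<in> sets borel"
  then have "C j t -` B \<inter> space M \<in> ?E" using assms by force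
  then show "C j t -` B \<inter> space (sigma (space M) ?E) \<in> sets (sigma (space M) ?E)"
    using E by (simp add: space_measure_of sets_measure_of)
qed simp

section \<open>Explicit versions of the two factors and their limits\<close>

context chain_ladder
begin

text \<open>The last development period observed in row \<open>i\<close>: the largest
  \<open>t\<close> with \<open>i + t \<le> T + 1\<close>.\<close>

definition s0 :: nat where "s0 = T - i + 1"

lemma s0: "1 \<le> s0" "s0 < T" "T - s0 = i - 1"
  using i by (auto simp: s0_def)

text \<open>Rewrites a sum over the rows \<open>1..T-s\<close> as one over all rows, so that
  expressions with different \<open>s\<close> fit the same limit theorem.\<close>

definition on_rows :: "nat \<Rightarrow> (nat \<times> real \<Rightarrow> real) \<Rightarrow> nat \<Rightarrow> nat \<times> real \<Rightarrow> real" where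
  "on_rows s g j = (if j \<le> T - s then g else (\<lambda>_. 0))"

definition Lam :: "nat \<Rightarrow> real" where "Lam s = (\<Sum>j=1..T-s. lam j)"

text \<open>The telescoped product of the \<open>f s\<close> over \<open>{s0..<T}\<close>.\<close>

definition ratio :: real where "ratio = m T / m s0"

abbreviation C :: "real \<Rightarrow> nat \<Rightarrow> nat \<Rightarrow> 'a \<Rightarrow> real" where "C \<alpha> j t \<equiv> total j (paid t) \<alpha>"

text \<open>Summed over the rows up to \<open>T - s\<close>, this is the numerator of
  \<open>f_hat - f\<close> at \<open>s\<close>. The choice of \<open>f s\<close> gives it mean
  zero.\<close>

definition dev :: "nat \<Rightarrow> nat \<times> real \<Rightarrow> real" where "dev s x = paid (Suc s) x - f s * paid s x"

text \<open>The limit of the random coefficient that telescoping puts in front of the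
  \<open>s\<close>-th fluctuation: estimators to the left of \<open>s\<close> become
  \<open>f\<close>, and the denominator of \<open>f_hat\<close> per unit of exposure becomes
  \<open>Lam s * m s\<close>. The sign comes from \<open>f - f_hat\<close>.\<close>

definition weight :: "nat \<Rightarrow> real" where
  "weight s = - (\<Prod>r=s0..<s. f r) * (\<Prod>r=Suc s..<T. f r) * inverse (Lam s * m s)"

text \<open>The linearisation of \<open>A2'\<close>. Combining the periods inside the mark function
  absorbs the dependence between different \<open>s\<close>; only independence of rows remains to be
  used.\<close>

definition main_term :: "nat \<Rightarrow> nat \<times> real \<Rightarrow> real" where
  "main_term j x = (\<Sum>s=s0..<T. weight s * on_rows s (dev s) j x)"

definition A1' :: "real \<Rightarrow> 'a \<Rightarrow> real" where
  "A1' \<alpha> \<omega> = (1 - ratio) * (C \<alpha> i s0 \<omega> - \<alpha> * lam i * m s0) / sqrt \<alpha>"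

definition A2' :: "real \<Rightarrow> 'a \<Rightarrow> real" where
  "A2' \<alpha> \<omega> = sqrt \<alpha> * ((\<Prod>s=s0..<T. f s) - (\<Prod>s=s0..<T. f_hat T (C \<alpha>) s \<omega>))"

lemma m_less: "s < t \<Longrightarrow> t \<le> T \<Longrightarrow> m s < m t"
proof (induction t)
  case (Suc t)
  have "m (Suc t) - m t = (\<integral>x. paid (Suc t) x - paid t x \<partial>\<mu>)"
    unfolding m_def by (rule Bochner_Integration.integral_diff[symmetric]) (rule lin_bdd_integrable[OF lin_bdd_paid])+
  also have "(\<lambda>x. paid (Suc t) x - paid t x) = (\<lambda>x. snd x * of_bool (fst x = Suc t))"
    by (auto simp: paid_def fun_eq_iff of_bool_def)
  also have "(\<integral>x. snd x * of_bool (fst x = Suc t) \<partial>\<mu>) > 0" using Suc by (intro pos) auto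
  finally show ?case using Suc by (cases "s = t") auto
qed simp

lemma lin_bdd_on_rows: "lin_bdd g \<Longrightarrow> lin_bdd (on_rows s g j)"
  by (simp add: on_rows_def lin_bdd_0)

lemma lin_bdd_dev: "lin_bdd (dev s)"
  unfolding dev_def[abs_def] by (intro lin_bdd_diff lin_bdd_cmult lin_bdd_paid)

lemma lin_bdd_main_term: "lin_bdd (main_term j)"
  unfolding main_term_def[abs_def] by (intro lin_bdd_sum lin_bdd_cmult lin_bdd_on_rows lin_bdd_dev) auto

lemma nondeg_on_rows:
  assumes "s < T" "lin_bdd g" "t \<in> {1..T}" "\<And>z. g (t, z) = z"
  shows "nondeg (on_rows s g)"
  unfolding nondeg_def using assms
  by (intro conjI ballI lin_bdd_on_rows bexI[of _ 1] bexI[of _ t] exI[of _ 1]) (auto simp: on_rows_def)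

text \<open>Row 1 belongs to every sum, and at delay \<open>T\<close> all \<open>dev s\<close> with
  \<open>s < T - 1\<close> vanish while \<open>dev (T - 1)\<close> returns the claim size. No
  cancellation between periods is thus possible there.\<close>

lemma nondeg_main_term: "nondeg main_term"
proof -
  have Tm: "T - 1 \<in> {s0..<T}" using s0 by auto
  have "main_term 1 (T, z) = weight (T - 1) * z" for z
  proof -
    have "main_term 1 (T, z) = (\<Sum>s=s0..<T. if s = T - 1 then weight (T - 1) * z else 0)"
      unfolding main_term_def by (rule sum.cong) (auto simp: on_rows_def dev_def paid_def of_bool_def)
    also have "\<dots> = weight (T - 1) * z" using Tm by (simp add: sum.delta)
    finally show ?thesis .
  qed
  moreover have "f r \<noteq> 0" if "1 \<le> r" "r < T" for r
    using m_pos[of r] m_pos[of "Suc r"] that by (simp add: f_def)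
  moreover have "Lam (T - 1) > 0" unfolding Lam_def using i by (intro sum_pos lam_pos) auto
  moreover have "m (T - 1) > 0" using i by (intro m_pos) auto
  ultimately have "weight (T - 1) \<noteq> 0" using s0 by (auto simp: weight_def prod_zero_iff)
  with \<open>\<And>z. main_term 1 (T, z) = weight (T - 1) * z\<close> i show ?thesis
    unfolding nondeg_def using lin_bdd_main_term
    by (intro conjI ballI bexI[of _ 1] bexI[of _ T] exI[of _ "weight (T - 1)"]) auto
qed

lemma sum_on_rows: "(\<Sum>j=1..T-s. total j g \<alpha> \<omega>) = (\<Sum>j\<in>{1..T}. total j (on_rows s g j) \<alpha> \<omega>)"
  by (rule sum.mono_neutral_cong_left) (auto simp: on_rows_def total_0)

lemma integral_on_rows: "(\<integral>x. on_rows s g j x \<partial>\<mu>) = (if j \<le> T - s then (\<integral>x. g x \<partial>\<mu>) else 0)"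
  by (simp add: on_rows_def)

lemma integral_dev: "1 \<le> s \<Longrightarrow> s < T \<Longrightarrow> (\<integral>x. dev s x \<partial>\<mu>) = 0"
  unfolding dev_def using lin_bdd_integrable(1)[OF lin_bdd_paid] m_pos[of s]
  by (simp add: f_def flip: m_def)

text \<open>The centring disappears because \<open>dev s\<close> has mean zero, which leaves
  observable sums only.\<close>

lemma fluct_dev:
  assumes "1 \<le> s" "s < T"
  shows "fluct (on_rows s (dev s)) \<alpha> \<omega> = ((\<Sum>j=1..T-s. C \<alpha> j (Suc s) \<omega>) - f s * (\<Sum>j=1..T-s. C \<alpha> j s \<omega>)) / sqrt \<alpha>"
proof -
  have "fluct (on_rows s (dev s)) \<alpha> \<omega> = (\<Sum>j\<in>{1..T}. total j (on_rows s (dev s) j) \<alpha> \<omega>) / sqrt \<alpha>"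
    using assms by (simp add: fluct_def integral_on_rows integral_dev sum_divide_distrib cong: if_cong)
  also have "\<dots> = (\<Sum>j=1..T-s. total j (dev s) \<alpha> \<omega>) / sqrt \<alpha>" by (simp only: sum_on_rows)
  also have "(\<Sum>j=1..T-s. total j (dev s) \<alpha> \<omega>) = (\<Sum>j=1..T-s. C \<alpha> j (Suc s) \<omega>) - f s * (\<Sum>j=1..T-s. C \<alpha> j s \<omega>)"
    unfolding dev_def[abs_def] total_diff total_cmult by (simp add: sum_subtractf sum_distrib_left)
  finally show ?thesis .
qed

lemma fluct_main_term: "fluct main_term \<alpha> \<omega> = (\<Sum>s=s0..<T. weight s * fluct (on_rows s (dev s)) \<alpha> \<omega>)"
proof -
  have 0: "(\<integral>x. on_rows s (dev s) j x \<partial>\<mu>) = 0" if "s \<in> {s0..<T}" for s j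
    using that s0 by (simp add: integral_on_rows integral_dev)
  have "(\<integral>x. main_term j x \<partial>\<mu>) = (\<Sum>s=s0..<T. \<integral>x. weight s * on_rows s (dev s) j x \<partial>\<mu>)" for j
    unfolding main_term_def
    by (intro Bochner_Integration.integral_sum integrable_mult_right lin_bdd_integrable lin_bdd_on_rows lin_bdd_dev)
  also have "\<dots> j = 0" for j using 0 by simp
  finally have "(\<integral>x. main_term j x \<partial>\<mu>) = 0" for j .
  then have "fluct main_term \<alpha> \<omega> = (\<Sum>j\<in>{1..T}. \<Sum>s=s0..<T. weight s * total j (on_rows s (dev s) j) \<alpha> \<omega> / sqrt \<alpha>)"
    unfolding fluct_def main_term_def[abs_def] by (simp add: total_sum total_cmult sum_divide_distrib)
  also have "\<dots> = (\<Sum>s=s0..<T. \<Sum>j\<in>{1..T}. weight s * total j (on_rows s (dev s) j) \<alpha> \<omega> / sqrt \<alpha>)"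
    by (rule sum.swap)
  also have "\<dots> = (\<Sum>s=s0..<T. weight s * fluct (on_rows s (dev s)) \<alpha> \<omega>)"
    by (rule sum.cong) (use 0 in \<open>auto simp: fluct_def sum_distrib_left\<close>)
  finally show ?thesis .
qed

lemma C_measurable: "j \<in> {1..T} \<Longrightarrow> \<alpha> \<ge> 0 \<Longrightarrow> C \<alpha> j t \<in> borel_measurable M"
  by (intro total_measurable lin_bdd_measurable lin_bdd_paid) auto

lemma f_hat_measurable: "\<alpha> \<ge> 0 \<Longrightarrow> f_hat T (C \<alpha>) s \<in> borel_measurable M"
  unfolding f_hat_def[abs_def] by (intro borel_measurable_divide borel_measurable_sum C_measurable) auto

lemma A2'_measurable: "\<alpha> \<ge> 0 \<Longrightarrow> A2' \<alpha> \<in> borel_measurable M"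
  unfolding A2'_def[abs_def]
  by (intro borel_measurable_times borel_measurable_diff borel_measurable_prod f_hat_measurable) auto

lemma A1'_measurable: "\<alpha> \<ge> 0 \<Longrightarrow> A1' \<alpha> \<in> borel_measurable M"
  unfolding A1'_def[abs_def] using i
  by (intro borel_measurable_divide borel_measurable_times borel_measurable_diff C_measurable) auto

lemma A1'_weak_conv:
  "\<exists>\<sigma>>0. \<forall>a. filterlim a at_top sequentially \<longrightarrow> (\<forall>n. a n > 0) \<longrightarrow>
    weak_conv_m (\<lambda>n. distr M borel (A1' (a n))) (density lborel (normal_density 0 \<sigma>))"
proof -
  define k where "k = 1 - ratio"
  \<comment> \<open>Only row \<open>i\<close> carries a nonzero mark function, so the fluctuation is
    \<open>A1'\<close> itself; \<open>m s0 < m T\<close> makes the factor \<open>k\<close>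
    nonzero.\<close>
  define h where "h j = (if j = i then (\<lambda>x. k * paid s0 x) else (\<lambda>_. 0))" for j
  have r: "k \<noteq> 0" using m_less[of s0 T] m_pos[of s0] s0 by (auto simp: k_def ratio_def)
  have "lin_bdd (h j)" for j by (simp add: h_def lin_bdd_0 lin_bdd_cmult lin_bdd_paid)
  moreover have "h i (s0, z) = k * z" for z by (simp add: h_def paid_def)
  ultimately have n: "nondeg h"
    unfolding nondeg_def using r i s0
    by (intro conjI ballI bexI[of _ i] bexI[of _ s0] exI[of _ k]) auto
  have "fluct h \<alpha> \<omega> = A1' \<alpha> \<omega>" for \<alpha> \<omega>
  proof -
    have "fluct h \<alpha> \<omega> = (\<Sum>j\<in>{1..T}. if j = i then A1' \<alpha> \<omega> else 0)"
      unfolding fluct_def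
      by (rule sum.cong) (auto simp: h_def total_0 total_cmult A1'_def m_def algebra_simps simp flip: k_def)
    then show ?thesis using i by (simp add: sum.delta)
  qed
  then have "fluct h = A1'" by (simp add: fun_eq_iff)
  with fluct_weak_conv[OF _ _ n] sd_pos[OF n] show ?thesis by auto
qed

text \<open>The difference from the linearisation is a sum of terms
  \<open>(W s - weight s) * U s\<close>, a vanishing factor times a tight one.\<close>

lemma A2'_weak_conv:
  assumes a: "filterlim a at_top sequentially" "\<And>n. a n > 0"
  shows "weak_conv_m (\<lambda>n. distr M borel (A2' (a n))) (density lborel (normal_density 0 (sd main_term)))"
proof (rule slutsky)
  have an: "a n \<ge> 0" for n using a(2)[of n] by simp
  show "real_distribution (density lborel (normal_density 0 (sd main_term)))"
    by (intro real_distribution_normal sd_pos nondeg_main_term)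
  show "weak_conv_m (\<lambda>n. distr M borel (fluct main_term (a n))) (density lborel (normal_density 0 (sd main_term)))"
    using a nondeg_main_term by (rule fluct_weak_conv)
  show "fluct main_term (a n) \<in> borel_measurable M" for n
    using nondeg_main_term a(2) by (rule fluct_measurable)
  show "A2' (a n) \<in> borel_measurable M" for n using an by (rule A2'_measurable)
  \<comment> \<open>These quantities are functions of the pair \<open>p = (n, \<omega>)\<close>, so
    that limit rules for products and quotients apply along \<open>in_prob M\<close>.\<close>
  define q where "q s t p = (\<Sum>j=1..T-s. C (a (fst p)) j t (snd p))" for s t and p :: "nat \<times> 'a"
  define fh where "fh s p = f_hat T (C (a (fst p))) s (snd p)" for s and p :: "nat \<times> 'a"
  define U where "U s p = fluct (on_rows s (dev s)) (a (fst p)) (snd p)" for s and p :: "nat \<times> 'a"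
  define W where "W s p = - (\<Prod>r=s0..<s. fh r p) * (\<Prod>r=Suc s..<T. f r) * inverse (q s s p / a (fst p))" for s and p :: "nat \<times> 'a"
  have q: "((\<lambda>p. q s t p / a (fst p)) \<longlongrightarrow> Lam s * m t) (in_prob M)" if s: "1 \<le> s" "s < T" and t: "1 \<le> t" "t \<le> T" for s t
  proof -
    have "nondeg (on_rows s (paid t))"
      using s t by (intro nondeg_on_rows[of _ _ t] lin_bdd_paid) (auto simp: paid_def)
    from law_of_large_numbers[OF a this]
    have "((\<lambda>p. q s t p / a (fst p)) \<longlongrightarrow> (\<Sum>j\<in>{1..T}. lam j * (if j \<le> T - s then m t else 0))) (in_prob M)"
      by (simp only: case_prod_beta' q_def sum_on_rows integral_on_rows m_def)
    also have "(\<Sum>j\<in>{1..T}. lam j * (if j \<le> T - s then m t else 0)) = Lam s * m t"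
      unfolding Lam_def sum_distrib_right by (rule sum.mono_neutral_cong_right) auto
    finally show ?thesis .
  qed
  have Lam: "Lam s > 0" if "s < T" for s
    unfolding Lam_def using that by (intro sum_pos lam_pos) auto
  have fh_lim: "(fh s \<longlongrightarrow> f s) (in_prob M)" if s: "1 \<le> s" "s < T" for s
  proof -
    \<comment> \<open>Numerator and denominator of \<open>f_hat\<close> are both divided by the
      exposure, to which the law of large numbers applies.\<close>
    have "((\<lambda>p. (q s (Suc s) p / a (fst p)) / (q s s p / a (fst p))) \<longlongrightarrow> (Lam s * m (Suc s)) / (Lam s * m s)) (in_prob M)"
      using s Lam[of s] m_pos[of s] by (intro tendsto_divide q) auto
    moreover have "(q s (Suc s) p / a (fst p)) / (q s s p / a (fst p)) = fh s p" for p
      using a(2)[of "fst p"] by (simp add: fh_def f_hat_def q_def)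
    ultimately show ?thesis using s Lam[of s] by (simp add: f_def)
  qed
  have W_lim: "(W s \<longlongrightarrow> weight s) (in_prob M)" if s: "s \<in> {s0..<T}" for s
    unfolding W_def weight_def using s s0 Lam[of s] m_pos[of s]
    by (intro tendsto_mult tendsto_minus tendsto_prod tendsto_const fh_lim tendsto_inverse q) auto
  have small: "((\<lambda>p. (W s p - weight s) * U s p) \<longlongrightarrow> 0) (in_prob M)" if s: "s \<in> {s0..<T}" for s
  proof -
    have nd: "nondeg (on_rows s (dev s))"
      using s s0 by (intro nondeg_on_rows[of _ _ "Suc s"] lin_bdd_dev) (auto simp: dev_def paid_def)
    have "((\<lambda>p. W s p - weight s) \<longlongrightarrow> weight s - weight s) (in_prob M)"
      by (intro tendsto_diff W_lim[OF s] tendsto_const)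
    then have "((\<lambda>(n, \<omega>). W s (n, \<omega>) - weight s) \<longlongrightarrow> 0) (in_prob M)" by (simp add: case_prod_beta')
    then have "((\<lambda>(n, \<omega>). (W s (n, \<omega>) - weight s) * fluct (on_rows s (dev s)) (a n) \<omega>) \<longlongrightarrow> 0) (in_prob M)"
      using nd a by (intro tendsto_in_prob_mult_tight fluct_tight fluct_measurable)
    then show ?thesis by (simp add: case_prod_beta' U_def)
  qed
  have "((\<lambda>p. \<Sum>s=s0..<T. (W s p - weight s) * U s p) \<longlongrightarrow> (\<Sum>s=s0..<T. 0)) (in_prob M)"
    by (intro tendsto_sum small)
  \<comment> \<open>By the convention \<open>x / 0 = 0\<close> the algebra below can fail where a
    denominator of \<open>f_hat\<close> vanishes. Along \<open>in_prob M\<close> the denominators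
    are eventually positive, their normalised limits being positive.\<close>
  moreover have "\<forall>\<^sub>F p in in_prob M. \<forall>s\<in>{s0..<T}. q s s p / a (fst p) > 0"
    using s0 by (intro eventually_ball_finite ballI order_tendstoD(1)[OF q]) (auto intro!: mult_pos_pos Lam m_pos)
  then have "\<forall>\<^sub>F p in in_prob M. (\<Sum>s=s0..<T. (W s p - weight s) * U s p) = A2' (a (fst p)) (snd p) - fluct main_term (a (fst p)) (snd p)"
  proof eventually_elim
    case (elim p)
    let ?\<alpha> = "a (fst p)"
    have \<alpha>: "?\<alpha> > 0" by (rule a(2))
    have "A2' ?\<alpha> (snd p) = (\<Sum>s=s0..<T. sqrt ?\<alpha> * ((\<Prod>r=s0..<s. fh r p) * (f s - fh s p) * (\<Prod>r=Suc s..<T. f r)))"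
      using s0 unfolding A2'_def fh_def by (subst prod_diff_telescope) (auto simp: sum_distrib_left)
    also have "\<dots> = (\<Sum>s=s0..<T. W s p * U s p)"
    proof (rule sum.cong[OF refl])
      fix s assume s: "s \<in> {s0..<T}"
      have q0: "q s s p \<noteq> 0" using elim s by force
      have "sqrt ?\<alpha> * (f s - fh s p) = - (U s p * inverse (q s s p / ?\<alpha>))"
      proof -
        have "U s p = (q s (Suc s) p - f s * q s s p) / sqrt ?\<alpha>"
          unfolding U_def q_def using s s0 by (intro fluct_dev) auto
        moreover have "fh s p = q s (Suc s) p / q s s p" by (simp add: fh_def f_hat_def q_def)
        \<comment> \<open>Here \<open>r\<close> is \<open>sqrt ?\<alpha>\<close>, \<open>d\<close>
          is \<open>f s\<close>, and \<open>y / x\<close> is \<open>f_hat\<close>; writing the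
          exposure as \<open>r * r\<close> leaves pure field arithmetic.\<close>
        moreover have "r * (d - y / x) = - ((y - d * x) / r * inverse (x / (r * r)))" if "x \<noteq> 0" "r \<noteq> 0" for r d x y :: real
          using that by (simp add: field_simps)
        from this[OF q0, of "sqrt ?\<alpha>" "f s" "q s (Suc s) p"]
        have "sqrt ?\<alpha> * (f s - q s (Suc s) p / q s s p) =
            - ((q s (Suc s) p - f s * q s s p) / sqrt ?\<alpha> * inverse (q s s p / ?\<alpha>))"
          using \<alpha> by simp
        ultimately show ?thesis by simp
      qed
      moreover have "b * (x * y * z) = (- x * z * v) * u" if "b * y = - (u * v)" for b x y z u v :: real
      proof -
        have "b * (x * y * z) = x * z * (b * y)" by simp
        then show ?thesis by (simp add: that)
      qed
      ultimately show "sqrt ?\<alpha> * ((\<Prod>r=s0..<s. fh r p) * (f s - fh s p) * (\<Prod>r=Suc s..<T. f r)) = W s p * U s p"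
        unfolding W_def by blast
    qed
    finally show ?case by (simp add: fluct_main_term U_def sum_subtractf left_diff_distrib)
  qed
  ultimately have "((\<lambda>p. A2' (a (fst p)) (snd p) - fluct main_term (a (fst p)) (snd p)) \<longlongrightarrow> (\<Sum>s=s0..<T. 0)) (in_prob M)"
    by (rule Lim_transform_eventually)
  then show "((\<lambda>(n, \<omega>). A2' (a n) \<omega> - fluct main_term (a n) \<omega>) \<longlongrightarrow> 0) (in_prob M)"
    by (simp add: case_prod_beta')
qed

text \<open>The variable is the increment from \<open>s0\<close> to \<open>T\<close>, plus
  \<open>1 - ratio\<close> times the sum at \<open>s0\<close>. The first part has a constant
  conditional expectation, the second is observed.\<close>

lemma cond_exp_A1:
  assumes \<alpha>: "\<alpha> > 0"
  shows "AE \<omega> in M. real_cond_exp M (obs_alg M T (C \<alpha>)) (\<lambda>\<omega>. C \<alpha> i T \<omega> - C \<alpha> i s0 \<omega> * ratio) \<omega> / sqrt \<alpha> = A1' \<alpha> \<omega>"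
proof -
  let ?F = "obs_alg M T (C \<alpha>)"
  have iT: "i \<in> {1..T}" using i by auto
  interpret R: compound_poisson M "count_space UNIV \<Otimes>\<^sub>M borel" \<mu> "X i" "N i \<alpha>" "lam i * \<alpha>"
    using iT \<alpha> by (rule compound_poisson_row)
  let ?Q = "PiM ({1..T} - {i}) (\<lambda>_. rowM)" and ?W = "\<lambda>\<omega>. \<lambda>j\<in>{1..T}-{i}. row j \<omega>"
  let ?V = "\<lambda>\<omega>. \<lambda>t\<in>{1..s0}. C \<alpha> i t \<omega>" and ?VM = "\<Pi>\<^sub>M t\<in>{1..s0}. (borel :: real measure)"
  \<comment> \<open>Generated by the other rows in full and the observed sums of row
    \<open>i\<close>. It contains the observed algebra, which is all that
    \<open>real_cond_exp_compound\<close> asks for.\<close>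
  let ?G = "vimage_algebra (space M) (\<lambda>\<omega>. (?W \<omega>, ?V \<omega>)) (?Q \<Otimes>\<^sub>M ?VM)"
  let ?h = "\<lambda>x. paid T x - paid s0 x"
  have W: "indep_rv M ?Q ?W (count_space UNIV \<Otimes>\<^sub>M (\<Pi>\<^sub>M k\<in>{1..}. count_space UNIV \<Otimes>\<^sub>M borel)) (\<lambda>\<omega>. (N i \<alpha> \<omega>, \<lambda>k\<in>{1..}. X i k \<omega>))"
    using iT \<alpha> by (intro indep_rv_other_rows) auto
  have sub: "subalgebra M ?F"
    unfolding subalgebra_def using \<alpha>
    by (intro conjI sets_obs_alg_subset C_measurable) (auto simp: obs_alg_def space_measure_of_conv)
  have WV: "(\<lambda>\<omega>. (?W \<omega>, ?V \<omega>)) \<in> measurable M (?Q \<Otimes>\<^sub>M ?VM)"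
    using W iT \<alpha> by (intro measurable_Pair[OF _ measurable_restrict[OF C_measurable]]) (auto simp: indep_rv_def)
  have WVs: "(\<lambda>\<omega>. (?W \<omega>, ?V \<omega>)) \<in> space M \<rightarrow> space (?Q \<Otimes>\<^sub>M ?VM)"
    using measurable_space[OF WV] by auto
  have G1: "(\<lambda>\<omega>. (?W \<omega>, ?V \<omega>)) \<in> measurable ?G (?Q \<Otimes>\<^sub>M ?VM)"
    using WVs by (rule measurable_vimage_algebra1)
  have FG: "sets ?F \<subseteq> sets ?G"
  proof (rule sets_obs_alg_subset)
    fix j t assume jt: "j \<in> {1..T}" "t \<in> {1..T}" "j + t \<le> T + 1"
    show "C \<alpha> j t \<in> borel_measurable ?G"
    proof (cases "j = i")
      case True
      \<comment> \<open>For \<open>j = i\<close> the triangle condition reads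
        \<open>t \<le> s0\<close>.\<close>
      then have t: "t \<in> {1..s0}" using jt by (auto simp: s0_def)
      have "(\<lambda>p. snd p t) \<in> borel_measurable (?Q \<Otimes>\<^sub>M ?VM)"
        by (intro measurable_compose[OF measurable_snd measurable_component_singleton] t)
      from measurable_compose[OF G1 this] True t show ?thesis by simp
    next
      case False
      have "(\<lambda>p. row_sum (paid t) \<alpha> (fst p j)) \<in> borel_measurable (?Q \<Otimes>\<^sub>M ?VM)"
        using \<alpha> False jt by (intro row_sum_measurable lin_bdd_measurable lin_bdd_paid
            measurable_compose[OF measurable_fst measurable_component_singleton]) auto
      from measurable_compose[OF G1 this]
      have "(\<lambda>\<omega>. row_sum (paid t) \<alpha> (row j \<omega>)) \<in> borel_measurable ?G" using False jt by simp
      moreover have "C \<alpha> j t = (\<lambda>\<omega>. row_sum (paid t) \<alpha> (row j \<omega>))"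
        using \<alpha> by (simp add: total_eq_row_sum fun_eq_iff)
      ultimately show ?thesis by simp
    qed
  qed simp
  have FB: "\<exists>B\<in>sets (?Q \<Otimes>\<^sub>M ?VM). A = (\<lambda>\<omega>. (?W \<omega>, ?V \<omega>)) -` B \<inter> space M" if "A \<in> sets ?F" for A
    using that FG sets_vimage_algebra2[OF WVs] by auto
  have "integrable \<mu> ?h" by (intro lin_bdd_integrable lin_bdd_diff lin_bdd_paid)
  note CE = R.real_cond_exp_compound[OF this _ W _ sub, where I="{1..s0}" and g=paid, folded total_def]
  \<comment> \<open>The increment lives on delays in \<open>{s0<..T}\<close>, while
    \<open>paid t\<close> with \<open>t \<le> s0\<close> sees no delay beyond
    \<open>s0\<close>.\<close>
  have disj: "paid t x = 0" if "t \<in> {1..s0}" "?h x \<noteq> 0" for t x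
    using that s0 by (auto simp: paid_def of_bool_def split: if_splits)
  have ce: "AE \<omega> in M. real_cond_exp M ?F (total i ?h \<alpha>) \<omega> = lam i * \<alpha> * (\<integral>x. ?h x \<partial>\<mu>)"
    unfolding total_def[abs_def]
    using CE(2)[OF lin_bdd_measurable[OF lin_bdd_paid] disj FB] by (simp add: total_def[abs_def])
  interpret F: finite_measure_subalgebra M ?F by unfold_locales (rule sub)
  have int: "integrable M (total i h \<alpha>)" if "lin_bdd h" for h
    using iT \<alpha> lin_bdd_integrable(1)[OF that] by (rule integrable_total)
  have i0: "integrable M (\<lambda>\<omega>. (1 - ratio) * C \<alpha> i s0 \<omega>)"
    by (intro integrable_mult_right int lin_bdd_paid)
  have "C \<alpha> i s0 \<in> borel_measurable ?F"
    using i s0 by (intro measurable_obs_alg) (auto simp: s0_def)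
  then have meas: "AE \<omega> in M. real_cond_exp M ?F (\<lambda>\<omega>. (1 - ratio) * C \<alpha> i s0 \<omega>) \<omega> = (1 - ratio) * C \<alpha> i s0 \<omega>"
    using i0 by (intro F.real_cond_exp_F_meas borel_measurable_times) auto
  have split: "AE \<omega> in M. real_cond_exp M ?F (\<lambda>\<omega>. total i ?h \<alpha> \<omega> + (1 - ratio) * C \<alpha> i s0 \<omega>) \<omega> =
      real_cond_exp M ?F (total i ?h \<alpha>) \<omega> + real_cond_exp M ?F (\<lambda>\<omega>. (1 - ratio) * C \<alpha> i s0 \<omega>) \<omega>"
    by (rule F.real_cond_exp_add[OF int[OF lin_bdd_diff[OF lin_bdd_paid lin_bdd_paid]] i0])
  have eq: "(\<lambda>\<omega>. C \<alpha> i T \<omega> - C \<alpha> i s0 \<omega> * ratio) = (\<lambda>\<omega>. total i ?h \<alpha> \<omega> + (1 - ratio) * C \<alpha> i s0 \<omega>)"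
    by (simp add: total_diff fun_eq_iff algebra_simps)
  \<comment> \<open>Multiplied by \<open>lam i * \<alpha>\<close>, this mean becomes the centring
    constant in \<open>A1'\<close>.\<close>
  have "(\<integral>x. ?h x \<partial>\<mu>) = m T - m s0"
    unfolding m_def by (rule Bochner_Integration.integral_diff) (rule lin_bdd_integrable(1)[OF lin_bdd_paid])+
  also have "\<dots> = (ratio - 1) * m s0"
    using m_pos[of s0] s0 by (simp add: ratio_def field_simps)
  finally have mean: "(\<integral>x. ?h x \<partial>\<mu>) = (ratio - 1) * m s0" .
  from ce meas split show ?thesis
    unfolding eq mean
  proof eventually_elim
    case (elim \<omega>)
    show ?case unfolding A1'_def elim by (simp add: algebra_simps)
  qed
qed

text \<open>For \<open>s \<ge> s0\<close> the estimator sums over rows up to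
  \<open>T - s \<le> T - s0 = i - 1\<close>, so row \<open>i\<close> does not enter
  \<open>A2'\<close>. The maps from rows to paths are measurable into the product over all
  exposures, which gives independence of the processes at once.\<close>

lemma A1'_A2'_indep:
  "indep_var (\<Pi>\<^sub>M \<alpha>\<in>{0..}. borel) (\<lambda>\<omega>. \<lambda>\<alpha>\<in>{0..}. A1' \<alpha> \<omega>) (\<Pi>\<^sub>M \<alpha>\<in>{0..}. borel) (\<lambda>\<omega>. \<lambda>\<alpha>\<in>{0..}. A2' \<alpha> \<omega>)"
proof -
  let ?A = "PiM {i} (\<lambda>_. rowM)" and ?B = "PiM {1..<i} (\<lambda>_. rowM)"
  have I: "indep_var ?A (\<lambda>\<omega>. restrict (\<lambda>j. row j \<omega>) {i}) ?B (\<lambda>\<omega>. restrict (\<lambda>j. row j \<omega>) {1..<i})"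
    using i by (intro indep_var_restrict[OF rows_indep]) auto
  let ?G1 = "\<lambda>p. \<lambda>\<alpha>\<in>{0..}. (1 - ratio) * (row_sum (paid s0) \<alpha> (p i) - \<alpha> * lam i * m s0) / sqrt \<alpha>"
  let ?fh = "\<lambda>\<alpha>. f_hat T (\<lambda>j t p. row_sum (paid t) \<alpha> (p j))"
  let ?G2 = "\<lambda>p. \<lambda>\<alpha>\<in>{0..}. sqrt \<alpha> * ((\<Prod>s=s0..<T. f s) - (\<Prod>s=s0..<T. ?fh \<alpha> s p))"
  have rs: "(\<lambda>p. row_sum (paid t) \<alpha> (p j)) \<in> borel_measurable (PiM K (\<lambda>_. rowM))" if "j \<in> K" "\<alpha> \<ge> 0" for j K t \<alpha>
    using that by (intro row_sum_measurable lin_bdd_measurable lin_bdd_paid measurable_component_singleton)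
  have G1: "?G1 \<in> measurable ?A (\<Pi>\<^sub>M \<alpha>\<in>{0..}. borel)"
    by (intro measurable_restrict borel_measurable_divide borel_measurable_times borel_measurable_diff rs) auto
  have G2: "?G2 \<in> measurable ?B (\<Pi>\<^sub>M \<alpha>\<in>{0..}. borel)"
    unfolding f_hat_def using s0 i
    by (intro measurable_restrict borel_measurable_times borel_measurable_diff borel_measurable_prod
        borel_measurable_divide borel_measurable_sum rs) auto
  have e1: "?G1 \<circ> (\<lambda>\<omega>. restrict (\<lambda>j. row j \<omega>) {i}) = (\<lambda>\<omega>. \<lambda>\<alpha>\<in>{0..}. A1' \<alpha> \<omega>)"
    by (auto simp: fun_eq_iff A1'_def total_eq_row_sum)
  have fe: "?fh \<alpha> s (restrict (\<lambda>j. row j \<omega>) {1..<i}) = f_hat T (C \<alpha>) s \<omega>" if "s \<in> {s0..<T}" "\<alpha> \<ge> 0" for s \<alpha> \<omega>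
  proof -
    have "j \<in> {1..<i}" if "j \<in> {1..T-s}" for j using that \<open>s \<in> {s0..<T}\<close> s0 i by auto
    then have "(\<Sum>j=1..T-s. row_sum (paid t) \<alpha> (restrict (\<lambda>j. row j \<omega>) {1..<i} j)) = (\<Sum>j=1..T-s. C \<alpha> j t \<omega>)" for t
      using that(2) by (intro sum.cong) (auto simp: total_eq_row_sum)
    then show ?thesis by (simp add: f_hat_def)
  qed
  have e2: "?G2 \<circ> (\<lambda>\<omega>. restrict (\<lambda>j. row j \<omega>) {1..<i}) = (\<lambda>\<omega>. \<lambda>\<alpha>\<in>{0..}. A2' \<alpha> \<omega>)"
  proof -
    have "(\<Prod>s=s0..<T. ?fh \<alpha> s (restrict (\<lambda>j. row j \<omega>) {1..<i})) = (\<Prod>s=s0..<T. f_hat T (C \<alpha>) s \<omega>)" if "\<alpha> \<in> {0..}" for \<alpha> \<omega>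
      by (intro prod.cong refl fe) (use that in auto)
    then show ?thesis unfolding comp_def A2'_def by (intro ext restrict_ext) (simp only:)
  qed
  show ?thesis using indep_var_compose[OF I G1 G2] unfolding e1 e2 .
qed

end

section \<open>Mean of the product limit and conclusion\<close>

lemma normal_mean_zero:
  assumes "\<sigma> > 0"
  shows "integrable (density lborel (normal_density 0 \<sigma>)) (\<lambda>x. x)"
    and "(\<integral>x. x \<partial>density lborel (normal_density 0 \<sigma>)) = 0"
proof -
  have m: "(\<lambda>x. \<sigma> * x) \<in> borel_measurable std_normal_distribution" "(\<lambda>x. x :: real) \<in> borel_measurable borel" by measurable
  have "integrable std_normal_distribution (\<lambda>x. x)"
    using integrable_std_normal_distribution_moment[of 1] by (simp only: power_one_right)
  then have "integrable std_normal_distribution (\<lambda>x. \<sigma> * x)" by (rule integrable_mult_right)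
  then show "integrable (density lborel (normal_density 0 \<sigma>)) (\<lambda>x. x)"
    by (simp only: normal_measure_eq_distr[OF assms] integrable_distr_eq[OF m])
  have "(\<integral>x. x \<partial>std_normal_distribution) = 0"
    using integral_std_normal_distribution_moment_odd[OF odd_one] by (simp only: power_one_right)
  then show "(\<integral>x. x \<partial>density lborel (normal_density 0 \<sigma>)) = 0"
    by (simp only: normal_measure_eq_distr[OF assms] integral_distr[OF m] integral_mult_right_zero mult_zero_right)
qed

text \<open>Fubini: finite first moments of both factors make the product integrable, and the inner
  integral already vanishes.\<close>

lemma product_normal_mean_zero:
  assumes "\<sigma> > 0" "\<tau> > 0"
  defines "L \<equiv> distr (density lborel (normal_density 0 \<sigma>) \<Otimes>\<^sub>M density lborel (normal_density 0 \<tau>)) borel (\<lambda>(x, y). x * y)"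
  shows "prob_space L \<and> sets L = sets borel \<and> integrable L (\<lambda>x. x) \<and> (\<integral>x. x \<partial>L) = 0"
proof -
  let ?A = "density lborel (normal_density 0 \<sigma>)" and ?B = "density lborel (normal_density 0 \<tau>)"
  interpret A: real_distribution ?A using assms(1) by (rule real_distribution_normal)
  interpret B: real_distribution ?B using assms(2) by (rule real_distribution_normal)
  interpret AB: pair_prob_space ?A ?B ..
  have [measurable]: "(\<lambda>(x, y). x * y :: real) \<in> borel_measurable (?A \<Otimes>\<^sub>M ?B)"
    by measurable
  have int: "integrable (?A \<Otimes>\<^sub>M ?B) (\<lambda>(x, y). x * y)"
    by (rule AB.Fubini_integrable)
       (auto simp: abs_mult intro!: integrable_mult_left integrable_mult_right integrable_abs normal_mean_zero assms)
  have "(\<integral>p. (\<lambda>(x, y). x * y) p \<partial>(?A \<Otimes>\<^sub>M ?B)) = (\<integral>x. \<integral>y. x * y \<partial>?B \<partial>?A)"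
    using AB.integral_fst'[OF int] by simp
  also have "\<dots> = 0" by (simp add: normal_mean_zero(2)[OF assms(2)])
  finally have "(\<integral>p. (\<lambda>(x, y). x * y) p \<partial>(?A \<Otimes>\<^sub>M ?B)) = 0" .
  with int show ?thesis
    unfolding L_def by (auto simp: integrable_distr_eq integral_distr intro!: AB.prob_space_distr)
qed

theorem theorem4:
  fixes M :: "'a measure" and T :: nat and lam :: "nat \<Rightarrow> real"
    and N :: "nat \<Rightarrow> real \<Rightarrow> 'a \<Rightarrow> nat"
    and Dk :: "nat \<Rightarrow> nat \<Rightarrow> 'a \<Rightarrow> nat" and Zk :: "nat \<Rightarrow> nat \<Rightarrow> 'a \<Rightarrow> real"
    and D :: "'a \<Rightarrow> nat" and Z :: "'a \<Rightarrow> real"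
    and i :: nat and A1 A2 :: "real \<Rightarrow> 'a \<Rightarrow> real"
  assumes M: "prob_space M"
    and T: "T \<ge> 2"
    and lam_pos: "\<forall>j\<in>{1..T}. lam j > 0"
    and poisson: "\<forall>j\<in>{1..T}. hom_poisson_process M (lam j) (N j)"
    and D_meas: "D \<in> measurable M (count_space UNIV)"
    and Z_meas: "Z \<in> borel_measurable M"
    and D_range: "\<forall>\<omega>\<in>space M. D \<omega> \<in> {1..T}"
    and DZ_indep: "indep_rv M (count_space UNIV) D borel Z"
    and Z_sq: "integrable M (\<lambda>\<omega>. (Z \<omega>)\<^sup>2)"
    and Z_pos: "\<forall>t\<in>{1..T}. (\<integral>\<omega>. Z \<omega> * of_bool (D \<omega> = t) \<partial>M) > 0"
    and Dk_range: "\<forall>j\<in>{1..T}. \<forall>k\<ge>1. \<forall>\<omega>\<in>space M. Dk j k \<omega> \<in> {1..T}"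
    and ident: "\<forall>j\<in>{1..T}. \<forall>k\<ge>1.
        distr M (count_space UNIV \<Otimes>\<^sub>M borel) (\<lambda>\<omega>. (Dk j k \<omega>, Zk j k \<omega>))
      = distr M (count_space UNIV \<Otimes>\<^sub>M borel) (\<lambda>\<omega>. (D \<omega>, Z \<omega>))"
    and iid: "\<forall>j\<in>{1..T}. prob_space.indep_vars M (\<lambda>_. count_space UNIV \<Otimes>\<^sub>M borel)
        (\<lambda>k \<omega>. (Dk j k \<omega>, Zk j k \<omega>)) {1..}"
    and indep_within: "\<forall>j\<in>{1..T}. indep_rv M
        (\<Pi>\<^sub>M \<alpha>\<in>{0..}. count_space UNIV) (\<lambda>\<omega>. \<lambda>\<alpha>\<in>{0..}. N j \<alpha> \<omega>)
        (\<Pi>\<^sub>M k\<in>{1..}. count_space UNIV \<Otimes>\<^sub>M borel) (\<lambda>\<omega>. \<lambda>k\<in>{1..}. (Dk j k \<omega>, Zk j k \<omega>))"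
    and indep_across: "prob_space.indep_vars M
        (\<lambda>_. (\<Pi>\<^sub>M \<alpha>\<in>{0..}. count_space UNIV) \<Otimes>\<^sub>M (\<Pi>\<^sub>M k\<in>{1..}. count_space UNIV \<Otimes>\<^sub>M borel))
        (\<lambda>j \<omega>. (\<lambda>\<alpha>\<in>{0..}. N j \<alpha> \<omega>, \<lambda>k\<in>{1..}. (Dk j k \<omega>, Zk j k \<omega>))) {1..T}"
    and i: "i \<in> {1..T}" "i \<ge> 2"
    and A1_def: "A1 = (\<lambda>\<alpha> \<omega>. \<alpha> powr (-1/2) *
        real_cond_exp M (obs_alg M T (claims N Dk Zk \<alpha>))
          (\<lambda>\<omega>'. claims N Dk Zk \<alpha> i T \<omega>' - claims N Dk Zk \<alpha> i (T-i+1) \<omega>'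
                   * (\<Prod>s\<in>{T-i+1..T-1}. dev_factor M D Z s)) \<omega>)"
    and A2_def: "A2 = (\<lambda>\<alpha> \<omega>. \<alpha> powr (1/2) *
        ((\<Prod>s\<in>{T-i+1..T-1}. dev_factor M D Z s)
         - (\<Prod>s\<in>{T-i+1..T-1}. f_hat T (claims N Dk Zk \<alpha>) s \<omega>)))"
  shows "prob_space.indep_var M
           (\<Pi>\<^sub>M \<alpha>\<in>{0..}. borel) (\<lambda>\<omega>. \<lambda>\<alpha>\<in>{0..}. A1 \<alpha> \<omega>)
           (\<Pi>\<^sub>M \<alpha>\<in>{0..}. borel) (\<lambda>\<omega>. \<lambda>\<alpha>\<in>{0..}. A2 \<alpha> \<omega>)
    \<and> (\<exists>\<sigma>>0. conv_distr_at_top M A1 (density lborel (normal_density 0 \<sigma>)))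
    \<and> (\<exists>\<sigma>>0. conv_distr_at_top M A2 (density lborel (normal_density 0 \<sigma>)))
    \<and> (\<exists>L. prob_space L \<and> sets L = sets borel \<and> integrable L (\<lambda>x. x) \<and> (\<integral>x. x \<partial>L) = 0
           \<and> conv_distr_at_top M (\<lambda>\<alpha> \<omega>. A1 \<alpha> \<omega> * A2 \<alpha> \<omega>) L)"
proof -
  interpret prob_space M by fact
  define X where "X j k \<omega> = (Dk j k \<omega>, Zk j k \<omega>)" for j k \<omega>
  let ?S = "count_space UNIV \<Otimes>\<^sub>M borel :: (nat \<times> real) measure"
  define \<mu> where "\<mu> = distr M ?S (\<lambda>\<omega>. (D \<omega>, Z \<omega>))"
  have DZ [measurable]: "(\<lambda>\<omega>. (D \<omega>, Z \<omega>)) \<in> measurable M ?S" using D_meas Z_meas by measurable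
  have of_D: "(\<lambda>x. snd x * of_bool (P (fst x)) :: real) \<in> borel_measurable ?S" for P :: "nat \<Rightarrow> bool"
    by (intro borel_measurable_times measurable_snd measurable_compose[OF measurable_fst, of "\<lambda>d. of_bool (P d)"]) auto
  interpret chain_ladder M T \<mu> lam N X i
  proof unfold_locales
    show "2 \<le> i" "i \<le> T" "finite {1..T}" using i by auto
    show "\<And>j. j \<in> {1..T} \<Longrightarrow> 0 < lam j" using lam_pos by blast
    show "\<And>j. j \<in> {1..T} \<Longrightarrow> hom_poisson_process M (lam j) (N j)" using poisson by blast
    show "\<And>j. j \<in> {1..T} \<Longrightarrow> indep_vars (\<lambda>_. ?S) (X j) {1..}" using iid by (simp add: X_def[abs_def])
    show "\<And>j k. j \<in> {1..T} \<Longrightarrow> 1 \<le> k \<Longrightarrow> distr M ?S (X j k) = \<mu>"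
      using ident by (simp add: X_def[abs_def] \<mu>_def)
    show "\<And>j. j \<in> {1..T} \<Longrightarrow> indep_rv M (\<Pi>\<^sub>M \<alpha>\<in>{0..}. count_space UNIV) (\<lambda>\<omega>. \<lambda>\<alpha>\<in>{0..}. N j \<alpha> \<omega>)
        (\<Pi>\<^sub>M k\<in>{1..}. ?S) (\<lambda>\<omega>. \<lambda>k\<in>{1..}. X j k \<omega>)"
      using indep_within by (simp add: X_def)
    show "indep_vars (\<lambda>_. (\<Pi>\<^sub>M \<alpha>\<in>{0..}. count_space UNIV) \<Otimes>\<^sub>M (\<Pi>\<^sub>M k\<in>{1..}. ?S))
        (\<lambda>j \<omega>. (\<lambda>\<alpha>\<in>{0..}. N j \<alpha> \<omega>, \<lambda>k\<in>{1..}. X j k \<omega>)) {1..T}"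
      using indep_across by (simp add: X_def)
    show "integrable \<mu> (\<lambda>x. (snd x)\<^sup>2)" using Z_sq by (simp add: \<mu>_def integrable_distr_eq)
    show "AE x in \<mu>. fst x \<in> {1..T}"
    proof -
      have "{x \<in> space ?S. fst x \<in> {1..T}} = {1..T} \<times> UNIV" by (auto simp: space_pair_measure)
      then have "{x \<in> space ?S. fst x \<in> {1..T}} \<in> sets ?S" by simp
      from AE_distr_iff[OF DZ this] show ?thesis unfolding \<mu>_def using D_range by auto
    qed
    show "\<And>t. t \<in> {1..T} \<Longrightarrow> (\<integral>x. snd x * of_bool (fst x = t) \<partial>\<mu>) > 0"
      using Z_pos by (simp add: \<mu>_def integral_distr of_D)
  qed
  have claims: "claims N Dk Zk \<alpha> = C \<alpha>" for \<alpha>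
    by (simp add: fun_eq_iff claims_def total_def paid_def X_def)
  have m_eq: "m t = (\<integral>\<omega>. Z \<omega> * of_bool (D \<omega> \<le> t) \<partial>M)" for t
    using lin_bdd_measurable[OF lin_bdd_paid] unfolding m_def unfolding \<mu>_def by (simp add: integral_distr paid_def)
  have dev: "dev_factor M D Z = f"
    by (simp add: fun_eq_iff dev_factor_def f_def m_eq)
  have ivl: "{T-i+1..T-1} = {s0..<T}" using i by (auto simp: s0_def)
  have prod_f: "(\<Prod>s=s0..<T. f s) = ratio"
    unfolding f_def ratio_def
  proof (rule prod_ratio_telescope)
    show "m s \<noteq> 0" if "s0 \<le> s" "s < T" for s using m_pos[of s] s0 that by auto
    show "m s0 \<noteq> 0" using m_pos[of s0] s0 by auto
  qed (use s0 in simp)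
  have A2_eq: "A2 \<alpha> = A2' \<alpha>" if "\<alpha> \<ge> 0" for \<alpha>
    using that unfolding A2_def A2'_def claims dev ivl by (simp add: powr_half_sqrt)
  have A1_eq: "A1 \<alpha> = (\<lambda>\<omega>. \<alpha> powr (-1/2) * real_cond_exp M (obs_alg M T (C \<alpha>))
      (\<lambda>\<omega>. C \<alpha> i T \<omega> - C \<alpha> i s0 \<omega> * ratio) \<omega>)" for \<alpha>
    unfolding A1_def claims dev ivl prod_f by (simp add: s0_def)
  have A1_meas: "A1 \<alpha> \<in> borel_measurable M" for \<alpha>
    unfolding A1_eq by measurable
  have A1_AE: "AE \<omega> in M. A1 \<alpha> \<omega> = A1' \<alpha> \<omega>" if "\<alpha> \<ge> 0" for \<alpha>
  \<comment> \<open>At \<open>\<alpha> = 0\<close> both sides are 0, since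
    \<open>0 powr x = 0\<close> and division by \<open>sqrt 0\<close> yields 0.\<close>
  proof (cases "\<alpha> = 0")
    case False
    with that have \<alpha>: "\<alpha> > 0" by simp
    then have "\<alpha> powr (-1/2) = 1 / sqrt \<alpha>" by (simp add: powr_minus_divide powr_half_sqrt)
    with cond_exp_A1[OF \<alpha>] show ?thesis by (simp add: A1_eq)
  qed (simp add: A1_eq A1'_def)
  \<comment> \<open>\<open>A2\<close> agrees with \<open>A2'\<close> everywhere, so only the first
    process needs the almost sure transfer.\<close>
  have "(\<lambda>\<omega>. \<lambda>\<alpha>\<in>{0..}. A2 \<alpha> \<omega>) = (\<lambda>\<omega>. \<lambda>\<alpha>\<in>{0..}. A2' \<alpha> \<omega>)"
    by (intro ext restrict_ext) (simp add: A2_eq)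
  then have indep: "indep_var (\<Pi>\<^sub>M \<alpha>\<in>{0..}. borel) (\<lambda>\<omega>. \<lambda>\<alpha>\<in>{0..}. A1 \<alpha> \<omega>) (\<Pi>\<^sub>M \<alpha>\<in>{0..}. borel) (\<lambda>\<omega>. \<lambda>\<alpha>\<in>{0..}. A2 \<alpha> \<omega>)"
    using A1'_A2'_indep A1_meas A1_AE by (simp only:) (rule indep_var_process_cong_AE[where X'=A1'], auto)
  obtain \<sigma>1 where \<sigma>1: "\<sigma>1 > 0" "\<And>a. filterlim a at_top sequentially \<Longrightarrow> (\<And>n. a n > 0) \<Longrightarrow>
      weak_conv_m (\<lambda>n. distr M borel (A1' (a n))) (density lborel (normal_density 0 \<sigma>1))"
    using A1'_weak_conv by blast
  have A1_conv: "weak_conv_m (\<lambda>n. distr M borel (A1 (a n))) (density lborel (normal_density 0 \<sigma>1))"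
    if a: "filterlim a at_top sequentially" "\<And>n. a n > 0" for a
  proof -
    have "distr M borel (A1 (a n)) = distr M borel (A1' (a n))" for n
      using A1_AE[of "a n"] A1_meas A1'_measurable[of "a n"] a(2)[of n] by (intro distr_cong_AE) auto
    with \<sigma>1(2)[OF a] show ?thesis by simp
  qed
  define \<sigma>2 where "\<sigma>2 = sd main_term"
  have \<sigma>2: "\<sigma>2 > 0" unfolding \<sigma>2_def by (rule sd_pos[OF nondeg_main_term])
  have A2_conv: "weak_conv_m (\<lambda>n. distr M borel (A2 (a n))) (density lborel (normal_density 0 \<sigma>2))"
    if a: "filterlim a at_top sequentially" "\<And>n. a n > 0" for a
    using A2'_weak_conv[OF a] a(2) by (simp add: \<sigma>2_def A2_eq less_imp_le)
  let ?N1 = "density lborel (normal_density 0 \<sigma>1)" and ?N2 = "density lborel (normal_density 0 \<sigma>2)"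
  have rd: "real_distribution ?N1" "real_distribution ?N2"
    using \<sigma>1(1) \<sigma>2 by (auto intro: real_distribution_normal)
  define L where "L = distr (?N1 \<Otimes>\<^sub>M ?N2) borel (\<lambda>(x, y). x * y)"
  have L: "conv_distr_at_top M (\<lambda>\<alpha> \<omega>. A1 \<alpha> \<omega> * A2 \<alpha> \<omega>) L"
    unfolding L_def
  proof (rule conv_distr_at_topI, rule weak_conv_indep_mult[OF _ rd A1_conv A2_conv])
    fix b :: "nat \<Rightarrow> real" and n assume "\<And>n. b n > 0"
    then have b: "b n \<in> {0..}" by (simp add: less_imp_le)
    \<comment> \<open>Evaluating both processes at the coordinate \<open>b n\<close> turns their
      independence into that of the two variables at one exposure.\<close>
    have "(\<lambda>x. x (b n)) \<in> measurable (\<Pi>\<^sub>M \<alpha>\<in>{0..}. borel) (borel :: real measure)"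
      using b by (rule measurable_component_singleton)
    from indep_var_compose[OF indep this this] b show "indep_var borel (A1 (b n)) borel (A2 (b n))"
      by (simp add: comp_def)
  qed
  have "prob_space L \<and> sets L = sets borel \<and> integrable L (\<lambda>x. x) \<and> (\<integral>x. x \<partial>L) = 0"
    unfolding L_def using \<sigma>1(1) \<sigma>2 by (rule product_normal_mean_zero)
  with L indep \<sigma>1(1) \<sigma>2 conv_distr_at_topI[of M A1, OF A1_conv] conv_distr_at_topI[of M A2, OF A2_conv]
  show ?thesis by blast
qed

end
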